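(* Let $E$ be an arbitrary directed graph and let $K$ be a field. Then $I(P_l)$ is the largest semisimple left ideal and the largest semisimple right ideal of $L_K(E)$. It is also the largest locally left artinian and the largest locally right artinian (two-sided) ideal of $L_K(E)$. (Here "largest" means that $I(P_l)$ has the stated property and contains every ideal of the stated kind having that property.)
   Context: A directed graph $E=(E^0,E^1,s,r)$ consists of arbitrary sets $E^0$ (vertices), $E^1$ (edges) and maps $s,r:E^1\to E^0$ (source, range). A vertex $v$ is a sink if $s^{-1}(v)=\emptyset$, an infinite emitter if $s^{-1}(v)$ is infinite, and regular otherwise. A path is a vertex (length $0$) or a finite sequence of edges $e_1\cdots e_n$ with $r(e_i)=s(e_{i+1})$. Write $u\ge v$ if there is a path from $u$ to $v$, and for $v\in E^0$ put $T(v)=\{u\in E^0: v\ge u\}$ (the tree of $v$). A cycle is a path $e_1\cdots e_n$, $n>0$, with $r(e_n)=s(e_1)$ and $s(e_i)\ne s(e_j)$ for $i\neq j$. A vertex $v$ is a bifurcation if $|s^{-1}(v)|\ge 2$. A line point is a vertex $v$ whose tree $T(v)$ contains no bifurcations and no (vertices of) cycles; $P_l$ is the set of line points of $E$. The Leavitt path algebra $L_K(E)$ is the $K$-algebra generated by $\{v: v\in E^0\}\cup\{e,e^*: e\in E^1\}$ subject to: $vw=\delta_{v,w}v$ for $v,w\in E^0$; $s(e)e=e\,r(e)=e$ and $r(e)e^*=e^*s(e)=e^*$ for $e\in E^1$; $e^*e'=\delta_{e,e'}r(e)$ for $e,e'\in E^1$; $v=\sum_{s(e)=v}ee^*$ for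 every regular vertex $v$. For $X\subseteq L_K(E)$, $I(X)$ is the two-sided ideal generated by $X$. A left (right) ideal of a ring $R$ is semisimple if it is a sum of simple left (right) $R$-modules. A ring $R$ (not necessarily unital) is locally left (right) artinian if for every finite subset $X\subseteq R$ there is an idempotent $e\in R$ with $X\subseteq eRe$ and $eRe$ left (right) artinian. An ideal is said to be locally left (right) artinian if it is so as a ring. *)

theory Defs
  imports
    "Graph_Theory.Graph_Theory"
    "HOL-Algebra.QuotRing"
    "HOL-Algebra.Generated_Groups"
    "HOL-Library.Poly_Mapping"
begin

section \<open>Graphs\<close>

text \<open>
  Graphs are \<^locale>\<open>wf_digraph\<close>s: arbitrary (possibly empty or infinite) sets of vertices and arcs,
  multiple arcs and loops allowed.  The source and range maps are \<^const>\<open>tail\<close> and \<^const>\<open>head\<close>.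
\<close>

definition regular :: "('v, 'e) pre_digraph \<Rightarrow> 'v \<Rightarrow> bool" where
  "regular G v \<longleftrightarrow> v \<in> verts G \<and> out_arcs G v \<noteq> {} \<and> finite (out_arcs G v)"

definition tree :: "('v, 'e) pre_digraph \<Rightarrow> 'v \<Rightarrow> 'v set" where
  "tree G v = {u \<in> verts G. \<exists>p. pre_digraph.awalk G v p u}"

text \<open>The first disjunct is needed because \<^const>\<open>card\<close> of an infinite set is 0.\<close>

definition bifurcation :: "('v, 'e) pre_digraph \<Rightarrow> 'v \<Rightarrow> bool" where
  "bifurcation G v \<longleftrightarrow> v \<in> verts G \<and> (infinite (out_arcs G v) \<or> card (out_arcs G v) \<ge> 2)"

text \<open>
  \<^const>\<open>pre_digraph.cycle\<close> asks for distinct ranges; in a closed path the list of ranges is a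
  rotation of the list of sources.
\<close>

definition on_cycle :: "('v, 'e) pre_digraph \<Rightarrow> 'v \<Rightarrow> bool" where
  "on_cycle G v \<longleftrightarrow> (\<exists>p. pre_digraph.cycle G p \<and> v \<in> tail G ` set p)"

definition line_points :: "('v, 'e) pre_digraph \<Rightarrow> 'v set" where
  "line_points G = {v \<in> verts G. \<forall>u \<in> tree G v. \<not> bifurcation G u \<and> \<not> on_cycle G u}"


section \<open>Rings that need not be unital\<close>

text \<open>
  The notions below are stated on HOL-Algebra's ring records, but they refer only to the carrier,
  addition and multiplication, never to the \<^const>\<open>one\<close> field, so that they apply to rings without
  identity (\<^const>\<open>ideal\<close> and \<^const>\<open>genideal\<close> presuppose an identity).
\<close>

definition left_ideal :: "'a set \<Rightarrow> ('a, 'm) ring_scheme \<Rightarrow> bool" where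
  "left_ideal I R \<longleftrightarrow>
     additive_subgroup I R \<and> (\<forall>r \<in> carrier R. \<forall>x \<in> I. r \<otimes>\<^bsub>R\<^esub> x \<in> I)"

definition right_ideal :: "'a set \<Rightarrow> ('a, 'm) ring_scheme \<Rightarrow> bool" where
  "right_ideal I R \<longleftrightarrow>
     additive_subgroup I R \<and> (\<forall>r \<in> carrier R. \<forall>x \<in> I. x \<otimes>\<^bsub>R\<^esub> r \<in> I)"

definition two_sided_ideal :: "'a set \<Rightarrow> ('a, 'm) ring_scheme \<Rightarrow> bool" where
  "two_sided_ideal I R \<longleftrightarrow> left_ideal I R \<and> right_ideal I R"

definition ideal_generated :: "('a, 'm) ring_scheme \<Rightarrow> 'a set \<Rightarrow> 'a set" where
  "ideal_generated R X = \<Inter> {I. two_sided_ideal I R \<and> X \<subseteq> I}"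

text \<open>
  The submodules of the left module \<open>R\<close> are the left ideals.  Over a ring without identity,
  simplicity of a module \<open>S\<close> includes the condition \<open>R S \<noteq> 0\<close>, which also gives \<open>S \<noteq> 0\<close>.
\<close>

definition simple_left_module :: "'a set \<Rightarrow> ('a, 'm) ring_scheme \<Rightarrow> bool" where
  "simple_left_module S R \<longleftrightarrow>
     left_ideal S R \<and> (\<exists>r \<in> carrier R. \<exists>x \<in> S. r \<otimes>\<^bsub>R\<^esub> x \<noteq> \<zero>\<^bsub>R\<^esub>) \<and>
     (\<forall>T. left_ideal T R \<and> T \<subseteq> S \<longrightarrow> T = {\<zero>\<^bsub>R\<^esub>} \<or> T = S)"

definition simple_right_module :: "'a set \<Rightarrow> ('a, 'm) ring_scheme \<Rightarrow> bool" where
  "simple_right_module S R \<longleftrightarrow>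
     right_ideal S R \<and> (\<exists>r \<in> carrier R. \<exists>x \<in> S. x \<otimes>\<^bsub>R\<^esub> r \<noteq> \<zero>\<^bsub>R\<^esub>) \<and>
     (\<forall>T. right_ideal T R \<and> T \<subseteq> S \<longrightarrow> T = {\<zero>\<^bsub>R\<^esub>} \<or> T = S)"

text \<open>
  The sum of a family of submodules is the additive subgroup generated by their union; the empty
  sum is the zero ideal.
\<close>

definition semisimple_left_ideal :: "'a set \<Rightarrow> ('a, 'm) ring_scheme \<Rightarrow> bool" where
  "semisimple_left_ideal I R \<longleftrightarrow>
     left_ideal I R \<and>
     (\<exists>\<S>. (\<forall>S \<in> \<S>. simple_left_module S R) \<and> I = generate (add_monoid R) (\<Union> \<S>))"

definition semisimple_right_ideal :: "'a set \<Rightarrow> ('a, 'm) ring_scheme \<Rightarrow> bool" where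
  "semisimple_right_ideal I R \<longleftrightarrow>
     right_ideal I R \<and>
     (\<exists>\<S>. (\<forall>S \<in> \<S>. simple_right_module S R) \<and> I = generate (add_monoid R) (\<Union> \<S>))"

definition left_artinian :: "('a, 'm) ring_scheme \<Rightarrow> bool" where
  "left_artinian R \<longleftrightarrow>
     (\<forall>I :: nat \<Rightarrow> 'a set. (\<forall>n. left_ideal (I n) R \<and> I (Suc n) \<subseteq> I n) \<longrightarrow>
        (\<exists>n. \<forall>m \<ge> n. I m = I n))"

definition right_artinian :: "('a, 'm) ring_scheme \<Rightarrow> bool" where
  "right_artinian R \<longleftrightarrow>
     (\<forall>I :: nat \<Rightarrow> 'a set. (\<forall>n. right_ideal (I n) R \<and> I (Suc n) \<subseteq> I n) \<longrightarrow>
        (\<exists>n. \<forall>m \<ge> n. I m = I n))"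

text \<open>The ring \<open>eRe\<close>, with identity \<open>e\<close>, for an idempotent \<open>e\<close>.\<close>

definition corner :: "('a, 'm) ring_scheme \<Rightarrow> 'a \<Rightarrow> ('a, 'm) ring_scheme" where
  "corner R e = R\<lparr>carrier := (\<lambda>x. e \<otimes>\<^bsub>R\<^esub> x \<otimes>\<^bsub>R\<^esub> e) ` carrier R, one := e\<rparr>"

definition locally_left_artinian :: "('a, 'm) ring_scheme \<Rightarrow> bool" where
  "locally_left_artinian R \<longleftrightarrow>
     (\<forall>X. finite X \<and> X \<subseteq> carrier R \<longrightarrow>
        (\<exists>e \<in> carrier R. e \<otimes>\<^bsub>R\<^esub> e = e \<and> X \<subseteq> carrier (corner R e) \<and> left_artinian (corner R e)))"

definition locally_right_artinian :: "('a, 'm) ring_scheme \<Rightarrow> bool" where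
  "locally_right_artinian R \<longleftrightarrow>
     (\<forall>X. finite X \<and> X \<subseteq> carrier R \<longrightarrow>
        (\<exists>e \<in> carrier R. e \<otimes>\<^bsub>R\<^esub> e = e \<and> X \<subseteq> carrier (corner R e) \<and> right_artinian (corner R e)))"

definition locally_left_artinian_ideal :: "'a set \<Rightarrow> ('a, 'm) ring_scheme \<Rightarrow> bool" where
  "locally_left_artinian_ideal I R \<longleftrightarrow>
     two_sided_ideal I R \<and> locally_left_artinian (R\<lparr>carrier := I\<rparr>)"

definition locally_right_artinian_ideal :: "'a set \<Rightarrow> ('a, 'm) ring_scheme \<Rightarrow> bool" where
  "locally_right_artinian_ideal I R \<longleftrightarrow>
     two_sided_ideal I R \<and> locally_right_artinian (R\<lparr>carrier := I\<rparr>)"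

definition largest :: "('a set \<Rightarrow> bool) \<Rightarrow> 'a set \<Rightarrow> bool" where
  "largest P I \<longleftrightarrow> P I \<and> (\<forall>J. P J \<longrightarrow> J \<subseteq> I)"


section \<open>Free algebras\<close>

text \<open>
  Words form the free monoid under concatenation, so finitely supported functions on words, with
  the convolution product of \<^theory>\<open>HOL-Library.Poly_Mapping\<close>, form the free unital algebra.
\<close>

instantiation list :: (type) monoid_add
begin

definition zero_list :: "'a list" where "zero_list = []"

definition plus_list :: "'a list \<Rightarrow> 'a list \<Rightarrow> 'a list" where "plus_list = (@)"

instance by standard (simp_all add: zero_list_def plus_list_def)

end

definition free_algebra :: "'g set \<Rightarrow> ('g list \<Rightarrow>\<^sub>0 'k::field) ring" where
  "free_algebra X =
     \<lparr>carrier = {f. Poly_Mapping.keys f \<subseteq> lists X},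
      mult = (*), one = 1, zero = 0, add = (+)\<rparr>"

text \<open>The free algebra without identity: no constant term.\<close>

definition nonunital_free_algebra :: "'g set \<Rightarrow> ('g list \<Rightarrow>\<^sub>0 'k::field) set" where
  "nonunital_free_algebra X = {f. Poly_Mapping.keys f \<subseteq> lists X - {[]}}"


section \<open>Leavitt path algebras\<close>

datatype ('v, 'e) lpa_gen = Vertex 'v | Edge 'e | Ghost 'e

type_synonym ('v, 'e, 'k) lpa_free = "('v, 'e) lpa_gen list \<Rightarrow>\<^sub>0 'k"

definition lpa_gens :: "('v, 'e) pre_digraph \<Rightarrow> ('v, 'e) lpa_gen set" where
  "lpa_gens G = Vertex ` verts G \<union> Edge ` arcs G \<union> Ghost ` arcs G"

abbreviation lpa_V :: "'v \<Rightarrow> ('v, 'e, 'k::field) lpa_free" where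
  "lpa_V v \<equiv> Poly_Mapping.single [Vertex v] 1"

abbreviation lpa_E :: "'e \<Rightarrow> ('v, 'e, 'k::field) lpa_free" where
  "lpa_E e \<equiv> Poly_Mapping.single [Edge e] 1"

abbreviation lpa_Es :: "'e \<Rightarrow> ('v, 'e, 'k::field) lpa_free" where
  "lpa_Es e \<equiv> Poly_Mapping.single [Ghost e] 1"

text \<open>Each element is the difference of the two sides of a defining relation.\<close>

definition lpa_relations :: "('v, 'e) pre_digraph \<Rightarrow> ('v, 'e, 'k::field) lpa_free set" where
  "lpa_relations G =
     {lpa_V v * lpa_V w - (if v = w then lpa_V v else 0) | v w. v \<in> verts G \<and> w \<in> verts G} \<union>
     {lpa_V (tail G e) * lpa_E e - lpa_E e | e. e \<in> arcs G} \<union>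
     {lpa_E e * lpa_V (head G e) - lpa_E e | e. e \<in> arcs G} \<union>
     {lpa_V (head G e) * lpa_Es e - lpa_Es e | e. e \<in> arcs G} \<union>
     {lpa_Es e * lpa_V (tail G e) - lpa_Es e | e. e \<in> arcs G} \<union>
     {lpa_Es e * lpa_E f - (if e = f then lpa_V (head G e) else 0) | e f. e \<in> arcs G \<and> f \<in> arcs G} \<union>
     {lpa_V v - (\<Sum>e \<in> out_arcs G v. lpa_E e * lpa_Es e) | v. regular G v}"

definition lpa_ideal :: "('v, 'e) pre_digraph \<Rightarrow> ('v, 'e, 'k::field) lpa_free set" where
  "lpa_ideal G = Idl\<^bsub>free_algebra (lpa_gens G)\<^esub> (lpa_relations G)"

text \<open>
  The algebra generated by the vertices, edges and ghost edges is not assumed unital, so it is the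
  image of the nonunital free algebra in the quotient of the free algebra.  The ideal of relations
  is nevertheless generated in the unital free algebra: this makes it closed under scalars, and it
  is contained in the nonunital free algebra because the relations are.  The \<^const>\<open>one\<close> field of the
  record is inherited from the ambient quotient and carries no meaning.
\<close>

definition leavitt_path_algebra ::
    "'k::field itself \<Rightarrow> ('v, 'e) pre_digraph \<Rightarrow> ('v, 'e, 'k) lpa_free set ring" where
  "leavitt_path_algebra K G =
     (let F = free_algebra (lpa_gens G); N = lpa_ideal G
      in (F Quot N)\<lparr>carrier := (\<lambda>f. N +>\<^bsub>F\<^esub> f) ` nonunital_free_algebra (lpa_gens G)\<rparr>)"

definition lpa_vertex ::
    "'k::field itself \<Rightarrow> ('v, 'e) pre_digraph \<Rightarrow> 'v \<Rightarrow> ('v, 'e, 'k) lpa_free set" where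
  "lpa_vertex K G v = lpa_ideal G +>\<^bsub>free_algebra (lpa_gens G)\<^esub> lpa_V v"

text \<open>\<^const>\<open>genideal\<close> is meaningful only for subsets of a ring.\<close>

lemma ring_free_algebra: "ring (free_algebra X :: ('g list \<Rightarrow>\<^sub>0 'k::field) ring)"
proof (rule ringI)
  let ?C = "{f :: 'g list \<Rightarrow>\<^sub>0 'k. Poly_Mapping.keys f \<subseteq> lists X}"
  have uminus: "- f \<in> ?C" if "f \<in> ?C" for f
    using that by simp
  have add: "f + g \<in> ?C" if "f \<in> ?C" "g \<in> ?C" for f g
    using that Poly_Mapping.keys_add[of f g] by blast
  have mult: "f * g \<in> ?C" if "f \<in> ?C" "g \<in> ?C" for f g
  proof -
    have "Poly_Mapping.keys (f * g) \<subseteq> {a + b | a b. a \<in> Poly_Mapping.keys f \<and> b \<in> Poly_Mapping.keys g}"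
      by (rule keys_mult)
    with that show ?thesis
      by (fastforce simp: plus_list_def)
  qed
  have one: "1 \<in> ?C"
    by (simp add: zero_list_def)
  show "abelian_group (free_algebra X :: ('g list \<Rightarrow>\<^sub>0 'k) ring)"
  proof (rule abelian_groupI)
    fix f :: "'g list \<Rightarrow>\<^sub>0 'k"
    assume "f \<in> carrier (free_algebra X)"
    then show "\<exists>g \<in> carrier (free_algebra X). g \<oplus>\<^bsub>free_algebra X\<^esub> f = \<zero>\<^bsub>free_algebra X\<^esub>"
      using uminus by (intro bexI[of _ "- f"]) (auto simp: free_algebra_def)
  qed (use add in \<open>auto simp: free_algebra_def algebra_simps\<close>)
  show "Group.monoid (free_algebra X :: ('g list \<Rightarrow>\<^sub>0 'k) ring)"
    by (rule monoidI) (use mult one in \<open>auto simp: free_algebra_def algebra_simps\<close>)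
qed (auto simp: free_algebra_def algebra_simps)

lemma (in wf_digraph) lpa_relations_subset:
  "(lpa_relations G :: ('a, 'b, 'k::field) lpa_free set) \<subseteq> nonunital_free_algebra (lpa_gens G)"
proof -
  let ?N = "nonunital_free_algebra (lpa_gens G) :: ('a, 'b, 'k) lpa_free set"
  have diff: "f - g \<in> ?N" if "f \<in> ?N" "g \<in> ?N" for f g
    using that Poly_Mapping.keys_diff[of f g] by (auto simp: nonunital_free_algebra_def)
  have sum: "sum h A \<in> ?N" if "\<And>a. a \<in> A \<Longrightarrow> h a \<in> ?N" for h :: "'b \<Rightarrow> _" and A
    using that Poly_Mapping.keys_sum[of h A] by (fastforce simp: nonunital_free_algebra_def)
  have zero: "0 \<in> ?N"
    by (simp add: nonunital_free_algebra_def)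
  have word: "Poly_Mapping.single w 1 \<in> ?N" if "w \<in> lists (lpa_gens G)" "w \<noteq> []" for w
    using that by (auto simp: nonunital_free_algebra_def)
  have single: "Poly_Mapping.single [g] 1 \<in> ?N"
    and prod: "g' \<in> lpa_gens G \<Longrightarrow> Poly_Mapping.single [g] 1 * Poly_Mapping.single [g'] 1 \<in> ?N"
    if "g \<in> lpa_gens G" for g g'
    using that by (auto simp: mult_single plus_list_def intro: word)
  have gens: "v \<in> verts G \<Longrightarrow> Vertex v \<in> lpa_gens G"
    "e \<in> arcs G \<Longrightarrow> Edge e \<in> lpa_gens G" "e \<in> arcs G \<Longrightarrow> Ghost e \<in> lpa_gens G" for v e
    by (auto simp: lpa_gens_def)
  have ite: "(if b then lpa_V v else 0) \<in> ?N" if "v \<in> verts G" for b v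
    using that by (auto intro: single gens zero)
  have cuntz: "(\<Sum>e \<in> out_arcs G v. lpa_E e * lpa_Es e) \<in> ?N" for v
    by (rule sum, rule prod) (auto simp: out_arcs_def intro: gens)
  show ?thesis
    unfolding lpa_relations_def regular_def
    by (intro Un_least subsetI; elim CollectE exE conjE; hypsubst;
        intro diff ite cuntz prod single gens tail_in_verts head_in_verts; assumption)
qed

lemma (in wf_digraph) ideal_lpa_ideal:
  "ideal (lpa_ideal G :: ('a, 'b, 'k::field) lpa_free set) (free_algebra (lpa_gens G))"
proof -
  have "(nonunital_free_algebra (lpa_gens G) :: ('a, 'b, 'k) lpa_free set)
      \<subseteq> carrier (free_algebra (lpa_gens G))"
    by (auto simp: nonunital_free_algebra_def free_algebra_def)
  with lpa_relations_subset show ?thesis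
    unfolding lpa_ideal_def by (intro ring.genideal_ideal ring_free_algebra) blast
qed

end

theory Submission
  imports Defs
begin

text \<open>
  Multiplying on both sides, every nonzero element \<open>x\<close> of \<open>L\<close> can be reduced to \<open>y = k w + \<Sum> k\<^sub>i c\<^sub>i\<close>
  with a vertex \<open>w\<close>, a scalar \<open>k \<noteq> 0\<close> and closed walks \<open>c\<^sub>i\<close> at \<open>w\<close>, in such a way that no \<open>c\<^sub>i\<close> occurs
  or no bifurcation can be reached from \<open>w\<close>.  If \<open>x\<close> belongs to a minimal left ideal \<open>S\<close> and
  \<open>y = a x b\<close>, then \<open>y\<close> belongs to the minimal left ideal \<open>S b\<close>.  The second case cannot occur, since
  \<open>w L w\<close> is then an algebra of Laurent polynomials; hence \<open>w \<in> S b\<close>.  Minimality of \<open>L w\<close> forces \<open>w\<close> to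
  be a line point, and \<open>S \<subseteq> I(P\<^sub>l)\<close> follows.  Conversely, \<open>L v\<close> is minimal if \<open>v\<close> is a line point, and
  \<open>I(P\<^sub>l)\<close> is the sum of the left ideals \<open>L v x\<close>.

  If the path \<open>p\<close> ends in a line point, then \<open>L p p\<^sup>*\<close> is minimal, and two such idempotents are equal or
  orthogonal.  Their finite sums \<open>e\<close> are local units of \<open>I(P\<^sub>l)\<close>, and \<open>e L e\<close> is a finite sum of simple
  modules.  The reduction also shows that \<open>L\<close> is semiprime.  In a semiprime ring an idempotent with
  artinian corner belongs to every ideal that contains all minimal left ideals, so \<open>I(P\<^sub>l)\<close> contains
  every locally artinian ideal.  The statements on right ideals follow by the involution of \<open>L\<close>.

  That \<open>y \<noteq> 0\<close>, and the argument excluding cycles, rest on the graded representation of \<open>L\<close> on the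
  space spanned by the boundary paths.
\<close>

abbreviation "keys \<equiv> Poly_Mapping.keys"
abbreviation "lookup \<equiv> Poly_Mapping.lookup"
abbreviation "single \<equiv> Poly_Mapping.single"

section \<open>Left ideals of subrings\<close>

definition subgrp :: "'a::ab_group_add set \<Rightarrow> bool" where
  "subgrp T \<longleftrightarrow> 0 \<in> T \<and> (\<forall>x\<in>T. \<forall>y\<in>T. x - y \<in> T)"

lemma subgrp_zero: "subgrp T \<Longrightarrow> 0 \<in> T"
  by (simp add: subgrp_def)

lemma subgrp_diff: "subgrp T \<Longrightarrow> x \<in> T \<Longrightarrow> y \<in> T \<Longrightarrow> x - y \<in> T"
  by (simp add: subgrp_def)

lemma subgrp_uminus: "subgrp T \<Longrightarrow> x \<in> T \<Longrightarrow> - x \<in> T"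
  using subgrp_diff[of T 0 x] subgrp_zero[of T] by simp

lemma subgrp_add: "subgrp T \<Longrightarrow> x \<in> T \<Longrightarrow> y \<in> T \<Longrightarrow> x + y \<in> T"
  using subgrp_diff[of T x "- y"] subgrp_uminus[of T y] by simp

lemma subgrp_sum: "subgrp T \<Longrightarrow> (\<And>i. i \<in> A \<Longrightarrow> f i \<in> T) \<Longrightarrow> sum f A \<in> T"
  by (induction A rule: infinite_finite_induct) (auto simp: subgrp_zero subgrp_add)

definition subrng :: "'a::ring set \<Rightarrow> bool" where
  "subrng C \<longleftrightarrow> subgrp C \<and> (\<forall>x\<in>C. \<forall>y\<in>C. x * y \<in> C)"

inductive_set aspan :: "'a::ab_group_add set \<Rightarrow> 'a set" for X where
  zero: "0 \<in> aspan X"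
| base: "x \<in> X \<Longrightarrow> x \<in> aspan X"
| diff: "x \<in> aspan X \<Longrightarrow> y \<in> aspan X \<Longrightarrow> x - y \<in> aspan X"

lemma subgrp_aspan: "subgrp (aspan X)"
  by (simp add: subgrp_def aspan.zero aspan.diff)

lemma aspan_subset: "X \<subseteq> T \<Longrightarrow> subgrp T \<Longrightarrow> aspan X \<subseteq> T"
proof
  fix x assume "X \<subseteq> T" "subgrp T" "x \<in> aspan X"
  from this(3,1,2) show "x \<in> T"
    by (induction) (auto simp: subgrp_def)
qed

lemma aspan_mono: "X \<subseteq> Y \<Longrightarrow> aspan X \<subseteq> aspan Y"
  by (rule aspan_subset) (auto simp: subgrp_aspan intro: aspan.base)

lemma aspan_image:
  assumes "\<And>x y. f (x - y) = f x - f y" "x \<in> aspan X" "\<And>x. x \<in> X \<Longrightarrow> f x \<in> T" "subgrp T"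
  shows "f x \<in> T"
  using assms(2)
proof induction
  case zero
  then show ?case using assms(1)[of 0 0] subgrp_zero[OF assms(4)] by simp
next
  case (diff x y)
  then show ?case using assms(1,4) by (simp add: subgrp_diff)
qed (rule assms(3))

definition lideal :: "'a::ring set \<Rightarrow> 'a set \<Rightarrow> bool" where
  "lideal C T \<longleftrightarrow> T \<subseteq> C \<and> subgrp T \<and> (\<forall>r\<in>C. \<forall>x\<in>T. r * x \<in> T)"

definition rideal :: "'a::ring set \<Rightarrow> 'a set \<Rightarrow> bool" where
  "rideal C T \<longleftrightarrow> T \<subseteq> C \<and> subgrp T \<and> (\<forall>r\<in>C. \<forall>x\<in>T. x * r \<in> T)"

definition lsimple :: "'a::ring set \<Rightarrow> 'a set \<Rightarrow> bool" where
  "lsimple C S \<longleftrightarrow> lideal C S \<and> (\<exists>r\<in>C. \<exists>x\<in>S. r * x \<noteq> 0) \<and>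
     (\<forall>T. lideal C T \<and> T \<subseteq> S \<longrightarrow> T = {0} \<or> T = S)"

definition lart :: "'a::ring set \<Rightarrow> bool" where
  "lart C \<longleftrightarrow> (\<forall>I :: nat \<Rightarrow> 'a set. (\<forall>n. lideal C (I n) \<and> I (Suc n) \<subseteq> I n) \<longrightarrow>
     (\<exists>n. \<forall>m\<ge>n. I m = I n))"

lemma lidealD:
  assumes "lideal C T"
  shows "T \<subseteq> C" "subgrp T" "\<And>r x. r \<in> C \<Longrightarrow> x \<in> T \<Longrightarrow> r * x \<in> T"
  using assms by (auto simp: lideal_def)

lemma rideal_mult: "rideal C T \<Longrightarrow> r \<in> C \<Longrightarrow> x \<in> T \<Longrightarrow> x * r \<in> T"
  by (auto simp: rideal_def)

lemma subgrp_image_mult: "subgrp T \<Longrightarrow> subgrp ((\<lambda>z. z * x) ` T)" for x :: "'a::ring"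
  unfolding subgrp_def by (force simp: left_diff_distrib[symmetric] image_iff)

lemma lideal_image_mult:
  assumes C: "subrng C" and T: "lideal C T" and x: "x \<in> C"
  shows "lideal C ((\<lambda>z. z * x) ` T)"
  unfolding lideal_def
proof (intro conjI ballI)
  show "(\<lambda>z. z * x) ` T \<subseteq> C"
    using C T x unfolding subrng_def lideal_def by blast
  show "subgrp ((\<lambda>z. z * x) ` T)"
    using T by (simp add: lideal_def subgrp_image_mult)
  fix r y assume "r \<in> C" "y \<in> (\<lambda>z. z * x) ` T"
  then show "r * y \<in> (\<lambda>z. z * x) ` T"
    using T unfolding lideal_def by (auto simp: mult.assoc[symmetric])
qed

lemma lideal_self: "subrng C \<Longrightarrow> lideal C C"
  by (auto simp: subrng_def lideal_def)

lemma lideal_kernel: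
  assumes T: "lideal C T"
  shows "lideal C {z \<in> T. z * x = 0}"
  using T unfolding lideal_def subgrp_def by (auto simp: left_diff_distrib mult.assoc)

lemma lsimple_nonzero_eq: "lsimple C S \<Longrightarrow> lideal C T \<Longrightarrow> T \<subseteq> S \<Longrightarrow> t \<in> T \<Longrightarrow> t \<noteq> 0 \<Longrightarrow> T = S"
  by (auto simp: lsimple_def)

lemma subrng_lideal: "lideal C J \<Longrightarrow> subrng J"
  by (auto simp: lideal_def subrng_def)

lemma subrng_corner:
  fixes e :: "'a::ring"
  assumes J: "subrng J" and e: "e \<in> J" "e * e = e"
  shows "subrng ((\<lambda>x. e * x * e) ` J)"
proof -
  have "subgrp J" and mJ: "\<And>x y. x \<in> J \<Longrightarrow> y \<in> J \<Longrightarrow> x * y \<in> J" using J by (auto simp: subrng_def)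
  show ?thesis
    unfolding subrng_def subgrp_def
  proof (intro conjI ballI)
    show "0 \<in> (\<lambda>x. e * x * e) ` J"
      using subgrp_zero[OF \<open>subgrp J\<close>] by force
    fix x y assume "x \<in> (\<lambda>x. e * x * e) ` J" "y \<in> (\<lambda>x. e * x * e) ` J"
    then obtain x' y' where *: "x' \<in> J" "y' \<in> J" "x = e * x' * e" "y = e * y' * e" by blast
    then have "x - y = e * (x' - y') * e" by (simp add: algebra_simps)
    then show "x - y \<in> (\<lambda>x. e * x * e) ` J" using subgrp_diff[OF \<open>subgrp J\<close> *(1,2)] by blast
    have "x * y = e * (x' * (e * e) * y') * e" using * by (simp only: mult.assoc)
    moreover have "x' * (e * e) * y' \<in> J" using * e mJ by simp
    ultimately show "x * y \<in> (\<lambda>x. e * x * e) ` J" by blast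
  qed
qed

lemma lsimple_lideal: "lsimple C S \<Longrightarrow> lideal C S"
  by (simp add: lsimple_def)

lemma lsimple_mult: "lsimple C S \<Longrightarrow> r \<in> C \<Longrightarrow> x \<in> S \<Longrightarrow> r * x \<in> S"
  by (rule lidealD(3)[OF lsimple_lideal])

lemma lsimple_nonzero: "lsimple C S \<Longrightarrow> \<exists>x\<in>S. x \<noteq> 0"
  unfolding lsimple_def by (metis mult_zero_right)

definition left_units :: "'a::ring set \<Rightarrow> bool" where
  "left_units C \<longleftrightarrow> (\<forall>x\<in>C. \<exists>u\<in>C. u * x = x)"

lemma lsimple_principal:
  assumes C: "subrng C" "left_units C" and S: "lsimple C S" and x: "x \<in> S" "x \<noteq> 0"
  shows "S = (\<lambda>z. z * x) ` C"
proof -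
  have xC: "x \<in> C"
    using S x by (auto simp: lsimple_def lideal_def)
  then obtain u where u: "u \<in> C" "u * x = x"
    using C by (auto simp: left_units_def)
  have "(\<lambda>z. z * x) ` C \<subseteq> S"
    using S x by (auto simp: lsimple_def lideal_def)
  moreover have "x \<in> (\<lambda>z. z * x) ` C"
    using u by (metis image_eqI)
  ultimately show ?thesis
    using lsimple_nonzero_eq[OF S lideal_image_mult[OF C(1) lideal_self[OF C(1)] xC]] x by blast
qed

lemma lsimpleI:
  assumes C: "left_units C" and S: "lideal C S" "s0 \<in> S" "s0 \<noteq> 0"
    and gen: "\<And>y s. y \<in> S \<Longrightarrow> y \<noteq> 0 \<Longrightarrow> s \<in> S \<Longrightarrow> \<exists>z\<in>C. s = z * y"
  shows "lsimple C S"
  unfolding lsimple_def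
proof (intro conjI allI impI)
  obtain u where "u \<in> C" "u * s0 = s0"
    using C S unfolding left_units_def lideal_def by blast
  then show "\<exists>r\<in>C. \<exists>x\<in>S. r * x \<noteq> 0"
    using S by metis
next
  fix T assume T: "lideal C T \<and> T \<subseteq> S"
  show "T = {0} \<or> T = S"
  proof (cases "T = {0}")
    case False
    then obtain y where y: "y \<in> T" "y \<noteq> 0"
      using T by (auto simp: lideal_def subgrp_def)
    have "s \<in> T" if "s \<in> S" for s
      using gen[of y s] that T y by (auto simp: lideal_def)
    then show ?thesis
      using T by auto
  qed simp
qed (rule S)

lemma lsimple_image_mult:
  assumes C: "subrng C" "left_units C" and S: "lsimple C S" and b: "b \<in> C" and s: "s \<in> S" "s * b \<noteq> 0"
  shows "lsimple C ((\<lambda>z. z * b) ` S)"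
proof (rule lsimpleI[OF C(2)])
  show "lideal C ((\<lambda>z. z * b) ` S)"
    using S by (intro lideal_image_mult C b) (simp add: lsimple_def)
  show "s * b \<in> (\<lambda>z. z * b) ` S"
    using s by simp
next
  fix y t assume yt: "y \<in> (\<lambda>z. z * b) ` S" "y \<noteq> 0" "t \<in> (\<lambda>z. z * b) ` S"
  obtain y' t' where *: "y' \<in> S" "y = y' * b" "t' \<in> S" "t = t' * b"
    using yt by auto
  with yt have "y' \<noteq> 0"
    by auto
  from lsimple_principal[OF C S *(1) this] *(3) obtain z where "z \<in> C" "t' = z * y'"
    by auto
  then show "\<exists>z\<in>C. t = z * y"
    using * by (auto simp: mult.assoc)
qed (use s in auto)


subsection \<open>Descending chains\<close>

definition dcc :: "'a::ring set \<Rightarrow> 'a set \<Rightarrow> bool" where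
  "dcc B M \<longleftrightarrow> (\<forall>I :: nat \<Rightarrow> 'a set. (\<forall>n. lideal B (I n) \<and> I n \<subseteq> M \<and> I (Suc n) \<subseteq> I n) \<longrightarrow>
     (\<exists>n. \<forall>m\<ge>n. I m = I n))"

lemma lideal_plus:
  assumes M: "lideal B M" and A: "lideal B A" and B: "subgrp B"
  shows "lideal B {m + a | m a. m \<in> M \<and> a \<in> A}"
  unfolding lideal_def subgrp_def
proof (intro conjI ballI)
  show "{m + a | m a. m \<in> M \<and> a \<in> A} \<subseteq> B"
    using M A B by (auto simp: lideal_def intro!: subgrp_add)
  show "0 \<in> {m + a | m a. m \<in> M \<and> a \<in> A}"
    using M A by (force simp: lideal_def subgrp_def)
next
  fix x y assume "x \<in> {m + a | m a. m \<in> M \<and> a \<in> A}" "y \<in> {m + a | m a. m \<in> M \<and> a \<in> A}"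
  then obtain m a m' a' where *: "x = m + a" "y = m' + a'" "m \<in> M" "m' \<in> M" "a \<in> A" "a' \<in> A"
    by auto
  then have "x - y = (m - m') + (a - a')"
    by simp
  moreover have "m - m' \<in> M" "a - a' \<in> A"
    using * M A by (auto simp: lideal_def subgrp_def)
  ultimately show "x - y \<in> {m + a | m a. m \<in> M \<and> a \<in> A}"
    by blast
next
  fix r x assume *: "r \<in> B" "x \<in> {m + a | m a. m \<in> M \<and> a \<in> A}"
  then obtain m a where "x = m + a" "m \<in> M" "a \<in> A" by auto
  then have "r * x = r * m + r * a" "r * m \<in> M" "r * a \<in> A"
    using * M A by (auto simp: lideal_def distrib_left)
  then show "r * x \<in> {m + a | m a. m \<in> M \<and> a \<in> A}"
    by blast
qed

lemma dcc_plus: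
  assumes M: "lideal B M" "dcc B M" and A: "lideal B A"
    and simple: "\<And>T. lideal B T \<Longrightarrow> T \<subseteq> A \<Longrightarrow> T = {0} \<or> T = A"
  shows "dcc B {m + a | m a. m \<in> M \<and> a \<in> A}"
  unfolding dcc_def
proof (intro allI impI)
  fix I :: "nat \<Rightarrow> 'a set"
  assume "\<forall>n. lideal B (I n) \<and> I n \<subseteq> {m + a | m a. m \<in> M \<and> a \<in> A} \<and> I (Suc n) \<subseteq> I n"
  then have I: "lideal B (I n)" "I n \<subseteq> {m + a | m a. m \<in> M \<and> a \<in> A}" "I (Suc n) \<subseteq> I n" for n
    by auto
  have dec: "I m \<subseteq> I n" if "n \<le> m" for m n
    using that I(3) by (rule lift_Suc_antimono_le[rotated])
  have "\<forall>n. lideal B (I n \<inter> M) \<and> I n \<inter> M \<subseteq> M \<and> I (Suc n) \<inter> M \<subseteq> I n \<inter> M"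
    using I M(1) unfolding lideal_def subgrp_def by blast
  then obtain n1 where n1: "\<And>m. m \<ge> n1 \<Longrightarrow> I m \<inter> M = I n1 \<inter> M"
    using M(2)[unfolded dcc_def, rule_format, of "\<lambda>n. I n \<inter> M"] by auto
  define Q where "Q n = {a \<in> A. \<exists>m\<in>M. m + a \<in> I n}" for n
  have "lideal B (Q n)" for n
    unfolding lideal_def subgrp_def
  proof (intro conjI ballI)
    show "Q n \<subseteq> B" using A by (auto simp: Q_def lideal_def)
    show "0 \<in> Q n" using A M I(1)[of n] by (auto simp: Q_def lideal_def subgrp_def intro!: bexI[of _ 0])
  next
    fix x y assume "x \<in> Q n" "y \<in> Q n"
    then obtain m m' where *: "x \<in> A" "y \<in> A" "m \<in> M" "m' \<in> M" "m + x \<in> I n" "m' + y \<in> I n"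
      by (auto simp: Q_def)
    then have "(m + x) - (m' + y) \<in> I n"
      using I(1)[of n] unfolding lideal_def subgrp_def by blast
    also have "(m + x) - (m' + y) = (m - m') + (x - y)" by simp
    finally show "x - y \<in> Q n"
      using * A M(1) by (auto simp: Q_def lideal_def subgrp_def)
  next
    fix r x assume r: "r \<in> B" and "x \<in> Q n"
    then obtain m where *: "x \<in> A" "m \<in> M" "m + x \<in> I n"
      by (auto simp: Q_def)
    then have "r * m + r * x \<in> I n"
      using I(1)[of n] r by (auto simp: lideal_def simp flip: distrib_left)
    then show "r * x \<in> Q n"
      using * r A M(1) by (auto simp: Q_def lideal_def)
  qed
  then have Q: "Q n = {0} \<or> Q n = A" for n
    using simple[of "Q n"] by (auto simp: Q_def)
  have Qdec: "Q m \<subseteq> Q n" if "n \<le> m" for m n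
    using dec[OF that] by (auto simp: Q_def)
  obtain n2 where n2: "\<And>m. m \<ge> n2 \<Longrightarrow> Q m = Q n2"
  proof (cases "\<exists>n. Q n = {0}")
    case True
    then obtain n where "Q n = {0}" by auto
    then have "Q m = Q n" if "m \<ge> n" for m
      using Qdec[OF that] Q[of m] lidealD(2)[OF A] by (auto dest: subgrp_zero)
    then show ?thesis by (rule that)
  next
    case False
    then show ?thesis using Q by (intro that[of 0]) metis
  qed
  define N where "N = max n1 n2"
  have "I m = I N" if m: "m \<ge> N" for m
  proof
    show "I m \<subseteq> I N" using m by (rule dec)
    show "I N \<subseteq> I m"
    proof
      fix x assume x: "x \<in> I N"
      then obtain k a where ka: "x = k + a" "k \<in> M" "a \<in> A"
        using I(2) by blast
      then have "a \<in> Q N"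
        using x by (auto simp: Q_def)
      then have "a \<in> Q m"
        using n2[of N] n2[of m] m by (simp add: N_def)
      then obtain k' where k': "k' \<in> M" "k' + a \<in> I m"
        by (auto simp: Q_def)
      then have "x - (k' + a) \<in> I N"
        using x dec[OF m] I(1)[of N] unfolding lideal_def subgrp_def by blast
      moreover have "x - (k' + a) = k - k'"
        using ka by simp
      moreover have "k - k' \<in> M"
        using ka k' M by (auto simp: lideal_def subgrp_def)
      ultimately have "x - (k' + a) \<in> I N \<inter> M"
        by (metis IntI)
      then have "x - (k' + a) \<in> I m"
        using n1[of m] n1[of N] m unfolding N_def by auto
      then have "(x - (k' + a)) + (k' + a) \<in> I m"
        using k'(2) by (rule subgrp_add[OF lidealD(2)[OF I(1)]])
      then show "x \<in> I m" by simp
    qed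
  qed
  then show "\<exists>n. \<forall>m\<ge>n. I m = I n" by blast
qed

lemma dcc_sum:
  assumes B: "subgrp B" and D: "finite D"
    and A: "\<And>d. d \<in> D \<Longrightarrow> lideal B (A d)"
    and simple: "\<And>d T. d \<in> D \<Longrightarrow> lideal B T \<Longrightarrow> T \<subseteq> A d \<Longrightarrow> T = {0} \<or> T = A d"
  shows "lideal B {sum f D | f. \<forall>d\<in>D. f d \<in> A d} \<and> dcc B {sum f D | f. \<forall>d\<in>D. f d \<in> A d}"
  using D A simple
proof (induction D rule: finite_induct)
  case empty
  have "I = {0}" if "lideal B I" "I \<subseteq> {0}" for I :: "'a set"
    using that by (auto simp: lideal_def subgrp_def)
  then have "dcc B {0}"
    unfolding dcc_def by metis
  moreover have "lideal B {0}"
    using B by (auto simp: lideal_def subgrp_def)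
  ultimately show ?case by simp
next
  case (insert d D)
  have eq: "{sum f (insert d D) | f. \<forall>d\<in>insert d D. f d \<in> A d} =
    {m + a | m a. m \<in> {sum f D | f. \<forall>d\<in>D. f d \<in> A d} \<and> a \<in> A d}" (is "?L = ?R")
  proof
    show "?L \<subseteq> ?R"
    proof
      fix x assume "x \<in> ?L"
      then obtain f where "x = sum f (insert d D)" "\<forall>d\<in>insert d D. f d \<in> A d" by blast
      then have "x = sum f D + f d" "\<forall>d\<in>D. f d \<in> A d" "f d \<in> A d"
        using insert by (auto simp: add.commute)
      then show "x \<in> ?R" by blast
    qed
    show "?R \<subseteq> ?L"
    proof
      fix x assume "x \<in> ?R"
      then obtain f a where f: "x = sum f D + a" "\<forall>d\<in>D. f d \<in> A d" "a \<in> A d" by blast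
      let ?f = "f(d := a)"
      have "sum ?f D = sum f D" using insert by (intro sum.cong) auto
      then have "x = sum ?f (insert d D)" using insert f by (simp add: add.commute)
      moreover have "\<forall>d\<in>insert d D. ?f d \<in> A d" using f by auto
      ultimately show "x \<in> ?L" by blast
    qed
  qed
  from insert have IH: "lideal B {sum f D | f. \<forall>d\<in>D. f d \<in> A d}" "dcc B {sum f D | f. \<forall>d\<in>D. f d \<in> A d}"
    by auto
  show ?case
    unfolding eq using insert.prems by (intro conjI lideal_plus dcc_plus IH B) auto
qed

lemma lart_minimal:
  assumes "lart B" "F \<noteq> {}" "\<And>T. T \<in> F \<Longrightarrow> lideal B T"
  obtains T where "T \<in> F" "\<And>T'. T' \<in> F \<Longrightarrow> T' \<subseteq> T \<Longrightarrow> T' = T"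
proof (rule ccontr)
  assume "\<not> thesis"
  then have *: "\<exists>T'. T' \<in> F \<and> T' \<subset> T" if "T \<in> F" for T
    using that \<open>\<And>T. T \<in> F \<Longrightarrow> (\<And>T'. T' \<in> F \<Longrightarrow> T' \<subseteq> T \<Longrightarrow> T' = T) \<Longrightarrow> thesis\<close> by blast
  obtain T0 where "T0 \<in> F" using assms(2) by auto
  have "\<exists>I :: nat \<Rightarrow> 'a set. \<forall>n. I n \<in> F \<and> I (Suc n) \<subset> I n"
  proof (rule dependent_nat_choice)
    show "\<exists>T. T \<in> F" using \<open>T0 \<in> F\<close> by blast
    show "\<exists>T'. T' \<in> F \<and> T' \<subset> T" if "T \<in> F" for T n
      using *[OF that] .
  qed
  then obtain I :: "nat \<Rightarrow> 'a set" where "\<forall>n. I n \<in> F \<and> I (Suc n) \<subset> I n" ..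
  then have I: "I n \<in> F" "I (Suc n) \<subset> I n" for n
    by simp_all
  have "\<forall>n. lideal B (I n) \<and> I (Suc n) \<subseteq> I n"
    using assms(3)[OF I(1)] I(2) by (simp add: psubset_imp_subset)
  with assms(1) have "\<exists>n. \<forall>m\<ge>n. I m = I n"
    unfolding lart_def by (elim allE[where x = I] impE)
  then obtain n where n: "\<forall>m\<ge>n. I m = I n" ..
  have "I (Suc n) = I n" using n[rule_format, of "Suc n"] by simp
  then show False using I(2)[of n] by simp
qed


subsection \<open>Idempotents with an artinian corner\<close>

lemma artinian_corner_subset:
  assumes C: "subrng C" "left_units C"
    and semiprime: "\<And>x. x \<in> C \<Longrightarrow> x \<noteq> 0 \<Longrightarrow> \<exists>z\<in>C. x * z * x \<noteq> 0"
    and I: "lideal C I" "rideal C I" "\<And>S. lsimple C S \<Longrightarrow> S \<subseteq> I"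
    and e: "e \<in> C" "e * e = e" and art: "lart ((\<lambda>x. e * x * e) ` C)"
  shows "e \<in> I"
proof -
  define B where "B = (\<lambda>x. e * x * e) ` C"
  have mC: "x * y \<in> C" if "x \<in> C" "y \<in> C" for x y
    using C(1) that by (auto simp: subrng_def)
  have ee: "e * (e * x) = e * x" for x
    using e(2) by (metis mult.assoc)
  have Be: "e * b = b" "b * e = b" "b \<in> C" if "b \<in> B" for b
    using that e mC ee by (auto simp: B_def mult.assoc)
  have BI: "e * x * e \<in> B" if "x \<in> C" for x
    using that by (auto simp: B_def)
  have eB: "e \<in> B"
    using BI[OF e(1)] e(2) by simp
  have subB: "subgrp B"
    unfolding subgrp_def
  proof (intro conjI ballI)
    show "0 \<in> B"
      using BI[of 0] C(1) by (auto simp: subrng_def subgrp_zero)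
    fix x y assume xy: "x \<in> B" "y \<in> B"
    then have "x - y \<in> C"
      using C(1) by (auto simp: subrng_def subgrp_diff Be)
    then have "e * (x - y) * e \<in> B"
      by (rule BI)
    then show "x - y \<in> B"
      using Be xy by (simp add: algebra_simps)
  qed
  have BB: "x * y \<in> B" if "x \<in> B" "y \<in> B" for x y
  proof -
    have "e * (x * y) * e = (e * x) * (y * e)"
      by (simp only: mult.assoc)
    then have "e * (x * y) * e = x * y"
      using that Be by simp
    then show ?thesis
      using BI[of "x * y"] mC Be(3) that by metis
  qed
  have rngB: "subrng B"
    using subB BB by (auto simp: subrng_def)
  define F where "F = {T. lideal B T \<and> (\<exists>t\<in>T. e - t \<in> I)}"
  have "B \<in> F"
    using lideal_self[OF rngB] eB lidealD(2)[OF I(1)] by (force simp: F_def subgrp_zero)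
  then obtain T where T: "T \<in> F" "\<And>T'. T' \<in> F \<Longrightarrow> T' \<subseteq> T \<Longrightarrow> T' = T"
    using lart_minimal[of B F] art unfolding B_def[symmetric] F_def by blast
  have Tl: "lideal B T"
    using T(1) by (simp add: F_def)
  show ?thesis
  proof (cases "T = {0}")
    case True
    then show ?thesis using T(1) by (simp add: F_def)
  next
    case False
    define H where "H = {A. lideal B A \<and> A \<subseteq> T \<and> A \<noteq> {0}}"
    have "T \<in> H"
      using Tl False by (simp add: H_def)
    then obtain A where A: "A \<in> H" "\<And>A'. A' \<in> H \<Longrightarrow> A' \<subseteq> A \<Longrightarrow> A' = A"
      using lart_minimal[of B H] art unfolding B_def[symmetric] H_def by blast
    have Al: "lideal B A" and AT: "A \<subseteq> T" and A0: "A \<noteq> {0}"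
      using A(1) by (auto simp: H_def)
    have AB: "A \<subseteq> B"
      using Al by (simp add: lideal_def)
    have Amin: "A' = A" if "lideal B A'" "A' \<subseteq> A" "b \<in> A'" "b \<noteq> 0" for A' b
      using A(2)[of A'] that AT by (auto simp: H_def)
    have "a \<in> I" if a: "a \<in> A" "a \<noteq> 0" for a
    proof -
      have aB: "a \<in> B" using a AB by auto
      have "lsimple C ((\<lambda>z. z * a) ` C)"
      proof (rule lsimpleI[OF C(2)])
        show "lideal C ((\<lambda>z. z * a) ` C)"
          using lideal_image_mult[OF C(1) lideal_self[OF C(1)]] Be aB by auto
        show "a \<in> (\<lambda>z. z * a) ` C"
          using Be(1)[OF aB] e(1) by (metis image_eqI)
        show "a \<noteq> 0" by fact
      next
        fix y s assume y: "y \<in> (\<lambda>z. z * a) ` C" "y \<noteq> 0" and s: "s \<in> (\<lambda>z. z * a) ` C"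
        obtain z where z: "z \<in> C" "y = z * a" using y by auto
        obtain z' where z': "z' \<in> C" "s = z' * a" using s by auto
        have yC: "y \<in> C" using z Be(3)[OF aB] mC by simp
        obtain c where c: "c \<in> C" "y * c * y \<noteq> 0"
          using semiprime[OF yC y(2)] by auto
        have "y * e = y" using z Be(2)[OF aB] by (simp add: mult.assoc)
        moreover have "y * (e * c * y) = (y * e) * c * y"
          by (simp only: mult.assoc)
        ultimately have "y * c * y = y * (e * c * y)"
          by simp
        then have ne: "e * c * y \<noteq> 0"
          using c(2) by auto
        have "(e * (c * z) * e) * a = e * c * (z * (e * a))"
          by (simp only: mult.assoc)
        then have "e * c * y = (e * (c * z) * e) * a"
          using z Be(1)[OF aB] by simp
        then have inA: "e * c * y \<in> A"
          using Al a BI[OF mC[OF c(1) z(1)]] by (simp add: lideal_def)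
        have "(\<lambda>b. b * (e * c * y)) ` B = A"
        proof (rule Amin)
          show "lideal B ((\<lambda>b. b * (e * c * y)) ` B)"
            using inA AB by (intro lideal_image_mult rngB lideal_self) auto
          show "(\<lambda>b. b * (e * c * y)) ` B \<subseteq> A"
            using inA Al by (auto simp: lideal_def)
          show "e * c * y \<in> (\<lambda>b. b * (e * c * y)) ` B"
            using eB Be(1)[of "e * c * y"] inA AB by (metis image_eqI subsetD)
        qed fact
        then obtain b where b: "b \<in> B" "a = b * (e * c * y)"
          using a by blast
        then have "s = (z' * b * e * c) * y"
          using z' by (simp add: mult.assoc)
        moreover have "z' * b * e * c \<in> C"
          using z' b e c Be(3) mC by simp
        ultimately show "\<exists>z\<in>C. s = z * y" by blast
      qed
      from I(3)[OF this] show ?thesis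
        using Be(1)[OF aB] e(1) by (metis image_eqI subsetD)
    qed
    then have AI: "A \<subseteq> I"
      using subgrp_zero[OF lidealD(2)[OF I(1)]] by auto
    obtain a where a: "a \<in> A" "a \<noteq> 0"
      using A0 subgrp_zero[OF lidealD(2)[OF Al]] by auto
    have aB: "a \<in> B" using a AB by auto
    obtain c where c: "c \<in> C" "a * c * a \<noteq> 0"
      using semiprime[OF Be(3)[OF aB] a(2)] by auto
    define a1 where "a1 = (e * c * e) * a"
    have a1: "a1 \<in> A"
      using Al a BI[OF c(1)] by (simp add: lideal_def a1_def)
    have "a * a1 = (a * e) * c * (e * a)"
      unfolding a1_def by (simp only: mult.assoc)
    then have "a * a1 = a * c * a"
      using Be[OF aB] by simp
    then have aa1: "a * a1 \<noteq> 0"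
      using c by simp
    then have a1ne: "a1 \<noteq> 0" by auto
    have "(\<lambda>b. b * a1) ` A = A"
    proof (rule Amin)
      show "lideal B ((\<lambda>b. b * a1) ` A)"
        using a1 AB by (intro lideal_image_mult rngB Al) auto
      show "(\<lambda>b. b * a1) ` A \<subseteq> A"
        using a1 Al AB by (auto simp: lideal_def)
      show "a * a1 \<in> (\<lambda>b. b * a1) ` A"
        using a by auto
    qed fact
    then obtain g where g: "g \<in> A" "a1 = g * a1"
      using a1 by blast
    have gB: "g \<in> B" using g AB by auto
    have "{z \<in> A. z * a1 = 0} = {0}"
    proof (rule ccontr)
      assume ne: "{z \<in> A. z * a1 = 0} \<noteq> {0}"
      then have "{z \<in> A. z * a1 = 0} = A"
        using A(2)[of "{z \<in> A. z * a1 = 0}"] lideal_kernel[OF Al, of a1] AT by (auto simp: H_def)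
      then show False using a aa1 by blast
    qed
    moreover have "g * g - g \<in> {z \<in> A. z * a1 = 0}"
      using g gB Al by (auto simp: lideal_def left_diff_distrib mult.assoc intro!: subgrp_diff)
    ultimately have gg: "g * g = g" by auto
    have gne: "g \<noteq> 0" using g a1ne by auto
    define T' where "T' = {b \<in> T. b * g = 0}"
    obtain t where t: "t \<in> T" "e - t \<in> I"
      using T(1) by (auto simp: F_def)
    have tB: "t \<in> B" using t Tl by (auto simp: lideal_def)
    have tg: "t * g \<in> T" "t * g \<in> I"
      using lidealD(3)[OF Tl tB] lidealD(3)[OF I(1) Be(3)[OF tB]] g AT AI by auto
    have "t - t * g \<in> T'"
      using t tg gg Tl by (auto simp: T'_def left_diff_distrib mult.assoc lideal_def intro: subgrp_diff)
    moreover have "e - (t - t * g) = (e - t) + t * g"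
      by simp
    then have "e - (t - t * g) \<in> I"
      using subgrp_add[OF lidealD(2)[OF I(1)] t(2) tg(2)] by metis
    moreover have "lideal B T'"
      unfolding T'_def by (rule lideal_kernel[OF Tl])
    ultimately have "T' \<in> F"
      by (auto simp: F_def)
    then have "T' = T"
      by (rule T(2)) (auto simp: T'_def)
    then have "g * g = 0"
      using g AT by (auto simp: T'_def)
    then show ?thesis using gg gne by simp
  qed
qed

section \<open>Walks in graphs\<close>

context wf_digraph
begin

definition nobif :: "'a \<Rightarrow> bool" where
  "nobif v \<longleftrightarrow> (\<forall>u\<in>tree G v. \<not> bifurcation G u)"

lemma mem_tree_iff: "u \<in> tree G v \<longleftrightarrow> (\<exists>p. awalk v p u)"
  by (auto simp: tree_def)

lemma tree_refl: "v \<in> verts G \<Longrightarrow> v \<in> tree G v"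
  by (auto simp: mem_tree_iff awalk_Nil_iff intro: exI[of _ "[]"])

lemma tree_trans: "u \<in> tree G v \<Longrightarrow> w \<in> tree G u \<Longrightarrow> w \<in> tree G v"
  unfolding mem_tree_iff using awalk_appendI by blast

lemma line_points_tree: "v \<in> line_points G \<Longrightarrow> u \<in> tree G v \<Longrightarrow> u \<in> line_points G"
  unfolding line_points_def using tree_trans by (auto simp: tree_def)

lemma nobif_tree: "nobif v \<Longrightarrow> u \<in> tree G v \<Longrightarrow> nobif u"
  unfolding nobif_def using tree_trans by blast

lemma line_points_verts: "v \<in> line_points G \<Longrightarrow> v \<in> verts G"
  by (simp add: line_points_def)

lemma line_points_nobif: "v \<in> line_points G \<Longrightarrow> nobif v"
  by (simp add: line_points_def nobif_def)

lemma bifurcationE: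
  assumes "bifurcation G u"
  obtains e f where "e \<in> out_arcs G u" "f \<in> out_arcs G u" "e \<noteq> f"
proof -
  have "\<exists>e f. e \<in> out_arcs G u \<and> f \<in> out_arcs G u \<and> e \<noteq> f"
  proof (rule ccontr)
    assume *: "\<not> ?thesis"
    then have "out_arcs G u = {} \<or> (\<exists>e. out_arcs G u = {e})" by blast
    with assms show False by (auto simp: bifurcation_def)
  qed
  with that show thesis by blast
qed

lemma bifurcationI:
  assumes "e \<in> out_arcs G u" "f \<in> out_arcs G u" "e \<noteq> f"
  shows "bifurcation G u"
proof -
  have "card {e, f} \<le> card (out_arcs G u)" if "finite (out_arcs G u)"
    using assms that by (intro card_mono) auto
  with assms show ?thesis
    by (auto simp: bifurcation_def)
qed

lemma nobif_arc_unique: "nobif v \<Longrightarrow> e \<in> arcs G \<Longrightarrow> f \<in> arcs G \<Longrightarrow> tail G e = v \<Longrightarrow> tail G f = v \<Longrightarrow> e = f"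
  using bifurcationI[of e v f] tree_refl[of v] tail_in_verts[of e] by (auto simp: nobif_def)

lemma nobif_out_arcs: "nobif v \<Longrightarrow> e \<in> arcs G \<Longrightarrow> tail G e = v \<Longrightarrow> out_arcs G v = {e}"
  using nobif_arc_unique by auto

lemma awalk_append_drop:
  assumes "awalk u q w" "awalk u' (q @ r) v" "q = [] \<longrightarrow> u' = w"
  shows "awalk w r v"
proof -
  obtain x where "awalk u' q x" "awalk x r v"
    using assms(2) by auto
  then show ?thesis
    using awalk_ends[OF assms(1)] assms(3) by (cases "q = []") (auto simp: awalk_Nil_iff)
qed

lemma closed_walk_on_cycle: "awalk u c u \<Longrightarrow> c \<noteq> [] \<Longrightarrow> \<exists>w\<in>tree G u. on_cycle G w"
proof (induction "length c" arbitrary: u c rule: less_induct)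
  case less
  show ?case
  proof (cases "distinct (tl (awalk_verts u c))")
    case True
    obtain e es where "c = e # es" using less.prems(2) by (cases c) auto
    moreover from this have "tail G e = u" using less.prems(1) by (simp add: awalk_Cons_iff)
    moreover have "cycle c" using less.prems True by (auto simp: cycle_def)
    ultimately have "on_cycle G u"
      by (force simp: on_cycle_def)
    then show ?thesis
      using tree_refl[of u] awalk_hd_in_verts[OF less.prems(1)] by blast
  next
    case False
    then obtain e es where c: "c = e # es" by (cases c) auto
    with False less.prems have *: "awalk (head G e) es u" "\<not> distinct (awalk_verts (head G e) es)"
      and e: "e \<in> arcs G" "tail G e = u"
      by (auto simp: awalk_Cons_iff)
    obtain q r s w where r: "es = q @ r @ s" "0 < length r" "awalk (head G e) q w" "awalk w r w"
      using awalk_not_distinct_decomp[OF *] by blast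
    then have "\<exists>w'\<in>tree G w. on_cycle G w'"
      by (intro less.hyps[of r]) (auto simp: c)
    moreover have "awalk u (e # q) w"
      using r e by (simp add: awalk_Cons_iff)
    then have "w \<in> tree G u"
      by (auto simp: mem_tree_iff)
    ultimately show ?thesis
      using tree_trans by blast
  qed
qed

lemma line_point_no_closed_walk: "v \<in> line_points G \<Longrightarrow> awalk v c v \<Longrightarrow> c = []"
  using closed_walk_on_cycle[of v c] by (auto simp: line_points_def)

lemma on_cycle_closed_walk:
  assumes "on_cycle G u"
  obtains c where "c \<noteq> []" "awalk u c u"
proof -
  obtain p a where p: "awalk a p a" "u \<in> tail G ` set p"
    using assms by (auto simp: on_cycle_def cycle_def)
  then obtain e p1 p2 where "p = p1 @ e # p2" "u = tail G e"
    by (auto dest: split_list)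
  with p have "awalk u ((e # p2) @ p1) u"
    by (auto simp: awalk_Cons_iff)
  then show thesis by (intro that) auto
qed

text \<open>
  If \<open>p e\<close> and \<open>p f\<close> were both prefixes of powers of the closed walk \<open>c\<close>, they would be equal.
\<close>

lemma aperiodic_walk:
  assumes "\<not> nobif w" "awalk w c w" "c \<noteq> []"
  obtains q w' where "awalk w q w'" "take (length q) (c @ q) \<noteq> q"
proof -
  obtain u where u: "u \<in> tree G w" "bifurcation G u"
    using assms by (auto simp: nobif_def)
  obtain e f where ef: "e \<in> out_arcs G u" "f \<in> out_arcs G u" "e \<noteq> f"
    using u bifurcationE by blast
  obtain p where p: "awalk w p u"
    using u by (auto simp: mem_tree_iff)
  have "awalk w (p @ [e]) (head G e)" "awalk w (p @ [f]) (head G f)"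
    using p ef by (auto simp: awalk_simps)
  moreover have "take (length (p @ [e])) (c @ p @ [e]) = take (length (p @ [f])) (c @ p @ [f])"
    using assms(3) by (cases c) auto
  then have "take (length (p @ [e])) (c @ p @ [e]) \<noteq> p @ [e] \<or> take (length (p @ [f])) (c @ p @ [f]) \<noteq> p @ [f]"
    using ef(3) by (metis last_snoc)
  ultimately show thesis
    using that by blast
qed

end


section \<open>Leavitt families\<close>

lemma sum_keys_diff:
  fixes f g :: "'a \<Rightarrow>\<^sub>0 'b::ab_group_add" and F :: "'a \<Rightarrow> 'b \<Rightarrow> 'c::ab_group_add"
  assumes "\<And>k a b. F k (a - b) = F k a - F k b"
  shows "(\<Sum>k\<in>keys (f - g). F k (lookup (f - g) k)) =
    (\<Sum>k\<in>keys f. F k (lookup f k)) - (\<Sum>k\<in>keys g. F k (lookup g k))"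
proof -
  let ?A = "keys f \<union> keys g"
  have F0: "F k 0 = 0" for k using assms[of k 0 0] by simp
  have *: "(\<Sum>k\<in>keys h. F k (lookup h k)) = (\<Sum>k\<in>?A. F k (lookup h k))"
    if "keys h \<subseteq> ?A" for h
    using that F0 by (intro sum.mono_neutral_left) (auto simp: in_keys_iff)
  show ?thesis
    unfolding *[OF keys_diff] *[OF Un_upper1] *[OF Un_upper2]
    by (simp add: lookup_minus assms sum_subtractf)
qed

locale leavitt_family = wf_digraph G for G :: "('v, 'e) pre_digraph" +
  fixes V :: "'v \<Rightarrow> 'a::ring_1" and E Es :: "'e \<Rightarrow> 'a" and S :: "'k::field \<Rightarrow> 'a"
  assumes V_V: "v \<in> verts G \<Longrightarrow> w \<in> verts G \<Longrightarrow> V v * V w = (if v = w then V v else 0)"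
    and V_tail_E: "e \<in> arcs G \<Longrightarrow> V (tail G e) * E e = E e"
    and E_V_head: "e \<in> arcs G \<Longrightarrow> E e * V (head G e) = E e"
    and V_head_Es: "e \<in> arcs G \<Longrightarrow> V (head G e) * Es e = Es e"
    and Es_V_tail: "e \<in> arcs G \<Longrightarrow> Es e * V (tail G e) = Es e"
    and Es_E: "e \<in> arcs G \<Longrightarrow> f \<in> arcs G \<Longrightarrow> Es e * E f = (if e = f then V (head G e) else 0)"
    and CK: "regular G v \<Longrightarrow> V v = (\<Sum>e\<in>out_arcs G v. E e * Es e)"
    and S_add: "S (a + b) = S a + S b"
    and S_mult: "S (a * b) = S a * S b"
    and S_one_V: "v \<in> verts G \<Longrightarrow> S 1 * V v = V v"
    and S_V: "v \<in> verts G \<Longrightarrow> S a * V v = V v * S a"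
    and S_E: "e \<in> arcs G \<Longrightarrow> S a * E e = E e * S a"
    and S_Es: "e \<in> arcs G \<Longrightarrow> S a * Es e = Es e * S a"
begin

definition P :: "'e list \<Rightarrow> 'a" where "P p = prod_list (map E p)"

definition Q :: "'e list \<Rightarrow> 'a" where "Q p = prod_list (map Es (rev p))"

definition mono :: "'k \<Rightarrow> 'e list \<Rightarrow> 'v \<Rightarrow> 'e list \<Rightarrow> 'a" where
  "mono k p w q = S k * (P p * (V w * Q q))"

definition Cn :: "nat \<Rightarrow> 'a set" where
  "Cn n = aspan {mono k p w q | k p w q u u'. awalk u p w \<and> awalk u' q w \<and> length q \<le> n}"

definition C :: "'a set" where
  "C = aspan {mono k p w q | k p w q u u'. awalk u p w \<and> awalk u' q w}"

lemma P_simps: "P [] = 1" "P (e # p) = E e * P p" "P (p @ q) = P p * P q"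
  by (simp_all add: P_def)

lemma Q_simps: "Q [] = 1" "Q (e # p) = Q p * Es e" "Q (p @ q) = Q q * Q p"
  by (simp_all add: Q_def)

lemma S_zero [simp]: "S 0 = 0"
  using S_add[of 0 0] by simp

lemma S_minus: "S (- a) = - S a"
  using S_add[of a "- a"] by (simp add: eq_neg_iff_add_eq_0 add.commute)

lemma S_diff: "S (a - b) = S a - S b"
  using S_add[of a "- b"] by (simp add: S_minus)

lemma V_E: "v \<in> verts G \<Longrightarrow> e \<in> arcs G \<Longrightarrow> V v * E e = (if v = tail G e then E e else 0)"
  using V_V[of v "tail G e"] V_tail_E[of e] by (metis mult.assoc mult_zero_left tail_in_verts)

lemma E_V: "v \<in> verts G \<Longrightarrow> e \<in> arcs G \<Longrightarrow> E e * V v = (if v = head G e then E e else 0)"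
  using V_V[of "head G e" v] E_V_head[of e] by (metis mult.assoc mult_zero_right head_in_verts)

lemma Es_V: "v \<in> verts G \<Longrightarrow> e \<in> arcs G \<Longrightarrow> Es e * V v = (if v = tail G e then Es e else 0)"
  using V_V[of "tail G e" v] Es_V_tail[of e] by (metis mult.assoc mult_zero_right tail_in_verts)

lemma E_S_left: "e \<in> arcs G \<Longrightarrow> E e * (S a * x) = S a * (E e * x)"
  by (metis S_E mult.assoc)

lemma Es_S_left: "e \<in> arcs G \<Longrightarrow> Es e * (S a * x) = S a * (Es e * x)"
  by (metis S_Es mult.assoc)

lemma V_S_left: "v \<in> verts G \<Longrightarrow> V v * (S a * x) = S a * (V v * x)"
  by (metis S_V mult.assoc)

lemma P_S_left: "set p \<subseteq> arcs G \<Longrightarrow> P p * (S a * x) = S a * (P p * x)"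
  by (induction p) (auto simp: P_simps mult.assoc E_S_left)

lemma Q_S_left: "set p \<subseteq> arcs G \<Longrightarrow> Q p * (S a * x) = S a * (Q p * x)"
  by (induction p arbitrary: x) (auto simp: Q_simps mult.assoc Es_S_left)

lemma V_P_V:
  assumes "awalk u p w" "v \<in> verts G"
  shows "V v * (P p * V w) = (if v = u then P p * V w else 0)"
proof (cases p)
  case Nil
  with assms show ?thesis by (auto simp: P_simps V_V awalk_Nil_iff)
next
  case (Cons e p')
  then have "e \<in> arcs G" "u = tail G e"
    using assms by (auto simp: awalk_Cons_iff)
  then show ?thesis
    using V_E[OF assms(2), of e] Cons by (auto simp: P_simps simp flip: mult.assoc)
qed

lemma V_P_V_left:
  assumes "awalk u p w" "v \<in> verts G"
  shows "V v * (P p * (V w * x)) = (if v = u then P p * (V w * x) else 0)"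
  using V_P_V[OF assms] by (metis mult.assoc mult_zero_left)

lemma V_Q_V:
  assumes "awalk u q w" "v \<in> verts G"
  shows "V w * (Q q * V v) = (if v = u then V w * Q q else 0)"
proof (cases q)
  case Nil
  with assms show ?thesis by (auto simp: Q_simps V_V awalk_Nil_iff)
next
  case (Cons e q')
  then have "e \<in> arcs G" "u = tail G e"
    using assms by (auto simp: awalk_Cons_iff)
  then show ?thesis
    using Es_V[OF assms(2), of e] Cons by (auto simp: Q_simps mult.assoc)
qed

lemma Q_P_V: "awalk u p w \<Longrightarrow> Q p * (P p * V w) = V w"
proof (induction p arbitrary: u)
  case Nil
  then show ?case by (simp add: P_simps Q_simps)
next
  case (Cons e p)
  then have e: "e \<in> arcs G" and p: "awalk (head G e) p w"
    by (auto simp: awalk_Cons_iff)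
  have "Q (e # p) * (P (e # p) * V w) = Q p * ((Es e * E e) * (P p * V w))"
    by (simp add: P_simps Q_simps mult.assoc)
  also have "(Es e * E e) * (P p * V w) = P p * V w"
    using e p by (simp add: Es_E V_P_V)
  finally show ?case using Cons.IH[OF p] by simp
qed

lemma V_Q_P_V:
  assumes "awalk u q w" "awalk u' p v" "length q \<le> length p"
  shows "V w * (Q q * (P p * V v)) =
    (if take (length q) p = q \<and> (q = [] \<longrightarrow> u' = w) then P (drop (length q) p) * V v else 0)"
  using assms
proof (induction q arbitrary: u u' p)
  case Nil
  then show ?case by (auto simp: Q_simps V_P_V awalk_Nil_iff)
next
  case (Cons e q)
  then obtain f p' where p: "p = f # p'" by (cases p) auto
  from Cons have e: "e \<in> arcs G" "awalk (head G e) q w" by (auto simp: awalk_Cons_iff)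
  from Cons p have f: "f \<in> arcs G" "awalk (head G f) p' v" by (auto simp: awalk_Cons_iff)
  have *: "V w * (Q (e # q) * (P p * V v)) = V w * (Q q * ((Es e * E f) * (P p' * V v)))"
    by (simp add: p P_simps Q_simps mult.assoc)
  show ?case
  proof (cases "e = f")
    case False
    then show ?thesis by (simp add: * Es_E e f) (simp add: p)
  next
    case True
    then have "(Es e * E f) * (P p' * V v) = P p' * V v"
      using f by (simp add: Es_E V_P_V)
    moreover have "q = [] \<Longrightarrow> head G e = w"
      using e by (auto simp: awalk_Nil_iff)
    ultimately show ?thesis
      using Cons.IH[OF e(2) f(2)] Cons.prems(3) True unfolding * by (auto simp: p)
  qed
qed

lemma V_eq_P_Q:
  assumes "awalk v q w" "nobif v"
  shows "V v = P q * (V w * Q q)"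
  using assms
proof (induction q arbitrary: v)
  case Nil
  then show ?case by (auto simp: P_simps Q_simps awalk_Nil_iff)
next
  case (Cons e q)
  then have e: "e \<in> arcs G" "tail G e = v" "awalk (head G e) q w" by (auto simp: awalk_Cons_iff)
  have "head G e \<in> tree G v"
    using e arc_implies_awalk[OF e(1)] by (auto simp: mem_tree_iff)
  then have IH: "V (head G e) = P q * (V w * Q q)"
    using Cons.IH e(3) Cons.prems(2) nobif_tree by blast
  have out: "out_arcs G v = {e}"
    using Cons.prems e by (intro nobif_out_arcs)
  then have "regular G v"
    using e tail_in_verts by (auto simp: regular_def)
  then have "V v = E e * Es e"
    using CK out by simp
  also have "\<dots> = E e * V (head G e) * Es e"
    using e by (simp add: E_V_head)
  finally show ?case
    by (simp add: IH P_simps Q_simps mult.assoc)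
qed


subsection \<open>The algebra\<close>

lemma S_mono: "S j * mono k p w q = mono (j * k) p w q"
  by (simp add: mono_def S_mult mult.assoc)

lemma V_mono: "awalk u p w \<Longrightarrow> v \<in> verts G \<Longrightarrow> V v * mono k p w q = (if v = u then mono k p w q else 0)"
  by (simp add: mono_def V_S_left V_P_V_left)

lemma mono_V: "awalk u q w \<Longrightarrow> v \<in> verts G \<Longrightarrow> mono k p w q * V v = (if v = u then mono k p w q else 0)"
  by (simp add: mono_def mult.assoc V_Q_V)

lemma E_mono:
  assumes "awalk u p w" "e \<in> arcs G"
  shows "E e * mono k p w q = (if head G e = u then mono k (e # p) w q else 0)"
proof -
  have "E e * mono k p w q = E e * V (head G e) * mono k p w q"
    using assms by (simp add: E_V_head)
  also have "\<dots> = E e * (V (head G e) * mono k p w q)"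
    by (simp only: mult.assoc)
  also have "\<dots> = (if head G e = u then mono k (e # p) w q else 0)"
    using assms by (simp add: V_mono) (simp add: mono_def P_simps E_S_left mult.assoc)
  finally show ?thesis .
qed

lemma Es_mono_Nil:
  assumes "awalk u q w" "e \<in> arcs G"
  shows "Es e * mono k [] w q = (if tail G e = w then mono k [] (head G e) (q @ [e]) else 0)"
proof -
  have "w \<in> verts G" using assms by auto
  have "Es e * mono k [] w q = S k * ((Es e * V w) * Q q)"
    using assms by (simp add: mono_def Es_S_left P_simps mult.assoc)
  also have "Es e * V w = (if tail G e = w then V (head G e) * Es e else 0)"
    using assms \<open>w \<in> verts G\<close> by (simp add: Es_V V_head_Es)
  finally show ?thesis by (simp add: mono_def P_simps Q_simps mult.assoc)
qed

lemma Es_mono_Cons: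
  assumes "awalk u (f # p) w" "e \<in> arcs G"
  shows "Es e * mono k (f # p) w q = (if e = f then mono k p w q else 0)"
proof -
  have f: "f \<in> arcs G" "awalk (head G f) p w" using assms by (auto simp: awalk_Cons_iff)
  have "Es e * mono k (f # p) w q = S k * ((Es e * E f) * (P p * (V w * Q q)))"
    using assms by (simp add: mono_def Es_S_left P_simps mult.assoc)
  then show ?thesis
    using assms f by (simp add: Es_E V_P_V_left mono_def)
qed

lemma mono_E_Nil:
  assumes "w \<in> verts G" "e \<in> arcs G"
  shows "mono k p w [] * E e = (if tail G e = w then mono k (p @ [e]) (head G e) [] else 0)"
  using assms V_E[OF assms] E_V_head[of e] by (simp add: mono_def P_simps Q_simps mult.assoc)

lemma mono_E_Cons:
  assumes "awalk u (f # q) w" "e \<in> arcs G"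
  shows "mono k p w (f # q) * E e = (if e = f then mono k p w q else 0)"
proof -
  have f: "f \<in> arcs G" "awalk (head G f) q w" using assms by (auto simp: awalk_Cons_iff)
  have "mono k p w (f # q) * E e = S k * (P p * (V w * (Q q * (Es f * E e))))"
    using assms by (simp add: mono_def Q_simps mult.assoc)
  then show ?thesis
    using assms f by (simp add: Es_E V_Q_V mono_def)
qed

lemma mono_in_C: "awalk u p w \<Longrightarrow> awalk u' q w \<Longrightarrow> mono k p w q \<in> C"
  unfolding C_def by (rule aspan.base) blast

lemma mono_in_Cn: "awalk u p w \<Longrightarrow> awalk u' q w \<Longrightarrow> length q \<le> n \<Longrightarrow> mono k p w q \<in> Cn n"
  unfolding Cn_def by (rule aspan.base) blast

lemma subgrp_C: "subgrp C"
  unfolding C_def by (rule subgrp_aspan)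

lemma subgrp_Cn: "subgrp (Cn n)"
  unfolding Cn_def by (rule subgrp_aspan)

lemma C_induct [consumes 1, case_names zero mono diff]:
  assumes "x \<in> C" "R 0"
    "\<And>k p w q u u'. awalk u p w \<Longrightarrow> awalk u' q w \<Longrightarrow> R (mono k p w q)"
    "\<And>x y. x \<in> C \<Longrightarrow> y \<in> C \<Longrightarrow> R x \<Longrightarrow> R y \<Longrightarrow> R (x - y)"
  shows "R x"
  using assms(1) unfolding C_def
proof induction
  case (diff x y)
  then show ?case by (intro assms(4)) (simp_all only: C_def)
next
  case (base x)
  then show ?case using assms(3) by blast
qed (rule assms(2))

lemma Cn_mono: "m \<le> n \<Longrightarrow> Cn m \<subseteq> Cn n"
  unfolding Cn_def by (rule aspan_mono) (blast intro: le_trans)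

lemma C_in_Cn: "x \<in> C \<Longrightarrow> \<exists>n. x \<in> Cn n"
proof (induction rule: C_induct)
  case zero
  then show ?case using subgrp_zero[OF subgrp_Cn] by blast
next
  case (mono k p w q u u')
  then show ?case using mono_in_Cn by blast
next
  case (diff x y)
  then obtain m n where "x \<in> Cn m" "y \<in> Cn n" by blast
  then have "x \<in> Cn (max m n)" "y \<in> Cn (max m n)"
    using Cn_mono[of m "max m n"] Cn_mono[of n "max m n"] by auto
  then show ?case using subgrp_diff[OF subgrp_Cn] by blast
qed

lemma left_mult_C:
  assumes "x \<in> C" "\<And>k p w q u u'. awalk u p w \<Longrightarrow> awalk u' q w \<Longrightarrow> a * mono k p w q \<in> C"
  shows "a * x \<in> C"
  using assms(1)
proof (induction rule: C_induct)
  case (mono k p w q u u')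
  then show ?case by (rule assms(2))
qed (simp_all add: right_diff_distrib subgrp_zero[OF subgrp_C] subgrp_diff[OF subgrp_C])

lemma S_C: "x \<in> C \<Longrightarrow> S k * x \<in> C"
  by (erule left_mult_C) (simp add: S_mono mono_in_C)

lemma V_C: "x \<in> C \<Longrightarrow> v \<in> verts G \<Longrightarrow> V v * x \<in> C"
  by (erule left_mult_C) (simp add: V_mono mono_in_C subgrp_zero[OF subgrp_C])

lemma E_C:
  assumes "x \<in> C" "e \<in> arcs G"
  shows "E e * x \<in> C"
  using assms(1)
proof (rule left_mult_C)
  fix k p w q u u' assume *: "awalk u p w" "awalk u' q w"
  then have "awalk (tail G e) (e # p) w" if "head G e = u"
    using assms that by (simp add: awalk_Cons_iff)
  then show "E e * mono k p w q \<in> C"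
    using * assms mono_in_C[of "tail G e" "e # p" w u' q k]
    by (auto simp: E_mono subgrp_zero[OF subgrp_C])
qed

lemma Es_C:
  assumes "x \<in> C" "e \<in> arcs G"
  shows "Es e * x \<in> C"
  using assms(1)
proof (rule left_mult_C)
  fix k p w q u u' assume *: "awalk u p w" "awalk u' q w"
  show "Es e * mono k p w q \<in> C"
  proof (cases p)
    case Nil
    have "awalk u' (q @ [e]) (head G e)" "awalk (head G e) [] (head G e)" if "tail G e = w"
      using * assms that by (auto simp: awalk_simps)
    then have "mono k [] (head G e) (q @ [e]) \<in> C" if "tail G e = w"
      using that mono_in_C by blast
    then show ?thesis
      using Nil * assms(2) by (simp add: Es_mono_Nil subgrp_zero[OF subgrp_C])
  next
    case (Cons f p')
    then have "awalk (head G f) p' w" "Es e * mono k p w q = (if e = f then mono k p' w q else 0)"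
      using * assms(2) by (auto simp: Es_mono_Cons awalk_Cons_iff)
    then show ?thesis
      using * by (simp add: mono_in_C subgrp_zero[OF subgrp_C])
  qed
qed

lemma P_C: "x \<in> C \<Longrightarrow> set p \<subseteq> arcs G \<Longrightarrow> P p * x \<in> C"
  by (induction p) (auto simp: P_simps mult.assoc E_C)

lemma Q_C: "x \<in> C \<Longrightarrow> set p \<subseteq> arcs G \<Longrightarrow> Q p * x \<in> C"
  by (induction p arbitrary: x) (auto simp: Q_simps mult.assoc Es_C)

lemma C_mult:
  assumes "x \<in> C" "y \<in> C"
  shows "x * y \<in> C"
  using assms(1)
proof (induction rule: C_induct)
  case zero
  then show ?case by (simp add: subgrp_zero[OF subgrp_C])
next
  case (mono k p w q u u')
  then have "set p \<subseteq> arcs G" "set q \<subseteq> arcs G" "w \<in> verts G" by auto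
  then show ?case
    using assms(2) by (simp add: mono_def mult.assoc S_C P_C V_C Q_C)
next
  case (diff x y)
  then show ?case by (simp add: left_diff_distrib subgrp_diff[OF subgrp_C])
qed

lemma subrng_C: "subrng C"
  by (simp add: subrng_def subgrp_C C_mult)

lemma V_in_C: "v \<in> verts G \<Longrightarrow> V v \<in> C"
  using mono_in_C[of v "[]" v v "[]" 1] by (simp add: mono_def P_simps Q_simps S_one_V awalk_Nil_iff)

lemma P_V_in_C: "awalk u p w \<Longrightarrow> P p * V w \<in> C"
  using P_C[OF V_in_C[of w], of p] by auto

lemma V_Q_in_C:
  assumes "awalk u q w"
  shows "V w * Q q \<in> C"
proof -
  have w: "w \<in> verts G" using assms by auto
  then have "V w * (Q q * V u) \<in> C"
    using assms by (auto intro!: V_C Q_C V_in_C)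
  then show ?thesis using assms V_Q_V[OF assms, of u] by auto
qed

lemma E_in_C: "e \<in> arcs G \<Longrightarrow> E e \<in> C"
  using E_C[OF V_in_C[of "head G e"], of e] by (simp add: E_V_head)

lemma Es_in_C: "e \<in> arcs G \<Longrightarrow> Es e \<in> C"
  using Es_C[OF V_in_C[of "tail G e"], of e] by (simp add: Es_V_tail)

lemma sum_V_unit:
  assumes "x \<in> C"
  shows "\<exists>A. finite A \<and> A \<subseteq> verts G \<and> (\<forall>A'. finite A' \<longrightarrow> A \<subseteq> A' \<longrightarrow> A' \<subseteq> verts G \<longrightarrow>
    sum V A' * x = x \<and> x * sum V A' = x)"
  using assms
proof (induction rule: C_induct)
  case zero
  then show ?case by (intro exI[of _ "{}"]) auto
next
  case (mono k p w q u u')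
  then have "u \<in> verts G" "u' \<in> verts G" by auto
  moreover have "sum V A' * mono k p w q = mono k p w q" "mono k p w q * sum V A' = mono k p w q"
    if "finite A'" "{u, u'} \<subseteq> A'" "A' \<subseteq> verts G" for A'
  proof -
    have "sum V A' * mono k p w q = (\<Sum>v\<in>A'. if v = u then mono k p w q else 0)"
      unfolding sum_distrib_right using that mono by (intro sum.cong) (auto simp: V_mono)
    then show "sum V A' * mono k p w q = mono k p w q" using that by simp
    have "mono k p w q * sum V A' = (\<Sum>v\<in>A'. if v = u' then mono k p w q else 0)"
      unfolding sum_distrib_left using that mono by (intro sum.cong) (auto simp: mono_V)
    then show "mono k p w q * sum V A' = mono k p w q" using that by simp
  qed
  ultimately show ?case by (intro exI[of _ "{u, u'}"]) auto
next
  case (diff x y)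
  then obtain A A' where "finite A \<and> A \<subseteq> verts G \<and> (\<forall>A'. finite A' \<longrightarrow> A \<subseteq> A' \<longrightarrow> A' \<subseteq> verts G \<longrightarrow>
    sum V A' * x = x \<and> x * sum V A' = x)" "finite A' \<and> A' \<subseteq> verts G \<and> (\<forall>A''. finite A'' \<longrightarrow> A' \<subseteq> A'' \<longrightarrow> A'' \<subseteq> verts G \<longrightarrow>
    sum V A'' * y = y \<and> y * sum V A'' = y)" by blast
  then show ?case
    by (intro exI[of _ "A \<union> A'"]) (auto simp: right_diff_distrib left_diff_distrib)
qed

lemma left_units_C: "left_units C"
  unfolding left_units_def
proof
  fix x assume "x \<in> C"
  from sum_V_unit[OF this] obtain A where "A \<subseteq> verts G" "sum V A * x = x" by blast
  then show "\<exists>u\<in>C. u * x = x"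
    by (intro bexI[of _ "sum V A"] subgrp_sum subgrp_C V_in_C) auto
qed

lemma ex_V_nonzero:
  assumes "x \<in> C" "x \<noteq> 0"
  obtains v where "v \<in> verts G" "x * V v \<noteq> 0"
proof -
  obtain A where "A \<subseteq> verts G" "x * sum V A = x"
    using sum_V_unit[OF assms(1)] by blast
  then have "(\<Sum>v\<in>A. x * V v) \<noteq> 0"
    using assms by (simp add: sum_distrib_left)
  then show thesis
    using that \<open>A \<subseteq> verts G\<close> by (metis sum.neutral subsetD)
qed


subsection \<open>Reduction to vertices and closed walks\<close>

definition real_sum :: "'v \<Rightarrow> ('e list \<Rightarrow>\<^sub>0 'k) \<Rightarrow> 'a" where
  "real_sum v f = (\<Sum>p\<in>keys f. S (lookup f p) * (P p * V v))"

definition walks_to :: "'v \<Rightarrow> ('e list \<Rightarrow>\<^sub>0 'k) \<Rightarrow> bool" where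
  "walks_to v f \<longleftrightarrow> (\<forall>p\<in>keys f. \<exists>u. awalk u p v)"

lemma real_sum_diff: "real_sum v (f - g) = real_sum v f - real_sum v g"
  unfolding real_sum_def by (rule sum_keys_diff) (simp add: S_diff left_diff_distrib)

lemma real_sum_zero: "real_sum v 0 = 0"
  by (simp add: real_sum_def)

lemma real_sum_single: "real_sum v (single p k) = S k * (P p * V v)"
  by (simp add: real_sum_def)

lemma walks_to_diff: "walks_to v f \<Longrightarrow> walks_to v g \<Longrightarrow> walks_to v (f - g)"
  using keys_diff[of f g] by (auto simp: walks_to_def)

lemma walks_to_single: "awalk u p v \<Longrightarrow> walks_to v (single p k)"
  by (auto simp: walks_to_def)

lemma walks_to_zero: "walks_to v 0"
  by (simp add: walks_to_def)

lemma mono_Nil: "w \<in> verts G \<Longrightarrow> mono k p w [] = S k * (P p * V w)"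
  by (simp add: mono_def Q_simps)

lemma Cn_0_mult_V:
  assumes "x \<in> Cn 0" "v \<in> verts G"
  shows "\<exists>f. walks_to v f \<and> x * V v = real_sum v f"
  using assms(1) unfolding Cn_def
proof induction
  case zero
  then show ?case
    by (intro exI[of _ 0]) (simp add: walks_to_zero real_sum_zero)
next
  case (base x)
  then obtain k p w u where x: "x = mono k p w []" "awalk u p w" "w \<in> verts G"
    by (auto simp: awalk_Nil_iff)
  then have "x * V v = (if v = w then x else 0)"
    using mono_V[of w "[]" w v k p] assms(2) by (simp add: awalk_Nil_iff)
  then show ?case
    using x walks_to_single[OF x(2)] walks_to_zero real_sum_zero
    by (cases "v = w") (auto simp: real_sum_single mono_Nil intro: exI[of _ 0] exI[of _ "single p k"])
next
  case (diff x y)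
  then obtain f g where "walks_to v f" "x * V v = real_sum v f" "walks_to v g" "y * V v = real_sum v g"
    by blast
  then show ?case
    by (intro exI[of _ "f - g"]) (simp add: walks_to_diff real_sum_diff left_diff_distrib)
qed

lemma Cn_Suc_mult_E:
  assumes "x \<in> Cn (Suc n)" "e \<in> arcs G"
  shows "x * E e \<in> Cn n"
  using assms(1) unfolding Cn_def[of "Suc n"]
proof (rule aspan_image[where f = "\<lambda>x. x * E e", rotated])
  fix x assume "x \<in> {mono k p w q |k p w q u u'. awalk u p w \<and> awalk u' q w \<and> length q \<le> Suc n}"
  then obtain k p w q u u' where x: "x = mono k p w q" "awalk u p w" "awalk u' q w" "length q \<le> Suc n"
    by blast
  show "x * E e \<in> Cn n"
  proof (cases q)
    case Nil
    have "w \<in> verts G" using x by auto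
    have "mono k (p @ [e]) (head G e) [] \<in> Cn n" if "tail G e = w"
      by (rule mono_in_Cn[of u _ _ "head G e"]) (use x that assms(2) in \<open>auto simp: awalk_simps\<close>)
    then show ?thesis
      using x Nil \<open>w \<in> verts G\<close> assms(2) by (simp add: mono_E_Nil subgrp_zero[OF subgrp_Cn])
  next
    case (Cons f q')
    then have "mono k p w q' \<in> Cn n"
      using x by (intro mono_in_Cn[of u _ _ "head G f"]) (auto simp: awalk_Cons_iff)
    then show ?thesis
      using x Cons assms(2) by (simp add: mono_E_Cons subgrp_zero[OF subgrp_Cn])
  qed
qed (simp_all add: left_diff_distrib subgrp_Cn)

text \<open>
  Quantifying over all larger \<open>F'\<close> makes the property additive in \<open>x\<close>; the vertex \<open>v\<close> may be an
  infinite emitter.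
\<close>

definition decomposes :: "'a \<Rightarrow> 'v \<Rightarrow> ('e list \<Rightarrow>\<^sub>0 'k) \<Rightarrow> 'e set \<Rightarrow> bool" where
  "decomposes x v f F \<longleftrightarrow> finite F \<and> F \<subseteq> out_arcs G v \<and> walks_to v f \<and>
    (\<forall>F'. finite F' \<longrightarrow> F \<subseteq> F' \<longrightarrow> F' \<subseteq> out_arcs G v \<longrightarrow>
      x * V v - real_sum v f = (\<Sum>e\<in>F'. (x * V v - real_sum v f) * (E e * Es e)))"

lemma mult_V_decomposition:
  assumes "x \<in> C" "v \<in> verts G"
  shows "\<exists>f F. decomposes x v f F"
  using assms(1)
proof (induction rule: C_induct)
  case zero
  then show ?case
    by (intro exI[of _ 0] exI[of _ "{}"]) (simp add: decomposes_def walks_to_zero real_sum_zero)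
next
  case (mono k p w q u u')
  show ?case
  proof (cases "v = u'")
    case False
    then have "mono k p w q * V v = 0"
      using mono assms by (simp add: mono_V)
    then show ?thesis
      by (intro exI[of _ 0] exI[of _ "{}"]) (simp add: decomposes_def walks_to_zero real_sum_zero)
  next
    case True
    then have x: "mono k p w q * V v = mono k p w q"
      using mono assms by (simp add: mono_V)
    show ?thesis
    proof (cases q)
      case Nil
      then have "w = v" using mono True by (auto simp: awalk_Nil_iff)
      then have "mono k p w q * V v = real_sum v (single p k)"
        using x Nil assms by (simp add: real_sum_single mono_Nil)
      then show ?thesis
        using mono \<open>w = v\<close>
        by (intro exI[of _ "single p k"] exI[of _ "{}"]) (simp add: decomposes_def walks_to_single)
    next
      case (Cons e q')
      have e: "e \<in> out_arcs G v" "awalk (head G e) q' w"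
        using Cons mono True by (auto simp: awalk_Cons_iff)
      have "mono k p w q = (\<Sum>f\<in>F'. mono k p w q * (E f * Es f))"
        if F': "finite F'" "{e} \<subseteq> F'" "F' \<subseteq> out_arcs G v" for F'
      proof -
        have "mono k p w q * (E f * Es f) = (if f = e then mono k p w q else 0)" if "f \<in> F'" for f
        proof -
          have "f \<in> arcs G" using F' that by auto
          then have "mono k p w q * E f = (if f = e then mono k p w q' else 0)"
            using mono Cons by (simp add: mono_E_Cons)
          moreover have "mono k p w q' * Es e = mono k p w q"
            by (simp add: mono_def Cons Q_simps mult.assoc)
          ultimately show ?thesis by (simp flip: mult.assoc)
        qed
        then show ?thesis using F' by simp
      qed
      then show ?thesis
        using e x by (intro exI[of _ 0] exI[of _ "{e}"]) (simp add: decomposes_def walks_to_zero real_sum_zero)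
    qed
  qed
next
  case (diff x y)
  then obtain f F g H where "decomposes x v f F" "decomposes y v g H"
    by blast
  then have
    F: "finite F" "F \<subseteq> out_arcs G v" "walks_to v f"
      "\<And>F'. finite F' \<Longrightarrow> F \<subseteq> F' \<Longrightarrow> F' \<subseteq> out_arcs G v \<Longrightarrow>
        x * V v - real_sum v f = (\<Sum>e\<in>F'. (x * V v - real_sum v f) * (E e * Es e))" and
    H: "finite H" "H \<subseteq> out_arcs G v" "walks_to v g"
      "\<And>F'. finite F' \<Longrightarrow> H \<subseteq> F' \<Longrightarrow> F' \<subseteq> out_arcs G v \<Longrightarrow>
        y * V v - real_sum v g = (\<Sum>e\<in>F'. (y * V v - real_sum v g) * (E e * Es e))"
    unfolding decomposes_def by blast+
  have eq: "(x - y) * V v - real_sum v (f - g) = (x * V v - real_sum v f) - (y * V v - real_sum v g)"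
    by (simp add: left_diff_distrib real_sum_diff)
  have "(x - y) * V v - real_sum v (f - g) = (\<Sum>e\<in>F'. ((x - y) * V v - real_sum v (f - g)) * (E e * Es e))"
    if "finite F'" "F \<union> H \<subseteq> F'" "F' \<subseteq> out_arcs G v" for F'
    unfolding eq left_diff_distrib[of "x * V v - real_sum v f"] sum_subtractf
    using F(4)[of F'] H(4)[of F'] that by simp
  then have "decomposes (x - y) v (f - g) (F \<union> H)"
    unfolding decomposes_def using F(1-3) H(1-3) by (simp add: walks_to_diff)
  then show ?case by blast
qed

lemma mult_V_mult_E: "e \<in> out_arcs G v \<Longrightarrow> x * V v * E e = x * E e"
  using V_tail_E[of e] by (auto simp: mult.assoc)

lemma real_sum_mult_E:
  assumes "e \<in> out_arcs G v" "walks_to v f" "f \<noteq> 0"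
  shows "\<exists>A k. finite A \<and> A \<noteq> {} \<and> (\<forall>p\<in>A. k p \<noteq> 0 \<and> (\<exists>u. awalk u p (head G e))) \<and>
    real_sum v f * E e = (\<Sum>p\<in>A. S (k p) * (P p * V (head G e)))"
proof -
  let ?A = "(\<lambda>p. p @ [e]) ` keys f"
  let ?k = "\<lambda>p. lookup f (butlast p)"
  have e: "e \<in> arcs G" "tail G e = v" using assms by auto
  have "real_sum v f * E e = (\<Sum>p\<in>keys f. S (lookup f p) * (P (p @ [e]) * V (head G e)))"
    unfolding real_sum_def sum_distrib_right
    using V_tail_E[OF e(1)] E_V_head[OF e(1)] e(2)
    by (intro sum.cong) (auto simp: P_simps mult.assoc)
  also have "\<dots> = (\<Sum>p\<in>?A. S (?k p) * (P p * V (head G e)))"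
    by (subst sum.reindex) (auto simp: inj_on_def)
  finally have "real_sum v f * E e = (\<Sum>p\<in>?A. S (?k p) * (P p * V (head G e)))" .
  moreover have "\<forall>p\<in>?A. ?k p \<noteq> 0 \<and> (\<exists>u. awalk u p (head G e))"
  proof
    fix p' assume "p' \<in> ?A"
    then obtain p where p: "p \<in> keys f" "p' = p @ [e]" by blast
    then obtain u where "awalk u p v" using assms(2) by (auto simp: walks_to_def)
    then have "awalk u p' (head G e)" using p e by (auto simp: awalk_simps)
    then show "?k p' \<noteq> 0 \<and> (\<exists>u. awalk u p' (head G e))"
      using p by (auto simp: in_keys_iff)
  qed
  ultimately show ?thesis
    using assms(3) by (intro exI[of _ ?A] exI[of _ ?k]) auto
qed

text \<open>
  The coefficients rather than the element on the right are said to be nonzero, since the linear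
  independence of paths is not available yet.
\<close>

definition path_reduction :: "'a \<Rightarrow> 'v \<Rightarrow> 'e list \<Rightarrow> 'v \<Rightarrow> 'e list set \<Rightarrow> ('e list \<Rightarrow> 'k) \<Rightarrow> bool" where
  "path_reduction x u q w A k \<longleftrightarrow> awalk u q w \<and> x * V u \<noteq> 0 \<and> finite A \<and> A \<noteq> {} \<and>
    (\<forall>p\<in>A. k p \<noteq> 0 \<and> (\<exists>u. awalk u p w)) \<and>
    x * (P q * V w) = (\<Sum>p\<in>A. S (k p) * (P p * V w))"

lemma reduce_to_paths:
  assumes "x \<in> C" "x \<noteq> 0"
  shows "\<exists>u q w A k. path_reduction x u q w A k"
proof -
  have real_sum_case: "\<exists>u q w A k. path_reduction x u q w A k"
    if "v \<in> verts G" "x * V v \<noteq> 0" "walks_to v f" "x * V v = real_sum v f" for x v f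
  proof -
    have "f \<noteq> 0" using that by (auto simp: real_sum_zero)
    then show ?thesis
      using that
      by (intro exI[of _ v] exI[of _ "[]"] exI[of _ "keys f"] exI[of _ "lookup f"])
        (auto simp: path_reduction_def walks_to_def real_sum_def P_simps awalk_Nil_iff in_keys_iff)
  qed
  obtain n where "x \<in> Cn n" using C_in_Cn[OF assms(1)] by blast
  then show ?thesis
    using assms
  proof (induction n arbitrary: x)
    case 0
    obtain v where "v \<in> verts G" "x * V v \<noteq> 0" using ex_V_nonzero[OF 0(2,3)] .
    moreover from this obtain f where "walks_to v f" "x * V v = real_sum v f"
      using Cn_0_mult_V[OF 0(1)] by blast
    ultimately show ?case by (rule real_sum_case)
  next
    case (Suc n)
    obtain v where v: "v \<in> verts G" "x * V v \<noteq> 0" using ex_V_nonzero[OF Suc.prems(2,3)] .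
    show ?case
    proof (cases "\<exists>e\<in>out_arcs G v. x * E e \<noteq> 0")
      case True
      then obtain e where e: "e \<in> arcs G" "tail G e = v" "x * E e \<noteq> 0" by auto
      have "x * E e \<in> Cn n" "x * E e \<in> C"
        using Cn_Suc_mult_E[OF Suc.prems(1) e(1)] C_mult[OF Suc.prems(2) E_in_C[OF e(1)]] by auto
      from Suc.IH[OF this e(3)] obtain u q w A k where "path_reduction (x * E e) u q w A k" by blast
      then have *: "awalk u q w" "x * E e * V u \<noteq> 0"
        "finite A" "A \<noteq> {}" "\<forall>p\<in>A. k p \<noteq> 0 \<and> (\<exists>u. awalk u p w)"
        "x * E e * (P q * V w) = (\<Sum>p\<in>A. S (k p) * (P p * V w))"
        unfolding path_reduction_def by blast+
      have "u = head G e"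
      proof (rule ccontr)
        assume "u \<noteq> head G e"
        then have "E e * V u = 0" using * e by (subst E_V) auto
        then show False using *(2) by (simp add: mult.assoc)
      qed
      then have "awalk v (e # q) w"
        using * e by (simp add: awalk_Cons_iff)
      moreover have "x * (P (e # q) * V w) = (\<Sum>p\<in>A. S (k p) * (P p * V w))"
        using * by (simp add: P_simps mult.assoc)
      ultimately have "path_reduction x v (e # q) w A k"
        unfolding path_reduction_def using v(2) *(3-5) by blast
      then show ?thesis by blast
    next
      case False
      obtain f F where F: "finite F" "F \<subseteq> out_arcs G v" "walks_to v f"
        "\<And>F'. finite F' \<Longrightarrow> F \<subseteq> F' \<Longrightarrow> F' \<subseteq> out_arcs G v \<Longrightarrow>
          x * V v - real_sum v f = (\<Sum>e\<in>F'. (x * V v - real_sum v f) * (E e * Es e))"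
        using mult_V_decomposition[OF Suc.prems(2) v(1)] unfolding decomposes_def by blast
      show ?thesis
      proof (cases "f = 0")
        case True
        have "x * V v = (\<Sum>e\<in>F. x * V v * (E e * Es e))"
          using F(4)[OF F(1) subset_refl F(2)] True by (simp add: real_sum_zero)
        also have "\<dots> = (\<Sum>e\<in>F. x * E e * Es e)"
          using F(2) by (intro sum.cong) (auto simp: mult_V_mult_E simp flip: mult.assoc)
        also have "\<dots> = 0"
          using F(2) False by (intro sum.neutral) auto
        finally show ?thesis using v by simp
      next
        case f: False
        show ?thesis
        proof (cases "regular G v")
          case True
          then have "x * V v = (\<Sum>e\<in>out_arcs G v. x * E e * Es e)"
            by (simp add: CK sum_distrib_left mult.assoc)
          then show ?thesis
            using False v by simp
        next
          case singular: False
          show ?thesis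
          proof (cases "out_arcs G v = {}")
            case True
            then have "x * V v = real_sum v f"
              using F(4)[of "{}"] F(2) by simp
            then show ?thesis
              by (rule real_sum_case[OF v F(3)])
          next
            case False
            then have "infinite (out_arcs G v)"
              using singular v by (simp add: regular_def)
            then obtain e where e: "e \<in> out_arcs G v" "e \<notin> F"
              using F(1) by (metis finite_subset subsetI)
            have "x * E e - real_sum v f * E e = (x * V v - real_sum v f) * E e"
              using mult_V_mult_E[OF e(1)] by (simp add: left_diff_distrib)
            also have "\<dots> = (\<Sum>e'\<in>F. (x * V v - real_sum v f) * (E e' * Es e')) * E e"
              using F(4)[OF F(1) subset_refl F(2)] by simp
            also have "\<dots> = (\<Sum>e'\<in>F. (x * V v - real_sum v f) * (E e' * (Es e' * E e)))"
              by (simp add: sum_distrib_right mult.assoc)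
            also have "\<dots> = 0"
              using e F(2) by (intro sum.neutral) (auto simp: Es_E)
            finally have "x * E e = real_sum v f * E e" by simp
            moreover have "x * (P [e] * V (head G e)) = x * E e"
              using e by (auto simp: P_simps E_V_head)
            moreover have "awalk v [e] (head G e)"
              using e by (auto simp: awalk_simps)
            moreover obtain A k where "finite A" "A \<noteq> {}" "\<forall>p\<in>A. k p \<noteq> 0 \<and> (\<exists>u. awalk u p (head G e))"
              "real_sum v f * E e = (\<Sum>p\<in>A. S (k p) * (P p * V (head G e)))"
              using real_sum_mult_E[OF e(1) F(3) f] by blast
            ultimately have "path_reduction x v [e] (head G e) A k"
              unfolding path_reduction_def using v(2) by simp
            then show ?thesis by blast
          qed
        qed
      qed
    qed
  qed
qed

definition closed_sum :: "'v \<Rightarrow> ('k \<times> 'e list) list \<Rightarrow> 'a" where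
  "closed_sum w cs = (\<Sum>(a, c)\<leftarrow>cs. S a * (P c * V w))"

definition closed_walks :: "'v \<Rightarrow> ('k \<times> 'e list) list \<Rightarrow> bool" where
  "closed_walks w cs \<longleftrightarrow> (\<forall>(a, c)\<in>set cs. c \<noteq> [] \<and> awalk w c w)"

lemma sum_eq_closed_sum:
  assumes "finite A" "\<And>p. p \<in> A \<Longrightarrow> t p = 0 \<or> (\<exists>a c. t p = S a * (P c * V w) \<and> c \<noteq> [] \<and> awalk w c w)"
  shows "\<exists>cs. closed_walks w cs \<and> sum t A = closed_sum w cs"
  using assms
proof (induction A rule: finite_induct)
  case empty
  then show ?case by (intro exI[of _ "[]"]) (simp add: closed_walks_def closed_sum_def)
next
  case (insert p A)
  then obtain cs where cs: "closed_walks w cs" "sum t A = closed_sum w cs" by auto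
  from insert.prems[of p] consider "t p = 0" | a c where "t p = S a * (P c * V w)" "c \<noteq> []" "awalk w c w"
    by blast
  then show ?case
  proof cases
    case 1
    then show ?thesis using insert.hyps cs by auto
  next
    case 2
    then show ?thesis using insert.hyps cs
      by (intro exI[of _ "(a, c) # cs"]) (auto simp: closed_walks_def closed_sum_def)
  qed
qed

lemma reduce_to_closed:
  assumes "x \<in> C" "x \<noteq> 0"
  shows "\<exists>a u q w k cs. a \<in> C \<and> awalk u q w \<and> x * V u \<noteq> 0 \<and> k \<noteq> 0 \<and> closed_walks w cs \<and>
    a * (x * (P q * V w)) = S k * V w + closed_sum w cs"
proof -
  obtain u q w A k where *: "awalk u q w" "x * V u \<noteq> 0" "finite A" "A \<noteq> {}"
    "\<forall>p\<in>A. k p \<noteq> 0 \<and> (\<exists>u. awalk u p w)" "x * (P q * V w) = (\<Sum>p\<in>A. S (k p) * (P p * V w))"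
    using reduce_to_paths[OF assms] unfolding path_reduction_def by blast
  obtain p0 where p0: "p0 \<in> A" "\<And>p. p \<in> A \<Longrightarrow> length p0 \<le> length p"
    using ex_min_if_finite[of "length ` A"] *(3,4)
    by (metis (no_types, lifting) arg_min_if_finite(1) arg_min_least)
  obtain u0 where u0: "awalk u0 p0 w" using *(5) p0(1) by blast
  have w: "w \<in> verts G" using u0 by auto
  define t where "t p = V w * (Q p0 * (S (k p) * (P p * V w)))" for p
  have tS: "t p = S (k p) * (V w * (Q p0 * (P p * V w)))" for p
    using u0 w by (auto simp: t_def Q_S_left V_S_left)
  have "t p = 0 \<or> (\<exists>a c. t p = S a * (P c * V w) \<and> c \<noteq> [] \<and> awalk w c w)" if p: "p \<in> A - {p0}" for p
  proof -
    obtain u where u: "awalk u p w" using *(5) p by blast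
    note eq = V_Q_P_V[OF u0 u p0(2)]
    show ?thesis
    proof (cases "take (length p0) p = p0 \<and> (p0 = [] \<longrightarrow> u = w)")
      case True
      then obtain r where r: "p = p0 @ r" by (metis append_take_drop_id)
      then have "awalk w r w"
        using u True by (intro awalk_append_drop[OF u0]) auto
      then show ?thesis
        using eq p True r by (auto simp: tS)
    next
      case False
      then have "V w * (Q p0 * (P p * V w)) = 0" using eq p by (simp only: if_False) auto
      then show ?thesis by (simp add: tS)
    qed
  qed
  then obtain cs where cs: "closed_walks w cs" "sum t (A - {p0}) = closed_sum w cs"
    using sum_eq_closed_sum[of "A - {p0}" t w] *(3) by blast
  have "V w * Q p0 * (x * (P q * V w)) = sum t A"
    by (simp add: *(6) t_def sum_distrib_left mult.assoc)
  also have "\<dots> = t p0 + sum t (A - {p0})"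
    using *(3) p0(1) by (simp add: sum.remove)
  also have "t p0 = S (k p0) * V w"
    using Q_P_V[OF u0] w V_V[of w w] by (simp add: tS)
  finally have "V w * Q p0 * (x * (P q * V w)) = S (k p0) * V w + closed_sum w cs"
    by (simp add: cs)
  then show ?thesis
    using V_Q_in_C[OF u0] *(1,2,5) cs(1) p0(1) by blast
qed

lemma conjugate_closed_walk:
  assumes "awalk w q w'" "awalk w c w" "c \<noteq> []"
  shows "V w' * (Q q * ((S a * (P c * V w)) * (P q * V w'))) = 0 \<or>
    (\<exists>c'. V w' * (Q q * ((S a * (P c * V w)) * (P q * V w'))) = S a * (P c' * V w') \<and> c' \<noteq> [] \<and> awalk w' c' w')"
    and "take (length q) (c @ q) \<noteq> q \<Longrightarrow> V w' * (Q q * ((S a * (P c * V w)) * (P q * V w'))) = 0"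
proof -
  have w: "w \<in> verts G" "w' \<in> verts G" using assms by auto
  have "(S a * (P c * V w)) * (P q * V w') = S a * (P (c @ q) * V w')"
    using V_P_V[OF assms(1) w(1)] by (simp add: P_simps mult.assoc)
  then have "V w' * (Q q * ((S a * (P c * V w)) * (P q * V w'))) = S a * (V w' * (Q q * (P (c @ q) * V w')))"
    using assms w by (auto simp: Q_S_left V_S_left)
  moreover have cq: "awalk w (c @ q) w'" using assms by auto
  moreover note V_Q_P_V[OF assms(1) cq]
  ultimately have eq: "V w' * (Q q * ((S a * (P c * V w)) * (P q * V w'))) =
    (if take (length q) (c @ q) = q then S a * (P (drop (length q) (c @ q)) * V w') else 0)"
    using assms(1) by (auto simp: awalk_Nil_iff)
  show "take (length q) (c @ q) \<noteq> q \<Longrightarrow> V w' * (Q q * ((S a * (P c * V w)) * (P q * V w'))) = 0"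
    using eq by simp
  have "awalk w' (drop (length q) (c @ q)) w'" if "take (length q) (c @ q) = q"
  proof -
    have "awalk w (q @ drop (length q) (c @ q)) w'"
      using cq append_take_drop_id[of "length q" "c @ q"] that by metis
    then show ?thesis
      using assms(1) by (intro awalk_append_drop[OF assms(1)]) (auto simp: awalk_Nil_iff)
  qed
  moreover have "length (drop (length q) (c @ q)) = length c"
    by simp
  then have "drop (length q) (c @ q) \<noteq> []"
    using assms(3) by (metis length_0_conv)
  ultimately show "V w' * (Q q * ((S a * (P c * V w)) * (P q * V w'))) = 0 \<or>
    (\<exists>c'. V w' * (Q q * ((S a * (P c * V w)) * (P q * V w'))) = S a * (P c' * V w') \<and> c' \<noteq> [] \<and> awalk w' c' w')"
    unfolding eq by auto
qed

lemma conjugate_closed_sum: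
  assumes "awalk w q w'" "closed_walks w cs"
  shows "\<exists>cs'. closed_walks w' cs' \<and> length cs' \<le> length cs \<and>
    V w' * (Q q * (closed_sum w cs * (P q * V w'))) = closed_sum w' cs'"
  using assms(2)
proof (induction cs)
  case Nil
  then show ?case by (intro exI[of _ "[]"]) (simp add: closed_sum_def closed_walks_def)
next
  case (Cons ac cs)
  obtain a c where ac: "ac = (a, c)" by fastforce
  obtain cs' where cs': "closed_walks w' cs'" "length cs' \<le> length cs"
    "V w' * (Q q * (closed_sum w cs * (P q * V w'))) = closed_sum w' cs'"
    using Cons by (auto simp: closed_walks_def)
  have eq: "V w' * (Q q * (closed_sum w (ac # cs) * (P q * V w'))) =
    V w' * (Q q * ((S a * (P c * V w)) * (P q * V w'))) + closed_sum w' cs'"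
    unfolding cs'(3)[symmetric] by (simp add: closed_sum_def ac distrib_left distrib_right)
  from Cons.prems have "awalk w c w" "c \<noteq> []" by (auto simp: closed_walks_def ac)
  from conjugate_closed_walk(1)[OF assms(1) this, of a] show ?case
  proof (elim disjE exE conjE)
    assume "V w' * (Q q * ((S a * (P c * V w)) * (P q * V w'))) = 0"
    then show ?thesis using cs' eq by (intro exI[of _ cs']) auto
  next
    fix c' assume "V w' * (Q q * ((S a * (P c * V w)) * (P q * V w'))) = S a * (P c' * V w')"
      "c' \<noteq> []" "awalk w' c' w'"
    then show ?thesis
      using cs' unfolding eq by (intro exI[of _ "(a, c') # cs'"]) (auto simp: closed_sum_def closed_walks_def)
  qed
qed

lemma closed_sum_nobif:
  assumes "k \<noteq> 0" "w \<in> verts G" "closed_walks w cs"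
  shows "\<exists>a b w' cs'. a \<in> C \<and> b \<in> C \<and> w' \<in> verts G \<and> closed_walks w' cs' \<and> (cs' = [] \<or> nobif w') \<and>
    a * (S k * V w + closed_sum w cs) * b = S k * V w' + closed_sum w' cs'"
  using assms(2,3)
proof (induction "length cs" arbitrary: w cs rule: less_induct)
  case less
  have V_unit: "V w * (S k * V w + closed_sum w cs) * V w = S k * V w + closed_sum w cs"
  proof -
    have "V w * closed_sum w cs * V w = closed_sum w cs"
      using less.prems(2)
    proof (induction cs)
      case (Cons ac cs)
      then have "V w * closed_sum w cs * V w = closed_sum w cs" by (auto simp: closed_walks_def)
      moreover obtain a c where ac: "ac = (a, c)" by fastforce
      moreover have "awalk w c w" using Cons.prems ac by (auto simp: closed_walks_def)
      then have "V w * (S a * (P c * V w)) * V w = S a * (P c * V w)"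
        using less.prems(1) V_P_V[of w c w w] V_V[of w w] by (simp add: V_S_left mult.assoc)
      ultimately show ?case
        by (simp add: closed_sum_def distrib_left distrib_right)
    qed (simp add: closed_sum_def)
    moreover have "V w * (S k * V w) * V w = S k * V w"
      using less.prems(1) V_V[of w w] by (simp add: V_S_left mult.assoc)
    ultimately show ?thesis by (simp add: distrib_left distrib_right)
  qed
  show ?case
  proof (cases "cs = [] \<or> nobif w")
    case True
    then show ?thesis
      using V_unit less.prems V_in_C by blast
  next
    case False
    then obtain a c cs1 where cs: "cs = (a, c) # cs1" by (cases cs) auto
    have c: "awalk w c w" "c \<noteq> []" and cs1: "closed_walks w cs1"
      using less.prems(2) by (auto simp: closed_walks_def cs)
    obtain q w' where q: "awalk w q w'" "take (length q) (c @ q) \<noteq> q"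
      using aperiodic_walk[of w c] False c by blast
    obtain cs' where cs': "closed_walks w' cs'" "length cs' \<le> length cs1"
      "V w' * (Q q * (closed_sum w cs1 * (P q * V w'))) = closed_sum w' cs'"
      using conjugate_closed_sum[OF q(1) cs1] by blast
    have w': "w' \<in> verts G" using q by auto
    have "V w' * (Q q * (S k * V w * (P q * V w'))) = S k * V w'"
      using V_P_V[OF q(1) less.prems(1)] Q_P_V[OF q(1)] V_V[of w' w'] q(1) w'
      by (auto simp: mult.assoc Q_S_left V_S_left)
    moreover have "V w' * (Q q * ((S a * (P c * V w)) * (P q * V w'))) = 0"
      by (rule conjugate_closed_walk(2)[OF q(1) c q(2)])
    ultimately have step: "(V w' * Q q) * (S k * V w + closed_sum w cs) * (P q * V w') = S k * V w' + closed_sum w' cs'"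
      using cs'(3) by (simp add: cs closed_sum_def distrib_left distrib_right mult.assoc)
    obtain a' b' w'' cs'' where *: "a' \<in> C" "b' \<in> C" "w'' \<in> verts G" "closed_walks w'' cs''" "cs'' = [] \<or> nobif w''"
      "a' * (S k * V w' + closed_sum w' cs') * b' = S k * V w'' + closed_sum w'' cs''"
      using less.hyps[OF _ w' cs'(1)] cs'(2) cs by auto
    have "(a' * (V w' * Q q)) * (S k * V w + closed_sum w cs) * ((P q * V w') * b') = S k * V w'' + closed_sum w'' cs''"
      using *(6) step by (metis mult.assoc)
    moreover have "a' * (V w' * Q q) \<in> C" "(P q * V w') * b' \<in> C"
      using * C_mult V_Q_in_C[OF q(1)] P_V_in_C[OF q(1)] by auto
    ultimately show ?thesis using *(3-5) by blast
  qed
qed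

theorem reduction:
  assumes "x \<in> C" "x \<noteq> 0"
  obtains a b k w cs where "a \<in> C" "b \<in> C" "k \<noteq> 0" "w \<in> verts G" "closed_walks w cs"
    "cs = [] \<or> nobif w" "a * x * b = S k * V w + closed_sum w cs"
proof -
  obtain a u q w k cs where *: "a \<in> C" "awalk u q w" "k \<noteq> 0" "closed_walks w cs"
    "a * (x * (P q * V w)) = S k * V w + closed_sum w cs"
    using reduce_to_closed[OF assms] by blast
  have w: "w \<in> verts G" using *(2) by auto
  obtain a' b' w' cs' where **: "a' \<in> C" "b' \<in> C" "w' \<in> verts G" "closed_walks w' cs'" "cs' = [] \<or> nobif w'"
      "a' * (S k * V w + closed_sum w cs) * b' = S k * V w' + closed_sum w' cs'"
    using closed_sum_nobif[OF *(3) w *(4)] by blast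
  have "(a' * a) * x * ((P q * V w) * b') = S k * V w' + closed_sum w' cs'"
    using **(6) *(5) by (metis mult.assoc)
  moreover have "a' * a \<in> C" "(P q * V w) * b' \<in> C"
    using * ** C_mult P_V_in_C by auto
  ultimately show thesis using that *(3) **(3-5) by blast
qed

lemma S_commute: "x \<in> C \<Longrightarrow> x * S k = S k * x"
proof (induction rule: C_induct)
  case (mono j p w q u u')
  then have "set p \<subseteq> arcs G" "set q \<subseteq> arcs G" and w: "w \<in> verts G" by auto
  then have "P p * (V w * (Q q * (S k * 1))) = S k * (P p * (V w * Q q))"
    using Q_S_left[of q k 1] by (simp only: Q_S_left V_S_left[OF w] P_S_left mult_1_right)
  moreover have "S j * S k = S k * S j"
    using S_mult[of j k] S_mult[of k j] by (simp add: mult.commute)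
  ultimately show ?case
    by (simp add: mono_def mult.assoc) (simp flip: mult.assoc)
qed (simp_all add: right_diff_distrib left_diff_distrib)

lemma S_inverse: "k \<noteq> 0 \<Longrightarrow> w \<in> verts G \<Longrightarrow> S (1 / k) * (S k * V w) = V w"
  using S_mult[of "1 / k" k] S_one_V[of w] by (simp flip: mult.assoc)

lemma line_point_mem_left_ideal:
  assumes "v \<in> line_points G" "y \<in> C" "y * V v = y" "y \<noteq> 0"
  shows "\<exists>z\<in>C. z * y = V v"
proof -
  obtain a u q w k cs where *: "a \<in> C" "awalk u q w" "y * V u \<noteq> 0" "k \<noteq> 0" "closed_walks w cs"
    "a * (y * (P q * V w)) = S k * V w + closed_sum w cs"
    using reduce_to_closed[OF assms(2,4)] by blast
  have v: "v \<in> verts G" using assms(1) by (simp add: line_points_def)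
  have u: "u \<in> verts G" and w: "w \<in> verts G" using *(2) by auto
  have "u = v"
  proof (rule ccontr)
    assume "u \<noteq> v"
    then have "V v * V u = 0" using u v by (simp add: V_V)
    then show False using *(3) assms(3) by (metis mult.assoc mult_zero_right)
  qed
  then have q: "awalk v q w" using * by simp
  then have "w \<in> line_points G"
    using line_points_tree[OF assms(1)] by (auto simp: mem_tree_iff)
  then have "cs = []"
    using *(5) line_point_no_closed_walk by (cases cs) (auto simp: closed_walks_def)
  then have eq: "a * (y * (P q * V w)) = S k * V w"
    using * by (simp add: closed_sum_def)
  have Vv: "V v = P q * (V w * Q q)"
    using V_eq_P_Q[OF q line_points_nobif[OF assms(1)]] .
  let ?z = "P q * V w * (S (1 / k) * a)"
  have "?z * y = P q * (V w * (S (1 / k) * (a * (y * V v))))"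
    by (simp add: mult.assoc assms(3))
  also have "a * (y * V v) = a * (y * (P q * V w)) * Q q"
    by (simp add: Vv mult.assoc)
  also have "S (1 / k) * (a * (y * (P q * V w)) * Q q) = V w * Q q"
    using S_inverse[OF *(4) w] unfolding eq by (simp flip: mult.assoc)
  also have "P q * (V w * (V w * Q q)) = V v"
    using V_V[OF w w] by (simp add: Vv flip: mult.assoc)
  finally have "?z * y = V v" .
  moreover have "?z \<in> C"
    using C_mult[OF P_V_in_C[OF q] S_C[OF *(1)]] .
  ultimately show ?thesis by blast
qed

end

section \<open>The boundary path representation\<close>

subsection \<open>Linear extension\<close>

definition smul :: "'k::comm_ring_1 \<Rightarrow> ('s \<Rightarrow>\<^sub>0 'k) \<Rightarrow> 's \<Rightarrow>\<^sub>0 'k" where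
  "smul a f = Poly_Mapping.map ((*) a) f"

lemma lookup_smul [simp]: "lookup (smul a f) s = a * lookup f s"
  by (simp add: smul_def map.rep_eq "when_def")

lemma smul_single [simp]: "smul a (single s b) = single s (a * b)"
  by (rule poly_mapping_eqI) (simp add: lookup_single "when_def")

lemma smul_zero [simp]: "smul a 0 = 0"
  by (rule poly_mapping_eqI) simp

lemma smul_zero_left [simp]: "smul 0 f = 0"
  by (rule poly_mapping_eqI) simp

lemma smul_one [simp]: "smul 1 f = f"
  by (rule poly_mapping_eqI) simp

lemma smul_smul: "smul a (smul b f) = smul (a * b) f"
  by (rule poly_mapping_eqI) (simp add: mult.assoc)

lemma smul_diff: "smul a (f - g) = smul a f - smul a g"
  by (rule poly_mapping_eqI) (simp add: lookup_minus right_diff_distrib)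

lemma smul_diff_left: "smul (a - b) f = smul a f - smul b f"
  by (rule poly_mapping_eqI) (simp add: lookup_minus left_diff_distrib)

lemma smul_sum: "smul a (sum f A) = (\<Sum>i\<in>A. smul a (f i))"
  by (rule poly_mapping_eqI) (simp add: lookup_sum sum_distrib_left)

definition ext :: "('s \<Rightarrow> 't \<Rightarrow>\<^sub>0 'k::comm_ring_1) \<Rightarrow> ('s \<Rightarrow>\<^sub>0 'k) \<Rightarrow> 't \<Rightarrow>\<^sub>0 'k" where
  "ext F g = (\<Sum>s\<in>keys g. smul (lookup g s) (F s))"

lemma ext_diff: "ext F (g - h) = ext F g - ext F h"
  unfolding ext_def by (rule sum_keys_diff) (rule smul_diff_left)

lemma ext_zero [simp]: "ext F 0 = 0"
  by (simp add: ext_def)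

lemma ext_add: "ext F (g + h) = ext F g + ext F h"
  using ext_diff[of F "g + h" h] by simp

lemma ext_sum: "ext F (sum g A) = (\<Sum>i\<in>A. ext F (g i))"
  by (induction A rule: infinite_finite_induct) (simp_all add: ext_add)

lemma ext_single [simp]: "ext F (single s a) = smul a (F s)"
  by (simp add: ext_def)

lemma pm_eq_sum: "g = (\<Sum>s\<in>keys g. single s (lookup g s))"
  by (rule poly_mapping_eqI) (simp add: lookup_sum lookup_single "when_def" in_keys_iff)

lemma ext_smul: "ext F (smul a g) = smul a (ext F g)"
proof -
  have "smul a g = (\<Sum>s\<in>keys g. single s (a * lookup g s))"
    by (subst (1) pm_eq_sum[of g]) (simp add: smul_sum)
  then show ?thesis
    by (simp add: ext_sum) (simp add: ext_def smul_sum smul_smul)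
qed

lemma ext_ext: "ext F (ext H g) = ext (\<lambda>s. ext F (H s)) g"
  unfolding ext_def[of H] ext_def[of "\<lambda>s. ext F (H s)"] by (simp add: ext_sum ext_smul)

lemma ext_cong: "(\<And>s. s \<in> keys g \<Longrightarrow> F s = H s) \<Longrightarrow> ext F g = ext H g"
  unfolding ext_def by (rule sum.cong) auto

lemma ext_eqI: "(\<And>s. F s = H s) \<Longrightarrow> ext F g = ext H g"
  by (rule ext_cong) simp

lemma ext_eq_zeroI: "(\<And>s. F s = 0) \<Longrightarrow> ext F g = 0"
  by (simp add: ext_def)

lemma ext_sum_left: "ext (\<lambda>s. \<Sum>i\<in>A. F i s) g = (\<Sum>i\<in>A. ext (F i) g)"
  unfolding ext_def by (simp add: smul_sum) (rule sum.swap)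

lemma ext_ident: "ext (\<lambda>s. single s k) g = smul k g"
  unfolding ext_def
  by (subst (3) pm_eq_sum[of g]) (simp add: smul_sum mult.commute)

lemma keys_ext: "keys (ext F g) \<subseteq> (\<Union>s\<in>keys g. keys (F s))"
proof -
  have "keys (smul a f) \<subseteq> keys f" for a and f :: "'t \<Rightarrow>\<^sub>0 'k::comm_ring_1"
    by (auto simp: in_keys_iff)
  then show ?thesis
    unfolding ext_def using keys_sum[of "\<lambda>s. smul (lookup g s) (F s)" "keys g"]
    by fastforce
qed

text \<open>
  A boundary path is an infinite path or a finite path ending in a vertex that is not regular.
  The second coordinate of \<open>bpath \<times> int\<close> records the grading.
\<close>

codatatype ('v, 'e) bpath = Stop 'v | Step 'e "('v, 'e) bpath"

context wf_digraph
begin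

definition src :: "('a, 'b) bpath \<Rightarrow> 'a" where
  "src x = (case x of Stop v \<Rightarrow> v | Step e y \<Rightarrow> tail G e)"

lemma src_simps [simp]: "src (Stop v) = v" "src (Step e x) = tail G e"
  by (simp_all add: src_def)

coinductive valid :: "('a, 'b) bpath \<Rightarrow> bool" where
  "v \<in> verts G \<Longrightarrow> \<not> regular G v \<Longrightarrow> valid (Stop v)"
| "e \<in> arcs G \<Longrightarrow> valid x \<Longrightarrow> src x = head G e \<Longrightarrow> valid (Step e x)"

lemma valid_Stop_iff: "valid (Stop v) \<longleftrightarrow> v \<in> verts G \<and> \<not> regular G v"
  by (subst valid.simps) auto

lemma valid_Step_iff: "valid (Step e x) \<longleftrightarrow> e \<in> arcs G \<and> valid x \<and> src x = head G e"
  by (subst valid.simps) auto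

primcorec path_from :: "'a \<Rightarrow> ('a, 'b) bpath" where
  "path_from v = (if regular G v then Step (SOME e. e \<in> out_arcs G v) (path_from (head G (SOME e. e \<in> out_arcs G v)))
    else Stop v)"

lemma regular_some: "regular G v \<Longrightarrow> (SOME e. e \<in> out_arcs G v) \<in> out_arcs G v"
  unfolding regular_def by (metis some_in_eq)

lemma src_path_from: "src (path_from v) = v"
  using regular_some[of v] by (subst path_from.code) auto

lemma valid_path_from: "v \<in> verts G \<Longrightarrow> valid (path_from v)"
proof (coinduction arbitrary: v)
  case valid
  show ?case
  proof (cases "regular G v")
    case True
    then have "(SOME e. e \<in> out_arcs G v) \<in> arcs G" using regular_some by auto
    moreover from this have "head G (SOME e. e \<in> out_arcs G v) \<in> verts G" by simp
    ultimately show ?thesis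
      using True by (subst (1 2) path_from.code) (auto simp: src_path_from)
  next
    case False
    then show ?thesis using valid by (subst (1) path_from.code) auto
  qed
qed

lemma valid_unique: "nobif w \<Longrightarrow> valid x \<Longrightarrow> valid y \<Longrightarrow> src x = w \<Longrightarrow> src y = w \<Longrightarrow> x = y"
proof (coinduction arbitrary: w x y)
  case (Eq_bpath w x y)
  have Stop_Step: False if "valid (Stop w)" "valid (Step e z)" "tail G e = w" for e z
    using that Eq_bpath(1) nobif_out_arcs[of w e] by (auto simp: valid_Stop_iff valid_Step_iff regular_def)
  show ?case
  proof (cases x)
    case x: (Stop v)
    then show ?thesis using Eq_bpath Stop_Step by (cases y) auto
  next
    case x: (Step e x')
    show ?thesis
    proof (cases y)
      case (Stop v)
      then show ?thesis using Eq_bpath Stop_Step[of e x'] x by auto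
    next
      case y: (Step f y')
      have e: "e \<in> arcs G" "tail G e = w" "f \<in> arcs G" "tail G f = w"
        using Eq_bpath x y by (auto simp: valid_Step_iff)
      then have "e = f" using nobif_arc_unique[OF Eq_bpath(1)] by blast
      moreover have "head G e \<in> tree G w"
        using arc_implies_awalk[OF e(1)] e by (auto simp: mem_tree_iff)
      then have "nobif (head G e)" using Eq_bpath(1) nobif_tree by blast
      ultimately show ?thesis
        using Eq_bpath x y by (auto simp: valid_Step_iff)
    qed
  qed
qed

definition app :: "'b list \<Rightarrow> ('a, 'b) bpath \<Rightarrow> ('a, 'b) bpath" where
  "app p x = foldr Step p x"

lemma app_simps: "app [] x = x" "app (e # p) x = Step e (app p x)"
  by (simp_all add: app_def)

lemma valid_app: "awalk u p (src x) \<Longrightarrow> valid x \<Longrightarrow> valid (app p x) \<and> src (app p x) = u"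
  by (induction p arbitrary: u) (auto simp: app_simps awalk_simps valid_Step_iff)

definition rep_V :: "'a \<Rightarrow> ('a, 'b) bpath \<times> int \<Rightarrow> ('a, 'b) bpath \<times> int \<Rightarrow>\<^sub>0 'k::comm_ring_1" where
  "rep_V v = (\<lambda>(x, n). if valid x \<and> src x = v then single (x, n) 1 else 0)"

definition rep_E :: "'b \<Rightarrow> ('a, 'b) bpath \<times> int \<Rightarrow> ('a, 'b) bpath \<times> int \<Rightarrow>\<^sub>0 'k::comm_ring_1" where
  "rep_E e = (\<lambda>(x, n). if valid x \<and> src x = head G e then single (Step e x, n + 1) 1 else 0)"

definition rep_Es :: "'b \<Rightarrow> ('a, 'b) bpath \<times> int \<Rightarrow> ('a, 'b) bpath \<times> int \<Rightarrow>\<^sub>0 'k::comm_ring_1" where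
  "rep_Es e = (\<lambda>(x, n). case x of Stop v \<Rightarrow> 0
    | Step f y \<Rightarrow> if f = e \<and> valid x then single (y, n - 1) 1 else 0)"

definition shift :: "int \<Rightarrow> (('a, 'b) bpath \<times> int \<Rightarrow>\<^sub>0 'k::comm_ring_1) \<Rightarrow> ('a, 'b) bpath \<times> int \<Rightarrow>\<^sub>0 'k" where
  "shift m = ext (\<lambda>(x, n). single (x, n + m) 1)"

lemma shift_diff: "shift m (f - g) = shift m f - shift m g"
  by (simp add: shift_def ext_diff)

lemma shift_smul: "shift m (smul a g) = smul a (shift m g)"
  by (simp add: shift_def ext_smul)

lemma shift_ext_commute:
  "(\<And>s. shift m (F s) = ext F (shift m (single s 1))) \<Longrightarrow> shift m (ext F g) = ext F (shift m g)"
  unfolding shift_def ext_ext by (rule ext_cong) (simp split: prod.splits)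

lemma lookup_shift: "lookup (shift m g) (x, n) = lookup g (x, n - m)"
proof -
  have "lookup (shift m g) (x, n) =
    (\<Sum>s\<in>keys g. if s = (x, n - m) then lookup g s else 0)"
    unfolding shift_def ext_def lookup_sum
    by (rule sum.cong) (auto simp: lookup_single "when_def" split: prod.splits)
  then show ?thesis by (simp add: in_keys_iff)
qed

lemma shift_rep_V: "shift m (ext (rep_V v) g) = ext (rep_V v) (shift m g)"
  by (rule shift_ext_commute) (auto simp: rep_V_def shift_def split: prod.splits)

lemma shift_rep_E: "shift m (ext (rep_E e) g) = ext (rep_E e) (shift m g)"
  by (rule shift_ext_commute) (auto simp: rep_E_def shift_def algebra_simps split: prod.splits)

lemma shift_rep_Es: "shift m (ext (rep_Es e) g) = ext (rep_Es e) (shift m g)"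
  by (rule shift_ext_commute) (auto simp: rep_Es_def shift_def algebra_simps split: prod.splits bpath.splits)

end


subsection \<open>Consequences for the algebra\<close>

locale leavitt_rep = leavitt_family G V E Es S
  for G :: "('v, 'e) pre_digraph" and V :: "'v \<Rightarrow> 'a::ring_1" and E Es :: "'e \<Rightarrow> 'a"
    and S :: "'k::field \<Rightarrow> 'a" +
  fixes rep :: "'a \<Rightarrow> (('v, 'e) bpath \<times> int \<Rightarrow>\<^sub>0 'k) \<Rightarrow> ('v, 'e) bpath \<times> int \<Rightarrow>\<^sub>0 'k"
  assumes rep_diff_left: "x \<in> C \<Longrightarrow> y \<in> C \<Longrightarrow> rep (x - y) g = rep x g - rep y g"
    and rep_diff: "x \<in> C \<Longrightarrow> rep x (g - h) = rep x g - rep x h"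
    and rep_mult: "x \<in> C \<Longrightarrow> y \<in> C \<Longrightarrow> rep (x * y) g = rep x (rep y g)"
    and rep_S: "x \<in> C \<Longrightarrow> rep (S k * x) g = smul k (rep x g)"
    and rep_V: "v \<in> verts G \<Longrightarrow> rep (V v) g = ext (rep_V v) g"
    and rep_E: "e \<in> arcs G \<Longrightarrow> rep (E e) g = ext (rep_E e) g"
    and rep_Es: "e \<in> arcs G \<Longrightarrow> rep (Es e) g = ext (rep_Es e) g"
begin

lemma zero_C: "0 \<in> C"
  by (rule subgrp_zero[OF subgrp_C])

lemma rep_zero_left: "rep 0 g = 0"
  using rep_diff_left[OF zero_C zero_C, of g] by simp

lemma rep_add_left:
  assumes "x \<in> C" "y \<in> C"
  shows "rep (x + y) g = rep x g + rep y g"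
  using rep_diff_left[OF subgrp_add[OF subgrp_C assms] assms(2), of g] by simp

lemma rep_P_V:
  assumes "awalk u p w"
  shows "rep (P p * V w) g = ext (\<lambda>(x, n). if valid x \<and> src x = w
    then single (app p x, n + int (length p)) 1 else 0) g"
  using assms
proof (induction p arbitrary: u)
  case Nil
  then show ?case
    by (auto simp: P_simps rep_V rep_V_def app_simps awalk_Nil_iff intro!: ext_cong)
next
  case (Cons e p)
  then have e: "e \<in> arcs G" "awalk (head G e) p w" by (auto simp: awalk_Cons_iff)
  have "rep (P (e # p) * V w) g = rep (E e) (rep (P p * V w) g)"
    using e by (simp add: P_simps mult.assoc rep_mult E_in_C P_V_in_C)
  also have "\<dots> = ext (rep_E e) (ext (\<lambda>(x, n). if valid x \<and> src x = w
    then single (app p x, n + int (length p)) 1 else 0) g)"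
    using Cons.IH[OF e(2)] rep_E[OF e(1)] by simp
  also have "\<dots> = ext (\<lambda>(x, n). if valid x \<and> src x = w
    then single (app (e # p) x, n + int (length (e # p))) 1 else 0) g"
    unfolding ext_ext using valid_app[of "head G e" p] e
    by (intro ext_cong) (auto simp: rep_E_def app_simps algebra_simps split: prod.splits)
  finally show ?case .
qed

lemma rep_vertex_closed_sum:
  assumes "valid x" "src x = w" "w \<in> verts G" "closed_walks w cs"
  shows "closed_sum w cs \<in> C \<and>
    lookup (rep (S k * V w + closed_sum w cs) (single (x, 0) 1)) (x, 0) = k"
proof -
  have "closed_sum w cs \<in> C \<and>
    lookup (rep (closed_sum w cs) (single (x, 0) 1)) (x, 0) = 0"
    using assms(4)
  proof (induction cs)
    case Nil
    then show ?case by (simp add: closed_sum_def zero_C rep_zero_left)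
  next
    case (Cons ac cs)
    obtain a c where ac: "ac = (a, c)" by fastforce
    then have c: "awalk w c w" "c \<noteq> []" and IH: "closed_sum w cs \<in> C"
      "lookup (rep (closed_sum w cs) (single (x, 0) 1)) (x, 0) = 0"
      using Cons by (auto simp: closed_walks_def)
    have eq: "closed_sum w (ac # cs) = S a * (P c * V w) + closed_sum w cs"
      by (simp add: closed_sum_def ac)
    have in_C: "S a * (P c * V w) \<in> C" by (rule S_C[OF P_V_in_C[OF c(1)]])
    have "rep (S a * (P c * V w)) (single (x, 0) 1) =
      single (app c x, int (length c)) a"
      using assms by (simp add: rep_S[OF P_V_in_C[OF c(1)]] rep_P_V[OF c(1)])
    then show ?case
      unfolding eq using c(2) IH in_C
      by (auto simp: rep_add_left lookup_add lookup_single "when_def" intro: subgrp_add[OF subgrp_C])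
  qed
  moreover have "S k * V w \<in> C" by (rule S_C[OF V_in_C[OF assms(3)]])
  moreover have "rep (S k * V w) (single (x, 0) 1) = single (x, 0) k"
    using assms by (simp add: rep_S V_in_C rep_V rep_V_def)
  ultimately show ?thesis
    by (simp add: rep_add_left lookup_add)
qed

lemma vertex_closed_sum_nonzero:
  assumes "w \<in> verts G" "closed_walks w cs" "k \<noteq> 0"
  shows "\<exists>g. rep (S k * V w + closed_sum w cs) g \<noteq> 0"
  using rep_vertex_closed_sum[OF valid_path_from src_path_from assms(1,2), of k] assms
  by (metis lookup_zero)

lemma closed_sum_in_C: "w \<in> verts G \<Longrightarrow> closed_walks w cs \<Longrightarrow> closed_sum w cs \<in> C"
  using rep_vertex_closed_sum[OF valid_path_from src_path_from] by blast

lemma V_nonzero: "w \<in> verts G \<Longrightarrow> V w \<noteq> 0"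
  using vertex_closed_sum_nonzero[of w "[]" 1]
  by (auto simp: closed_walks_def closed_sum_def S_one_V rep_zero_left)

lemma shift_rep:
  assumes "z \<in> C"
  shows "shift m (rep z g) = rep z (shift m g)"
proof -
  define K where "K z \<longleftrightarrow> z \<in> C \<and> (\<forall>g. shift m (rep z g) = rep z (shift m g))" for z
  have K_mult: "K (x * y)" if "K x" "K y" for x y
    using that by (simp add: K_def C_mult rep_mult)
  have K_V: "K (V v)" if "v \<in> verts G" for v
    using that by (simp add: K_def V_in_C rep_V shift_rep_V)
  have K_E: "K (E e)" "K (Es e)" if "e \<in> arcs G" for e
    using that by (simp_all add: K_def E_in_C Es_in_C rep_E rep_Es shift_rep_E shift_rep_Es)
  have K_P: "K (P p * x)" if "set p \<subseteq> arcs G" "K x" for p x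
    using that by (induction p) (auto simp: P_simps mult.assoc intro: K_mult K_E)
  have K_Q: "K (V w * Q q)" if "w \<in> verts G" "set q \<subseteq> arcs G" for w q
    using that(2)
  proof (induction q)
    case Nil
    then show ?case using K_V that by (simp add: Q_simps)
  next
    case (Cons e q)
    then show ?case using K_mult[of "V w * Q q" "Es e"] K_E by (simp add: Q_simps mult.assoc)
  qed
  have "K z"
    using assms
  proof (induction rule: C_induct)
    case zero
    then show ?case by (simp add: K_def zero_C rep_zero_left shift_def)
  next
    case (mono k p w q u u')
    then have "K (P p * (V w * Q q))"
      by (intro K_P K_Q) auto
    then show ?case
      by (simp add: K_def mono_def S_C rep_S shift_smul)
  next
    case (diff x y)
    then show ?case
      by (simp add: K_def subgrp_diff[OF subgrp_C] rep_diff_left shift_diff)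
  qed
  then show ?thesis by (simp add: K_def)
qed

lemma keys_rep_V: "w \<in> verts G \<Longrightarrow> keys (rep (V w) g) \<subseteq> {(x, n). valid x \<and> src x = w}"
  using keys_ext[of "rep_V w" g] by (fastforce simp: rep_V rep_V_def split: if_splits)

lemma long_closed_walk:
  assumes "awalk w c w" "c \<noteq> []"
  obtains c' where "awalk w c' w" "L \<le> length c'" "c' \<noteq> []"
proof -
  have "awalk w (concat (replicate n c)) w" for n
    using assms by (induction n) (auto simp: awalk_Nil_iff)
  moreover have "length (concat (replicate n c)) = n * length c" for n
    by (induction n) auto
  then have "L \<le> length (concat (replicate (Suc L) c))" "concat (replicate (Suc L) c) \<noteq> []"
    using assms(2) by (cases c; simp)+
  ultimately show thesis using that by blast
qed

lemma width_minus_shift: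
  fixes u :: "('v, 'e) bpath \<times> int \<Rightarrow>\<^sub>0 'k"
  assumes u: "u \<noteq> 0" "keys u \<subseteq> {x} \<times> UNIV" and m: "m > 0"
  shows "\<exists>a b. (x, a) \<in> keys (u - shift m u) \<and> (x, b) \<in> keys (u - shift m u) \<and> b - a \<ge> m"
proof -
  define N where "N = snd ` keys u"
  have N: "finite N" "N \<noteq> {}" using u(1) by (auto simp: N_def)
  have mem: "(x, n) \<in> keys u \<longleftrightarrow> n \<in> N" for n
    using u(2) by (force simp: N_def image_iff)
  have "Min N - m \<notin> N" "Max N + m \<notin> N"
    using Min_le[OF N(1), of "Min N - m"] Max_ge[OF N(1), of "Max N + m"] m by auto
  moreover have "Min N \<in> N" "Max N \<in> N" "Min N \<le> Max N" using N by auto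
  ultimately have "(x, Min N) \<in> keys (u - shift m u)" "(x, Max N + m) \<in> keys (u - shift m u)"
    unfolding mem[symmetric] by (auto simp: in_keys_iff lookup_minus lookup_shift)
  then show ?thesis using \<open>Min N \<le> Max N\<close> by (intro exI[of _ "Min N"] exI[of _ "Max N + m"]) simp
qed

text \<open>
  Only one boundary path \<open>x\<close> starts at \<open>w\<close>.  On multiples of \<open>x\<close> in all degrees, \<open>w - c\<close> acts like
  \<open>1 - shift m\<close> for a closed walk \<open>c\<close> of length \<open>m\<close>, so if \<open>y\<close> were in the left ideal generated by
  \<open>(w - c) y\<close>, the image of \<open>y\<close> would contain an element of bounded width of the form
  \<open>u - shift m u\<close>, for arbitrarily large \<open>m\<close>.
\<close>

lemma no_simple_at_cycle:
  assumes nobif: "nobif w" and c: "awalk w c w" "c \<noteq> []"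
    and S: "lsimple C T" and y: "y \<in> T" "V w * y = y" "rep y d \<noteq> 0"
  shows False
proof -
  have w: "w \<in> verts G" using c by auto
  define x where "x = path_from w"
  have x: "valid x" "src x = w" using w by (simp_all add: x_def valid_path_from src_path_from)
  have keys_V: "keys (rep (V w) g) \<subseteq> {x} \<times> UNIV" for g
    using keys_rep_V[OF w, of g] valid_unique[OF nobif _ x(1) _ x(2)] by auto
  have yC: "y \<in> C" using S y by (auto simp: lsimple_def lideal_def)
  define g where "g = rep y d"
  have gV: "g = rep (V w) g"
    using rep_mult[OF V_in_C[OF w] yC, of d] y(2) by (simp add: g_def)
  then have g: "keys g \<subseteq> {x} \<times> UNIV" "g \<noteq> 0"
    using keys_V[of g] y(3) by (auto simp: g_def)
  obtain L where L: "\<And>a b. (x, a) \<in> keys g \<Longrightarrow> (x, b) \<in> keys g \<Longrightarrow> b - a < int L"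
  proof -
    let ?D = "(\<lambda>(s, t). snd t - snd s) ` (keys g \<times> keys g)"
    have "b - a < int (nat (Max ?D + 1))" if "(x, a) \<in> keys g" "(x, b) \<in> keys g" for a b
    proof -
      have "b - a \<in> ?D" using that by force
      then have "b - a \<le> Max ?D" by (intro Max_ge) auto
      then show ?thesis by linarith
    qed
    then show thesis using that by blast
  qed
  obtain c' where c': "awalk w c' w" "L \<le> length c'" "c' \<noteq> []"
    using long_closed_walk[OF c] by blast
  define m where "m = int (length c')"
  have m: "m > 0" "int L \<le> m" using c' by (auto simp: m_def)
  have app_c': "app c' x = x"
    using valid_app[of w c' x] c'(1) x valid_unique[OF nobif] by blast
  have rep_c': "rep (V w - P c' * V w) h = h - shift m h" if "keys h \<subseteq> {x} \<times> UNIV" for h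
  proof -
    have "rep (P c' * V w) h = shift m h"
      unfolding rep_P_V[OF c'(1)] shift_def m_def
      using that x app_c' by (intro ext_cong) auto
    moreover have "rep (V w) h = smul 1 h"
      unfolding rep_V[OF w] ext_ident[symmetric]
      using that x by (intro ext_cong) (auto simp: rep_V_def)
    ultimately show ?thesis
      by (simp add: rep_diff_left V_in_C[OF w] P_V_in_C[OF c'(1)])
  qed
  define f where "f = V w - P c' * V w"
  have fC: "f \<in> C" using w c'(1) by (simp add: f_def subgrp_diff[OF subgrp_C] V_in_C P_V_in_C)
  have rep_fy: "rep (f * y) d = g - shift m g"
    using rep_mult[OF fC yC, of d] rep_c'[OF g(1)] by (simp add: f_def g_def)
  then have "rep (f * y) d \<noteq> 0"
    using width_minus_shift[OF g(2,1) m(1)] by auto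
  then have "f * y \<noteq> 0" using rep_zero_left by auto
  moreover have "f * y \<in> T"
    using S y(1) fC by (auto simp: lsimple_def lideal_def)
  ultimately have "y \<in> (\<lambda>z. z * (f * y)) ` C"
    using lsimple_principal[OF subrng_C left_units_C S] y(1) by blast
  then obtain z where z: "z \<in> C" "y = z * (f * y)" by auto
  then have zy: "y = (V w * z) * (f * y)"
    using y(2) by (metis mult.assoc)
  have zC: "V w * z \<in> C" using z(1) w by (rule V_C)
  define u where "u = rep (V w * z) g"
  have "g = rep (V w * z) (g - shift m g)"
    using rep_mult[OF zC C_mult[OF fC yC], of d] zy rep_fy by (simp add: g_def)
  then have gu: "g = u - shift m u"
    by (simp add: u_def rep_diff[OF zC] shift_rep[OF zC])
  then have "u \<noteq> 0" using g(2) by (auto simp: shift_def)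
  moreover have "keys u \<subseteq> {x} \<times> UNIV"
    unfolding u_def rep_mult[OF V_in_C[OF w] z(1)] by (rule keys_V)
  ultimately show False
    using width_minus_shift[of u x m] m L unfolding gu[symmetric] by fastforce
qed

end

section \<open>The ideal generated by the line points\<close>

definition semisimple_lideal :: "'a::ring set \<Rightarrow> 'a set \<Rightarrow> bool" where
  "semisimple_lideal C J \<longleftrightarrow> lideal C J \<and> (\<exists>\<S>. (\<forall>S\<in>\<S>. lsimple C S) \<and> J = aspan (\<Union>\<S>))"

definition locally_lart :: "'a::ring set \<Rightarrow> bool" where
  "locally_lart J \<longleftrightarrow> (\<forall>X. finite X \<and> X \<subseteq> J \<longrightarrow>
    (\<exists>e\<in>J. e * e = e \<and> X \<subseteq> (\<lambda>x. e * x * e) ` J \<and> lart ((\<lambda>x. e * x * e) ` J)))"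

context leavitt_rep
begin

definition line_ideal :: "'a set" where
  "line_ideal = aspan {a * (V v * b) | a v b. a \<in> C \<and> v \<in> line_points G \<and> b \<in> C}"

lemma line_ideal_gen: "a \<in> C \<Longrightarrow> v \<in> line_points G \<Longrightarrow> b \<in> C \<Longrightarrow> a * (V v * b) \<in> line_ideal"
  unfolding line_ideal_def by (rule aspan.base) blast

lemma subgrp_line_ideal: "subgrp line_ideal"
  unfolding line_ideal_def by (rule subgrp_aspan)

lemma line_ideal_subset: "line_ideal \<subseteq> C"
  unfolding line_ideal_def
  by (rule aspan_subset) (auto intro: C_mult V_in_C line_points_verts subgrp_C)

lemma lideal_line_ideal: "lideal C line_ideal"
  unfolding lideal_def
proof (intro conjI ballI line_ideal_subset subgrp_line_ideal)
  fix r x assume r: "r \<in> C" and "x \<in> line_ideal"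
  from this(2)[unfolded line_ideal_def] show "r * x \<in> line_ideal"
  proof (rule aspan_image[where f = "\<lambda>x. r * x", rotated])
    fix x assume "x \<in> {a * (V v * b) | a v b. a \<in> C \<and> v \<in> line_points G \<and> b \<in> C}"
    then obtain a v b where "x = a * (V v * b)" "a \<in> C" "v \<in> line_points G" "b \<in> C" by blast
    then show "r * x \<in> line_ideal"
      using line_ideal_gen[of "r * a" v b] r by (simp add: C_mult mult.assoc)
  qed (simp_all add: right_diff_distrib subgrp_line_ideal)
qed

lemma rideal_line_ideal: "rideal C line_ideal"
  unfolding rideal_def
proof (intro conjI ballI line_ideal_subset subgrp_line_ideal)
  fix r x assume r: "r \<in> C" and "x \<in> line_ideal"
  from this(2)[unfolded line_ideal_def] show "x * r \<in> line_ideal"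
  proof (rule aspan_image[where f = "\<lambda>x. x * r", rotated])
    fix x assume "x \<in> {a * (V v * b) | a v b. a \<in> C \<and> v \<in> line_points G \<and> b \<in> C}"
    then obtain a v b where "x = a * (V v * b)" "a \<in> C" "v \<in> line_points G" "b \<in> C" by blast
    then show "x * r \<in> line_ideal"
      using line_ideal_gen[of a v "b * r"] r by (simp add: C_mult mult.assoc)
  qed (simp_all add: left_diff_distrib subgrp_line_ideal)
qed

lemma V_in_line_ideal: "v \<in> line_points G \<Longrightarrow> V v \<in> line_ideal"
  using line_ideal_gen[of "V v" v "V v"] by (simp add: line_points_verts V_in_C V_V)

lemma line_ideal_minimal:
  assumes "lideal C T" "rideal C T" "V ` line_points G \<subseteq> T"
  shows "line_ideal \<subseteq> T"
  unfolding line_ideal_def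
proof (rule aspan_subset)
  show "{a * (V v * b) | a v b. a \<in> C \<and> v \<in> line_points G \<and> b \<in> C} \<subseteq> T"
    using assms(3) lidealD(3)[OF assms(1)] rideal_mult[OF assms(2)] by blast
  show "subgrp T" using assms(1) by (rule lidealD)
qed

lemma lsimple_line_point:
  assumes "v \<in> line_points G" "b \<in> C" "V v * b \<noteq> 0"
  shows "lsimple C ((\<lambda>z. z * (V v * b)) ` C)"
proof -
  have v: "v \<in> verts G" using assms(1) by (rule line_points_verts)
  have "lsimple C ((\<lambda>z. z * V v) ` C)"
  proof (rule lsimpleI[OF left_units_C])
    show "lideal C ((\<lambda>z. z * V v) ` C)"
      by (intro lideal_image_mult subrng_C lideal_self V_in_C v)
    show "V v \<in> (\<lambda>z. z * V v) ` C"
      using V_in_C[OF v] V_V[OF v v] by force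
    show "V v \<noteq> 0" using v by (rule V_nonzero)
  next
    fix y s assume y: "y \<in> (\<lambda>z. z * V v) ` C" "y \<noteq> 0" and s: "s \<in> (\<lambda>z. z * V v) ` C"
    have "y \<in> C" "y * V v = y"
      using y(1) V_V[OF v v] by (auto simp: mult.assoc C_mult V_in_C v)
    then obtain z where z: "z \<in> C" "z * y = V v"
      using line_point_mem_left_ideal[OF assms(1) _ _ y(2)] by blast
    obtain z' where "z' \<in> C" "s = z' * V v" using s by auto
    then have "s = (z' * z) * y" "z' * z \<in> C"
      using z by (simp_all add: mult.assoc C_mult)
    then show "\<exists>z\<in>C. s = z * y" by blast
  qed
  moreover have "V v \<in> (\<lambda>z. z * V v) ` C"
    using V_in_C[OF v] V_V[OF v v] by force
  ultimately have "lsimple C ((\<lambda>z. z * b) ` (\<lambda>z. z * V v) ` C)"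
    by (rule lsimple_image_mult[OF subrng_C left_units_C _ assms(2) _ assms(3)])
  then show ?thesis by (simp add: image_image mult.assoc)
qed

theorem semisimple_line_ideal: "semisimple_lideal C line_ideal"
  unfolding semisimple_lideal_def
proof (intro conjI exI)
  show "lideal C line_ideal" by (rule lideal_line_ideal)
  define \<S> where "\<S> = {S. lsimple C S \<and> S \<subseteq> line_ideal}"
  show "\<forall>S\<in>\<S>. lsimple C S" by (simp add: \<S>_def)
  show "line_ideal = aspan (\<Union>\<S>)"
  proof
    show "aspan (\<Union>\<S>) \<subseteq> line_ideal"
      by (rule aspan_subset) (auto simp: \<S>_def subgrp_line_ideal)
    show "line_ideal \<subseteq> aspan (\<Union>\<S>)"
      unfolding line_ideal_def
    proof (rule aspan_subset[OF _ subgrp_aspan], safe)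
      fix a v b assume *: "a \<in> C" "v \<in> line_points G" "b \<in> C"
      show "a * (V v * b) \<in> aspan (\<Union>\<S>)"
      proof (cases "V v * b = 0")
        case True
        then show ?thesis by (simp add: aspan.zero)
      next
        case False
        then have "(\<lambda>z. z * (V v * b)) ` C \<in> \<S>"
          using * lsimple_line_point line_ideal_gen by (auto simp: \<S>_def)
        then show ?thesis
          using *(1) by (intro aspan.base) blast
      qed
    qed
  qed
qed


subsection \<open>Minimal left ideals\<close>

lemma lsimple_vertex_tree:
  assumes "lsimple C T" "V w \<in> T" "u \<in> tree G w"
  shows "\<exists>T'. lsimple C T' \<and> V u \<in> T'"
proof -
  obtain q where q: "awalk w q u" using assms(3) by (auto simp: mem_tree_iff)
  then have u: "u \<in> verts G" and w: "w \<in> verts G" by auto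
  let ?T = "(\<lambda>z. z * (P q * V u)) ` T"
  have Vu: "Q q * (P q * V u) = V u" by (rule Q_P_V[OF q])
  then have ne: "P q * V u \<noteq> 0" using V_nonzero[OF u] by auto
  have eq: "V w * (P q * V u) = P q * V u" using V_P_V[OF q w] by simp
  have T': "lsimple C ?T"
    using assms(1,2) ne eq
    by (intro lsimple_image_mult[OF subrng_C left_units_C _ P_V_in_C[OF q], where s = "V w"]) auto
  have "P q * V u \<in> ?T" using assms(2) eq by (metis image_eqI)
  moreover have "V u * Q q \<in> C" by (rule V_Q_in_C[OF q])
  ultimately have "(V u * Q q) * (P q * V u) \<in> ?T"
    using lsimple_mult[OF T'] by blast
  then have "V u \<in> ?T"
    using Vu V_V[OF u u] by (simp add: mult.assoc)
  with T' show ?thesis by blast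
qed

lemma lsimple_vertex_no_bifurcation:
  assumes T: "lsimple C T" "V u \<in> T"
  shows "\<not> bifurcation G u"
proof
  assume "bifurcation G u"
  then obtain e f where ef: "e \<in> arcs G" "tail G e = u" "f \<in> arcs G" "tail G f = u" "e \<noteq> f"
    by (rule bifurcationE) auto
  let ?d = "E e * Es e"
  have dC: "?d \<in> C" using ef by (simp add: C_mult E_in_C Es_in_C)
  have "?d * V u = ?d" using Es_V_tail[OF ef(1)] ef by (simp add: mult.assoc)
  then have "?d \<in> T"
    using lsimple_mult[OF T(1) dC T(2)] by simp
  moreover have "Es e * ?d = Es e"
    using ef V_head_Es[OF ef(1)] by (simp add: Es_E flip: mult.assoc)
  then have "?d \<noteq> 0"
    using ef Es_E[OF ef(1,1)] V_nonzero[of "head G e"] by auto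
  ultimately have "V u \<in> (\<lambda>z. z * ?d) ` C"
    using lsimple_principal[OF subrng_C left_units_C T(1)] T(2) by blast
  then obtain z where "V u = z * ?d" by blast
  then have "V u * E f = 0"
    using ef Es_E[OF ef(1,3)] by (simp add: mult.assoc)
  then have "E f = 0" using V_tail_E[OF ef(3)] ef by simp
  then show False
    using Es_E[OF ef(3,3)] V_nonzero[of "head G f"] ef by simp
qed

lemma lsimple_vertex_line_point:
  assumes T: "lsimple C T" "V w \<in> T" and w: "w \<in> verts G"
  shows "w \<in> line_points G"
proof -
  have nobif: "\<not> bifurcation G u" if "u \<in> tree G w" for u
    using lsimple_vertex_tree[OF T that] lsimple_vertex_no_bifurcation by blast
  have "\<not> on_cycle G u" if u: "u \<in> tree G w" for u
  proof
    assume "on_cycle G u"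
    then obtain c where c: "c \<noteq> []" "awalk u c u" by (rule on_cycle_closed_walk)
    then have uv: "u \<in> verts G" by auto
    obtain T' where T': "lsimple C T'" "V u \<in> T'"
      using lsimple_vertex_tree[OF T u] by blast
    have "nobif u" using nobif tree_trans[OF u] by (auto simp: nobif_def)
    moreover obtain d where "rep (V u) d \<noteq> 0"
      using vertex_closed_sum_nonzero[OF uv, of "[]" 1] uv
      by (auto simp: closed_walks_def closed_sum_def S_one_V)
    ultimately show False
      using no_simple_at_cycle c T' V_V[OF uv uv] by metis
  qed
  then show ?thesis
    using w nobif by (auto simp: line_points_def)
qed

lemma closed_sum_V: "w \<in> verts G \<Longrightarrow> closed_walks w cs \<Longrightarrow> V w * closed_sum w cs = closed_sum w cs"
  by (induction cs)
    (auto simp: closed_sum_def closed_walks_def distrib_left V_S_left V_P_V)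

theorem lsimple_subset_line_ideal:
  assumes T: "lsimple C T"
  shows "T \<subseteq> line_ideal"
proof -
  obtain x where x: "x \<in> T" "x \<noteq> 0"
    using lsimple_nonzero[OF T] by blast
  have TC: "T \<subseteq> C" by (rule lidealD(1)[OF lsimple_lideal[OF T]])
  obtain a b k w cs where *: "a \<in> C" "b \<in> C" "k \<noteq> 0" "w \<in> verts G" "closed_walks w cs"
    "cs = [] \<or> nobif w" "a * x * b = S k * V w + closed_sum w cs"
    using reduction[OF subsetD[OF TC x(1)] x(2)] .
  let ?y = "S k * V w + closed_sum w cs"
  obtain d where d: "rep ?y d \<noteq> 0" using vertex_closed_sum_nonzero *(3,4,5) by blast
  then have y0: "?y \<noteq> 0" using rep_zero_left by auto
  let ?T = "(\<lambda>z. z * b) ` T"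
  have ax: "a * x \<in> T" using lsimple_mult[OF T *(1) x(1)] .
  have T': "lsimple C ?T"
    by (rule lsimple_image_mult[OF subrng_C left_units_C T *(2) ax]) (simp add: *(7) y0)
  have yT: "?y \<in> ?T" using ax *(7) by (metis image_eqI)
  have "cs = []"
  proof (rule ccontr)
    assume "cs \<noteq> []"
    then obtain a' c cs' where cs: "cs = (a', c) # cs'" by (cases cs) auto
    have c: "awalk w c w" "c \<noteq> []" using *(5) cs by (auto simp: closed_walks_def)
    have "V w * ?y = ?y"
      using closed_sum_V[OF *(4,5)] *(4) V_V[of w w] by (simp add: distrib_left V_S_left)
    then show False
      using no_simple_at_cycle[OF _ c T' yT _ d] *(6) \<open>cs \<noteq> []\<close> by blast
  qed
  then have "?y = S k * V w" by (simp add: closed_sum_def)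
  then have "S (1 / k) * V w * ?y = V w"
    using S_inverse[OF *(3,4)] V_V[OF *(4,4)] *(4) by (simp add: mult.assoc V_S_left)
  moreover have "S (1 / k) * V w * ?y \<in> ?T"
    using lsimple_mult[OF T' S_C[OF V_in_C[OF *(4)]] yT] .
  ultimately have VT: "V w \<in> ?T" by simp
  then have wl: "w \<in> line_points G"
    using lsimple_vertex_line_point[OF T'] *(4) by blast
  obtain x0 where x0: "x0 \<in> T" "V w = x0 * b" using VT by blast
  define x1 where "x1 = V w * x0"
  have "x1 * b = V w" using x0 V_V[OF *(4,4)] by (simp add: x1_def mult.assoc)
  then have "x1 \<noteq> 0" using V_nonzero[OF *(4)] by auto
  moreover have "x1 \<in> T" unfolding x1_def by (rule lsimple_mult[OF T V_in_C[OF *(4)] x0(1)])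
  ultimately have "T = (\<lambda>z. z * x1) ` C"
    by (intro lsimple_principal[OF subrng_C left_units_C T])
  moreover have "x1 \<in> line_ideal"
    unfolding x1_def using V_in_line_ideal[OF wl] x0(1) TC by (intro rideal_mult[OF rideal_line_ideal]) auto
  ultimately show ?thesis
    using lidealD(3)[OF lideal_line_ideal] by auto
qed


subsection \<open>The algebra is semiprime\<close>

lemma S_closed_sum: "closed_walks w cs \<Longrightarrow> \<exists>ds. closed_walks w ds \<and> S k * closed_sum w cs = closed_sum w ds"
proof (induction cs)
  case Nil
  then show ?case by (intro exI[of _ "[]"]) (simp add: closed_sum_def)
next
  case (Cons ac cs)
  obtain a c where ac: "ac = (a, c)" by fastforce
  obtain ds where "closed_walks w ds" "S k * closed_sum w cs = closed_sum w ds"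
    using Cons by (auto simp: closed_walks_def)
  then show ?case
    using Cons.prems
    by (intro exI[of _ "(k * a, c) # ds"]) (auto simp: ac closed_walks_def closed_sum_def distrib_left S_mult mult.assoc)
qed

lemma closed_sum_append: "closed_sum w (cs @ ds) = closed_sum w cs + closed_sum w ds"
  by (simp add: closed_sum_def)

lemma closed_walks_append: "closed_walks w (cs @ ds) \<longleftrightarrow> closed_walks w cs \<and> closed_walks w ds"
  by (auto simp: closed_walks_def)

lemma closed_sum_add:
  "closed_walks w cs \<Longrightarrow> closed_walks w ds \<Longrightarrow> \<exists>es. closed_walks w es \<and> closed_sum w cs + closed_sum w ds = closed_sum w es"
  using closed_walks_append closed_sum_append by metis

lemma P_closed_sum:
  assumes "awalk w c w" "c \<noteq> []" "closed_walks w ds"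
  shows "\<exists>es. closed_walks w es \<and> P c * V w * closed_sum w ds = closed_sum w es"
  using assms(3)
proof (induction ds)
  case Nil
  then show ?case by (intro exI[of _ "[]"]) (simp add: closed_sum_def)
next
  case (Cons bd ds)
  obtain b d where bd: "bd = (b, d)" by fastforce
  obtain es where es: "closed_walks w es" "P c * V w * closed_sum w ds = closed_sum w es"
    using Cons by (auto simp: closed_walks_def)
  have d: "awalk w d w" and w: "w \<in> verts G" using Cons.prems bd assms(1) by (auto simp: closed_walks_def)
  have "P c * V w * (S b * (P d * V w)) = S b * (P (c @ d) * V w)"
    using assms(1) d w V_P_V[OF d w] by (auto simp: mult.assoc V_S_left P_S_left P_simps)
  then show ?case
    using es d assms(1,2)
    by (intro exI[of _ "(b, c @ d) # es"]) (auto simp: bd closed_walks_def closed_sum_def distrib_left)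
qed

lemma closed_sum_mult:
  assumes "closed_walks w cs" "closed_walks w ds"
  shows "\<exists>es. closed_walks w es \<and> closed_sum w cs * closed_sum w ds = closed_sum w es"
  using assms(1)
proof (induction cs)
  case Nil
  then show ?case by (intro exI[of _ "[]"]) (simp add: closed_sum_def)
next
  case (Cons ac cs)
  obtain a c where ac: "ac = (a, c)" by fastforce
  have c: "awalk w c w" "c \<noteq> []" using Cons.prems by (auto simp: ac closed_walks_def)
  obtain es where es: "closed_walks w es" "closed_sum w cs * closed_sum w ds = closed_sum w es"
    using Cons by (auto simp: closed_walks_def)
  obtain fs where "closed_walks w fs" "P c * V w * closed_sum w ds = closed_sum w fs"
    using P_closed_sum[OF c assms(2)] by blast
  then obtain fs' where fs': "closed_walks w fs'" "S a * (P c * V w * closed_sum w ds) = closed_sum w fs'"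
    using S_closed_sum[of w fs a] by auto
  have "closed_sum w (ac # cs) * closed_sum w ds = closed_sum w fs' + closed_sum w es"
    unfolding es(2)[symmetric] fs'(2)[symmetric] by (simp add: closed_sum_def ac distrib_right mult.assoc)
  then show ?case using closed_sum_add[OF fs'(1) es(1)] by simp
qed

lemma semiprime:
  assumes "x \<in> C" "x \<noteq> 0"
  shows "\<exists>z\<in>C. x * z * x \<noteq> 0"
proof (rule ccontr)
  assume "\<not> ?thesis"
  then have zero: "x * z * x = 0" if "z \<in> C" for z using that by blast
  obtain a b k w cs where *: "a \<in> C" "b \<in> C" "k \<noteq> 0" "w \<in> verts G" "closed_walks w cs"
    "cs = [] \<or> nobif w" "a * x * b = S k * V w + closed_sum w cs"
    by (rule reduction[OF assms])
  let ?s = "closed_sum w cs"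
  have "(S k * V w + ?s) * (S k * V w + ?s) = a * (x * (b * a) * x) * b"
    unfolding *(7)[symmetric] by (simp add: mult.assoc)
  also have "\<dots> = 0" using zero[OF C_mult[OF *(2,1)]] by simp
  finally have sq: "(S k * V w + ?s) * (S k * V w + ?s) = 0" .
  have sV: "?s * V w = ?s"
    using *(4) V_V[OF *(4,4)] by (induction cs) (auto simp: closed_sum_def distrib_right mult.assoc)
  have Vs: "V w * ?s = ?s" by (rule closed_sum_V[OF *(4,5)])
  have VV: "S k * V w * (S k * V w) = S (k * k) * V w"
    using *(4) V_V[OF *(4,4)] by (simp add: S_mult mult.assoc V_S_left)
  have Vs': "S k * V w * ?s = S k * ?s"
    using Vs by (simp add: mult.assoc)
  have "?s * S k = S k * ?s"
    by (rule S_commute[OF closed_sum_in_C[OF *(4,5)]])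
  then have sV': "?s * (S k * V w) = S k * ?s"
    using sV by (metis mult.assoc)
  obtain ds where ds: "closed_walks w ds" "S k * ?s = closed_sum w ds" using S_closed_sum[OF *(5)] by blast
  obtain es where es: "closed_walks w es" "?s * ?s = closed_sum w es" using closed_sum_mult[OF *(5,5)] by blast
  have "(S k * V w + ?s) * (S k * V w + ?s) = S (k * k) * V w + (closed_sum w ds + closed_sum w ds + closed_sum w es)"
    by (simp only: distrib_left distrib_right VV Vs' sV' ds es) simp
  also have "closed_sum w ds + closed_sum w ds + closed_sum w es = closed_sum w (ds @ ds @ es)"
    by (simp add: closed_sum_append)
  finally show False
    using sq vertex_closed_sum_nonzero[OF *(4), of "ds @ ds @ es" "k * k"] *(3) ds(1) es(1)
    by (auto simp: closed_walks_append rep_zero_left)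
qed

theorem locally_lart_subset_line_ideal:
  assumes J: "lideal C J" "rideal C J" "locally_lart J"
  shows "J \<subseteq> line_ideal"
proof
  fix x assume x: "x \<in> J"
  have "\<exists>e\<in>J. e * e = e \<and> {x} \<subseteq> (\<lambda>x. e * x * e) ` J \<and> lart ((\<lambda>x. e * x * e) ` J)"
    using J(3)[unfolded locally_lart_def, rule_format, of "{x}"] x by simp
  then obtain e where e: "e \<in> J" "e * e = e" "x \<in> (\<lambda>x. e * x * e) ` J" "lart ((\<lambda>x. e * x * e) ` J)"
    by blast
  have JC: "J \<subseteq> C" using J(1) by (rule lidealD)
  have "(\<lambda>x. e * x * e) ` J = (\<lambda>x. e * x * e) ` C"
  proof
    show "(\<lambda>x. e * x * e) ` C \<subseteq> (\<lambda>x. e * x * e) ` J"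
    proof safe
      fix y assume y: "y \<in> C"
      have "e * y * e = e * (e * y) * e" by (simp add: e(2) flip: mult.assoc)
      moreover have "e * y \<in> J" using e(1) y by (intro rideal_mult[OF J(2)])
      ultimately show "e * y * e \<in> (\<lambda>x. e * x * e) ` J" by (metis image_eqI)
    qed
  qed (use JC in auto)
  then have "lart ((\<lambda>x. e * x * e) ` C)" using e(4) by simp
  moreover have "e \<in> C" using e(1) JC by blast
  ultimately have "e \<in> line_ideal"
    using semiprime lsimple_subset_line_ideal e(2)
    by (intro artinian_corner_subset[OF subrng_C left_units_C _ lideal_line_ideal rideal_line_ideal])
  moreover obtain y where "y \<in> J" "x = e * y * e" using e(3) by blast
  ultimately show "x \<in> line_ideal"
    using JC \<open>e \<in> C\<close> by (auto intro!: lidealD(3)[OF lideal_line_ideal] C_mult)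
qed

end

subsection \<open>Local artinianity\<close>

context leavitt_rep
begin

definition line_mono :: "'a set" where
  "line_mono = {mono k p w q | k p w q u u'. awalk u p w \<and> awalk u' q w \<and> w \<in> line_points G}"

definition proj :: "'e list \<Rightarrow> 'v \<Rightarrow> 'a" where
  "proj p w = P p * (V w * Q p)"

definition projs :: "'a set" where
  "projs = {proj p w | p w u. awalk u p w \<and> w \<in> line_points G}"

lemma awalk_line_point: "v \<in> line_points G \<Longrightarrow> awalk v q w \<Longrightarrow> w \<in> line_points G"
  using line_points_tree by (auto simp: mem_tree_iff)

lemma mult_V_line_mono:
  assumes "a \<in> C" "v \<in> line_points G"
  shows "a * V v \<in> aspan line_mono"
  using assms(1)
proof (induction rule: C_induct)
  case (mono k p w q u u')
  then have "mono k p w q \<in> line_mono" if "u' = v"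
    using that assms(2) awalk_line_point[of v q w] unfolding line_mono_def by blast
  then show ?case
    using mono line_points_verts[OF assms(2)] by (auto simp: mono_V intro: aspan.base aspan.zero)
qed (simp_all add: aspan.zero aspan.diff left_diff_distrib)

lemma V_mult_line_mono:
  assumes "b \<in> C" "v \<in> line_points G"
  shows "V v * b \<in> aspan line_mono"
  using assms(1)
proof (induction rule: C_induct)
  case (mono k p w q u u')
  then have "mono k p w q \<in> line_mono" if "u = v"
    using that assms(2) awalk_line_point[of v p w] unfolding line_mono_def by blast
  then show ?case
    using mono line_points_verts[OF assms(2)] by (auto simp: V_mono intro: aspan.base aspan.zero)
qed (simp_all add: aspan.zero aspan.diff right_diff_distrib)

lemma V_Q_P_V_incomparable:
  assumes p: "awalk u p w" and p': "awalk u' p' w'" and len: "length p' \<le> length p"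
    and ne: "\<not> (take (length p') p = p' \<and> (p' = [] \<longrightarrow> u = w'))"
  shows "V w * (Q p * (P p' * V w')) = 0"
proof -
  define p1 p2 where "p1 = take (length p') p" and "p2 = drop (length p') p"
  have pp: "p = p1 @ p2" by (simp add: p1_def p2_def)
  have l1: "length p1 = length p'" using len by (simp add: p1_def)
  obtain x where x: "awalk u p1 x" "awalk x p2 w" using p unfolding pp by auto
  have Q2: "V w * Q p2 = V w * (Q p2 * V x)" using V_Q_V[OF x(2), of x] x by auto
  have "V x * (Q p1 * (P p' * V w')) = 0"
  proof -
    have "\<not> (take (length p1) p' = p1 \<and> (p1 = [] \<longrightarrow> u' = x))"
    proof
      assume *: "take (length p1) p' = p1 \<and> (p1 = [] \<longrightarrow> u' = x)"
      then have "p1 = p'" using l1 by simp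
      then have "p' = []" "u \<noteq> w'" using ne by (simp_all add: p1_def)
      then have "u = x" "u' = w'" "u' = x"
        using x(1) p' * \<open>p1 = p'\<close> by (simp_all add: awalk_Nil_iff)
      then show False using \<open>u \<noteq> w'\<close> by simp
    qed
    moreover have "length p1 \<le> length p'" using l1 by simp
    ultimately show ?thesis using V_Q_P_V[OF x(1) p'] by (simp only: if_False)
  qed
  moreover have "V w * (Q p * (P p' * V w')) = V w * Q p2 * (Q p1 * (P p' * V w'))"
    by (simp add: pp Q_simps mult.assoc)
  ultimately show ?thesis unfolding Q2 by (simp add: mult.assoc)
qed

lemma proj_append:
  assumes "awalk u p w" "w \<in> line_points G" "awalk w r w'"
  shows "proj p w = proj (p @ r) w'"
  using V_eq_P_Q[OF assms(3) line_points_nobif[OF assms(2)]]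
  by (simp add: proj_def P_simps Q_simps mult.assoc)

text \<open>
  For line points \<open>w\<close> the idempotents \<open>p p\<^sup>*\<close> are equal or orthogonal: if \<open>p\<close> is a prefix of
  \<open>p' = p r\<close>, then \<open>r r\<^sup>* = w\<close>.
\<close>

lemma proj_mult:
  assumes p: "awalk u p w" "w \<in> line_points G" and p': "awalk u' p' w'" "w' \<in> line_points G"
  shows "proj p w = proj p' w' \<or> proj p w * proj p' w' = 0"
proof (cases "length p \<le> length p'")
  case True
  have eq: "proj p w * proj p' w' = P p * (V w * (Q p * (P p' * V w'))) * Q p'"
    by (simp add: proj_def mult.assoc)
  show ?thesis
  proof (cases "take (length p) p' = p \<and> (p = [] \<longrightarrow> u' = w)")
    case T: True
    then obtain r where r: "p' = p @ r" by (metis append_take_drop_id)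
    then have "awalk w r w'" using T p'(1) by (intro awalk_append_drop[OF p(1)]) auto
    then show ?thesis using proj_append[OF p] r by simp
  next
    case False
    then have "V w * (Q p * (P p' * V w')) = 0" using V_Q_P_V[OF p(1) p'(1) True] by (simp only: if_False)
    then show ?thesis unfolding eq by simp
  qed
next
  case False
  have eq: "proj p w * proj p' w' = P p * (V w * (Q p * (P p' * V w'))) * Q p'"
    by (simp add: proj_def mult.assoc)
  show ?thesis
  proof (cases "take (length p') p = p' \<and> (p' = [] \<longrightarrow> u = w')")
    case T: True
    then obtain r where r: "p = p' @ r" by (metis append_take_drop_id)
    then have "awalk w' r w" using T p(1) by (intro awalk_append_drop[OF p'(1)]) auto
    then show ?thesis using proj_append[OF p'] r by simp
  next
    case F: False
    then have "V w * (Q p * (P p' * V w')) = 0"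
      using V_Q_P_V_incomparable[OF p(1) p'(1) _ F] False by simp
    then show ?thesis unfolding eq by simp
  qed
qed

lemma proj_P_V: "awalk u p w \<Longrightarrow> proj p w * (P p * (V w * x)) = P p * (V w * x)"
proof -
  assume p: "awalk u p w"
  have "proj p w * (P p * (V w * x)) = P p * (V w * (Q p * (P p * V w) * x))"
    by (simp add: proj_def mult.assoc)
  also have "\<dots> = P p * (V w * V w * x)" unfolding Q_P_V[OF p] by (simp only: mult.assoc)
  finally show ?thesis using p V_V[of w w] awalk_last_in_verts[OF p] by simp
qed

lemma V_Q_proj: "awalk u p w \<Longrightarrow> V w * (Q p * proj p w) = V w * Q p"
proof -
  assume p: "awalk u p w"
  have "V w * (Q p * proj p w) = V w * (Q p * (P p * V w) * Q p)"
    by (simp add: proj_def mult.assoc)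
  also have "\<dots> = V w * V w * Q p" unfolding Q_P_V[OF p] by (simp add: mult.assoc)
  finally show ?thesis using p V_V[of w w] by auto
qed

lemma proj_idem: "d \<in> projs \<Longrightarrow> d * d = d"
  unfolding projs_def using proj_P_V by (auto simp: proj_def)

lemma projs_orthogonal: "d \<in> projs \<Longrightarrow> d' \<in> projs \<Longrightarrow> d \<noteq> d' \<Longrightarrow> d * d' = 0"
  unfolding projs_def using proj_mult by blast

lemma projs_line_ideal: "projs \<subseteq> line_ideal"
proof
  fix d assume "d \<in> projs"
  then obtain p w u where *: "d = proj p w" "awalk u p w" "w \<in> line_points G"
    by (auto simp: projs_def)
  have w: "w \<in> verts G" using *(2) by auto
  have "(P p * V w) * (V w * (V w * Q p)) \<in> line_ideal"
    using * by (intro line_ideal_gen P_V_in_C V_Q_in_C)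
  moreover have "(P p * V w) * (V w * (V w * Q p)) = P p * ((V w * V w) * (V w * Q p))"
    by (simp add: mult.assoc)
  ultimately show "d \<in> line_ideal"
    using V_V[OF w w] *(1) by (simp add: proj_def flip: mult.assoc)
qed

lemma sum_projs_mult:
  assumes "finite D" "D \<subseteq> projs" "d \<in> D"
  shows "\<Sum>D * d = d" "d * \<Sum>D = d"
proof -
  have mem: "d' \<in> projs" if "d' \<in> D" for d' using assms(2) that by blast
  have "\<Sum>D * d = (\<Sum>d'\<in>D. if d' = d then d else 0)"
    unfolding sum_distrib_right by (intro sum.cong) (auto simp: mem proj_idem projs_orthogonal assms(3))
  then show "\<Sum>D * d = d" using assms by simp
  have "d * \<Sum>D = (\<Sum>d'\<in>D. if d' = d then d else 0)"
    unfolding sum_distrib_left by (intro sum.cong) (auto simp: mem proj_idem projs_orthogonal assms(3))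
  then show "d * \<Sum>D = d" using assms by simp
qed

definition unit_for :: "'a set \<Rightarrow> 'a \<Rightarrow> 'a \<Rightarrow> bool" where
  "unit_for D0 x y \<longleftrightarrow> finite D0 \<and> D0 \<subseteq> projs \<and>
    (\<forall>D. finite D \<longrightarrow> D0 \<subseteq> D \<longrightarrow> D \<subseteq> projs \<longrightarrow> \<Sum>D * x = x \<and> y * \<Sum>D = y)"

lemma unit_for_mono: "unit_for D x y \<Longrightarrow> D \<subseteq> D' \<Longrightarrow> finite D' \<Longrightarrow> D' \<subseteq> projs \<Longrightarrow> unit_for D' x y"
  unfolding unit_for_def by blast

lemma unit_for_zero: "unit_for {} 0 0"
  by (simp add: unit_for_def)

lemma unit_for_Un:
  assumes "unit_for D x y" "unit_for D' x' y'"
  shows "unit_for (D \<union> D') x y" "unit_for (D \<union> D') x' y'"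
  using assms by (auto intro: unit_for_mono simp: unit_for_def)

lemma unit_for_diff: "unit_for D x y \<Longrightarrow> unit_for D x' y' \<Longrightarrow> unit_for D (x - x') (y - y')"
  unfolding unit_for_def by (auto simp: right_diff_distrib left_diff_distrib)

lemma unit_for_line_mono:
  assumes "x \<in> aspan line_mono"
  shows "\<exists>D. unit_for D x x"
  using assms
proof induction
  case zero
  then show ?case using unit_for_zero by blast
next
  case (base x)
  then obtain k p w q u u' where x: "x = mono k p w q" "awalk u p w" "awalk u' q w" "w \<in> line_points G"
    by (auto simp: line_mono_def)
  have mem: "proj p w \<in> projs" "proj q w \<in> projs"
    using x by (auto simp: projs_def)
  have "proj p w * S k = S k * proj p w"
    using projs_line_ideal line_ideal_subset \<open>proj p w \<in> projs\<close> by (intro S_commute) blast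
  then have "proj p w * x = S k * (proj p w * (P p * (V w * Q q)))"
    unfolding x(1) mono_def by (metis mult.assoc)
  then have px: "proj p w * x = x"
    by (simp add: x(1) mono_def proj_P_V[OF x(2)])
  have xq: "x * proj q w = x"
    using x V_Q_proj[OF x(3)] by (simp add: mono_def mult.assoc)
  have "\<Sum>D * x = x \<and> x * \<Sum>D = x" if D: "finite D" "{proj p w, proj q w} \<subseteq> D" "D \<subseteq> projs" for D
  proof
    have "\<Sum>D * x = (\<Sum>D * proj p w) * x" using px by (simp add: mult.assoc)
    then show "\<Sum>D * x = x" using sum_projs_mult(1)[of D "proj p w"] D px by simp
    have "x * \<Sum>D = x * (proj q w * \<Sum>D)" using xq by (simp flip: mult.assoc)
    then show "x * \<Sum>D = x" using sum_projs_mult(2)[of D "proj q w"] D xq by simp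
  qed
  then have "unit_for {proj p w, proj q w} x x"
    unfolding unit_for_def using mem by simp
  then show ?case by blast
next
  case (diff x y)
  then obtain D D' where "unit_for D x x" "unit_for D' y y" by blast
  then have "unit_for (D \<union> D') (x - y) (x - y)"
    by (intro unit_for_diff unit_for_Un)
  then show ?case by blast
qed

lemma unit_for_line_ideal:
  assumes "x \<in> line_ideal"
  shows "\<exists>D. unit_for D x x"
  using assms unfolding line_ideal_def
proof induction
  case zero
  then show ?case using unit_for_zero by blast
next
  case (base x)
  then obtain a v b where x: "x = a * (V v * b)" "a \<in> C" "v \<in> line_points G" "b \<in> C" by blast
  then have v: "v \<in> verts G" by (simp add: line_points_verts)
  obtain D D' where D: "unit_for D (a * V v) (a * V v)" "unit_for D' (V v * b) (V v * b)"
    using unit_for_line_mono[OF mult_V_line_mono[OF x(2,3)]]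
      unit_for_line_mono[OF V_mult_line_mono[OF x(4,3)]] by blast
  note D'' = unit_for_Un[OF D]
  have eq: "x = a * V v * b" "x = a * (V v * b)" using x by (simp_all add: mult.assoc)
  have "unit_for (D \<union> D') x x"
    unfolding unit_for_def
  proof (intro conjI allI impI)
    show "finite (D \<union> D')" "D \<union> D' \<subseteq> projs" using D''(1) by (simp_all add: unit_for_def)
    fix F assume F: "finite F" "D \<union> D' \<subseteq> F" "F \<subseteq> projs"
    then have "\<Sum>F * (a * V v) = a * V v" using D''(1) unfolding unit_for_def by blast
    then show "\<Sum>F * x = x" by (metis eq(1) mult.assoc)
    have "V v * b * \<Sum>F = V v * b" using F D''(2) unfolding unit_for_def by blast
    then show "x * \<Sum>F = x" by (metis eq(2) mult.assoc)
  qed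
  then show ?case by blast
next
  case (diff x y)
  then obtain D D' where "unit_for D x x" "unit_for D' y y" by blast
  then have "unit_for (D \<union> D') (x - y) (x - y)"
    by (intro unit_for_diff unit_for_Un)
  then show ?case by blast
qed

lemma finite_unit_for:
  assumes "finite X" "X \<subseteq> line_ideal"
  shows "\<exists>D. finite D \<and> D \<subseteq> projs \<and> (\<forall>x\<in>X. \<Sum>D * x = x \<and> x * \<Sum>D = x)"
proof -
  have "\<exists>D. finite D \<and> D \<subseteq> projs \<and> (\<forall>x\<in>X. unit_for D x x)"
    using assms
  proof (induction X rule: finite_induct)
    case empty
    then show ?case by auto
  next
    case (insert x X)
    then obtain D where D: "finite D" "D \<subseteq> projs" "\<forall>x\<in>X. unit_for D x x" by auto
    obtain D' where D': "unit_for D' x x" using unit_for_line_ideal insert by blast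
    then have fin: "finite (D \<union> D')" "D \<union> D' \<subseteq> projs" using D by (simp_all add: unit_for_def)
    have "unit_for (D \<union> D') z z" if "z \<in> insert x X" for z
    proof (cases "z = x")
      case True
      then show ?thesis using unit_for_mono[OF D' _ fin] by simp
    next
      case False
      then have "unit_for D z z" using D(3) that by simp
      then show ?thesis using unit_for_mono[OF _ _ fin] by simp
    qed
    then show ?case using fin by blast
  qed
  then obtain D where D: "finite D" "D \<subseteq> projs" "\<forall>x\<in>X. unit_for D x x" by blast
  then have "\<Sum>D * x = x \<and> x * \<Sum>D = x" if "x \<in> X" for x
    using that by (simp add: unit_for_def)
  then show ?thesis using D by blast
qed

lemma line_corner:
  assumes D: "finite D" "D \<subseteq> projs" and e: "e = \<Sum>D"
  shows "e \<in> line_ideal" "e * e = e" "lart ((\<lambda>x. e * x * e) ` line_ideal)"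
proof -
  define B where "B = (\<lambda>x. e * x * e) ` line_ideal"
  have DI: "D \<subseteq> line_ideal" using D(2) projs_line_ideal by blast
  show eI: "e \<in> line_ideal"
    unfolding e using DI by (intro subgrp_sum subgrp_line_ideal) auto
  have ed: "e * d = d" "d * e = d" if "d \<in> D" for d
    using sum_projs_mult[OF D that] e by auto
  show ee: "e * e = e"
    unfolding e sum_distrib_left using ed(1) e by (intro sum.cong) auto
  have IC: "x \<in> line_ideal \<Longrightarrow> x \<in> C" for x using line_ideal_subset by blast
  have mI: "x * y \<in> line_ideal" if "x \<in> line_ideal" "y \<in> C" for x y
    by (rule rideal_mult[OF rideal_line_ideal that(2,1)])
  have BI: "e * x * e \<in> B" if "x \<in> line_ideal" for x using that by (simp add: B_def)
  have Be: "b \<in> line_ideal" "e * b = b" "b * e = b" if b: "b \<in> B" for b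
  proof -
    obtain x where x: "x \<in> line_ideal" "b = e * x * e" using b by (auto simp: B_def)
    then show "b \<in> line_ideal" using mI eI IC by simp
    show "e * b = b" using x(2) ee by (simp flip: mult.assoc)
    show "b * e = b" using x(2) ee by (simp add: mult.assoc)
  qed
  have B_iff: "b \<in> B" if "b \<in> line_ideal" "e * b = b" "b * e = b" for b
    using BI[OF that(1)] that by simp
  have subB: "subgrp B"
    unfolding subgrp_def
  proof (intro conjI ballI)
    show "0 \<in> B" using BI[OF subgrp_zero[OF subgrp_line_ideal]] by simp
    fix x y assume xy: "x \<in> B" "y \<in> B"
    have "x - y \<in> line_ideal" using Be(1)[OF xy(1)] Be(1)[OF xy(2)] by (rule subgrp_diff[OF subgrp_line_ideal])
    then show "x - y \<in> B"
      by (rule B_iff) (simp_all add: right_diff_distrib left_diff_distrib Be xy)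
  qed
  have BB: "x * y \<in> B" if xy: "x \<in> B" "y \<in> B" for x y
  proof (rule B_iff)
    show "x * y \<in> line_ideal" using Be(1)[OF xy(1)] IC[OF Be(1)[OF xy(2)]] by (rule mI)
    show "e * (x * y) = x * y" using Be(2)[OF xy(1)] by (simp flip: mult.assoc)
    show "x * y * e = x * y" using Be(3)[OF xy(2)] by (simp add: mult.assoc)
  qed
  have rngB: "subrng B" using subB BB by (simp add: subrng_def)
  have DB: "d \<in> B" if "d \<in> D" for d
    using that DI ed by (intro B_iff) auto
  define A where "A d = (\<lambda>b. b * d) ` B" for d
  have Al: "lideal B (A d)" if "d \<in> D" for d
    unfolding A_def by (intro lideal_image_mult rngB lideal_self DB that)
  have Asimple: "T = {0} \<or> T = A d" if d: "d \<in> D" and T: "lideal B T" "T \<subseteq> A d" for d T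
  proof (cases "T = {0}")
    case False
    then obtain y where y: "y \<in> T" "y \<noteq> 0"
      using subgrp_zero[OF lidealD(2)[OF T(1)]] by blast
    have dd: "d * d = d" using d D(2) proj_idem by blast
    have yd: "y * d = y" using y(1) T(2) dd by (auto simp: A_def mult.assoc)
    have yB: "y \<in> B" using y(1) T(1) by (auto simp: lideal_def)
    obtain p w u where p: "d = proj p w" "awalk u p w" "w \<in> line_points G"
      using d D(2) by (auto simp: projs_def)
    have w: "w \<in> verts G" using p(2) by auto
    have "y * (P p * V w) * Q p = y * d" by (simp add: p(1) proj_def mult.assoc)
    then have ne: "y * (P p * V w) \<noteq> 0" using yd y(2) by auto
    have "y * (P p * V w) * V w = y * (P p * V w)" using V_V[OF w w] by (simp add: mult.assoc)
    then obtain z where z: "z \<in> C" "z * (y * (P p * V w)) = V w"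
      using line_point_mem_left_ideal[OF p(3) _ _ ne] C_mult IC[OF Be(1)[OF yB]] P_V_in_C[OF p(2)] by blast
    define c where "c = P p * V w * z"
    have cC: "c \<in> C" unfolding c_def by (intro C_mult P_V_in_C[OF p(2)] z(1))
    have "c * y = c * (y * d)" using yd by simp
    also have "\<dots> = P p * (V w * (z * (y * (P p * V w)) * Q p))"
      by (simp add: c_def p(1) proj_def mult.assoc)
    also have "\<dots> = d" unfolding z(2) using V_V[OF w w] by (simp add: p(1) proj_def flip: mult.assoc)
    finally have cy: "c * y = d" .
    have "d * c \<in> line_ideal" using d DI cC by (auto intro: mI)
    then have bB: "e * (d * c) * e \<in> B" by (rule BI)
    have "e * (d * c) * e * y = (e * d) * (c * (e * y))" by (simp add: mult.assoc)
    also have "\<dots> = d" using ed[OF d] Be(2)[OF yB] cy dd by simp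
    finally have b_y: "e * (d * c) * e * y = d" .
    have "A d \<subseteq> T"
      unfolding A_def
    proof safe
      fix b assume b: "b \<in> B"
      have "b * d = (b * (e * (d * c) * e)) * y" using b_y by (metis mult.assoc)
      then show "b * d \<in> T"
        using lidealD(3)[OF T(1) BB[OF b bB] y(1)] by simp
    qed
    then show ?thesis using T(2) by blast
  qed simp
  have "dcc B {sum f D | f. \<forall>d\<in>D. f d \<in> A d}"
    by (rule conjunct2[OF dcc_sum]) (fact subB D(1) Al Asimple)+
  moreover have "B \<subseteq> {sum f D | f. \<forall>d\<in>D. f d \<in> A d}"
  proof
    fix b assume b: "b \<in> B"
    have "b = (\<Sum>d\<in>D. b * d)" using Be(3)[OF b] by (simp add: e sum_distrib_left)
    moreover have "\<forall>d\<in>D. b * d \<in> A d" using b by (simp add: A_def)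
    ultimately show "b \<in> {sum f D | f. \<forall>d\<in>D. f d \<in> A d}" by blast
  qed
  ultimately show "lart ((\<lambda>x. e * x * e) ` line_ideal)"
    unfolding B_def[symmetric] lart_def dcc_def by (meson lidealD(1) subset_trans)
qed

theorem locally_lart_line_ideal: "locally_lart line_ideal"
  unfolding locally_lart_def
proof (intro allI impI, elim conjE)
  fix X assume X: "finite X" "X \<subseteq> line_ideal"
  obtain D where D: "finite D" "D \<subseteq> projs" "\<forall>x\<in>X. \<Sum>D * x = x \<and> x * \<Sum>D = x"
    using finite_unit_for[OF X] by blast
  have "X \<subseteq> (\<lambda>x. \<Sum>D * x * \<Sum>D) ` line_ideal"
  proof
    fix x assume x: "x \<in> X"
    then have "x = \<Sum>D * x * \<Sum>D" using D(3) by simp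
    then show "x \<in> (\<lambda>x. \<Sum>D * x * \<Sum>D) ` line_ideal" using x X(2) by blast
  qed
  then show "\<exists>e\<in>line_ideal. e * e = e \<and> X \<subseteq> (\<lambda>x. e * x * e) ` line_ideal \<and> lart ((\<lambda>x. e * x * e) ` line_ideal)"
    using line_corner[OF D(1,2) refl] by blast
qed

end

section \<open>Additive endomorphisms\<close>

typedef (overloaded) 'a endo = "{f :: 'a::ab_group_add \<Rightarrow> 'a. \<forall>x y. f (x - y) = f x - f y}"
  morphisms app_endo Endo
  by (rule exI[of _ "\<lambda>x. x"]) simp

lemma app_endo_diff: "app_endo f (x - y) = app_endo f x - app_endo f y"
  using app_endo[of f] by simp

lemma app_endo_zero: "app_endo f 0 = 0"
  using app_endo_diff[of f 0 0] by simp

lemma app_endo_uminus: "app_endo f (- x) = - app_endo f x"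
  using app_endo_diff[of f 0 x] by (simp add: app_endo_zero)

lemma app_endo_add: "app_endo f (x + y) = app_endo f x + app_endo f y"
  using app_endo_diff[of f x "- y"] by (simp add: app_endo_uminus)

lemma endo_eqI: "(\<And>x. app_endo f x = app_endo g x) \<Longrightarrow> f = g"
  by (metis app_endo_inject ext)

instantiation endo :: (ab_group_add) ring
begin

definition "0 = Endo (\<lambda>x. 0)"
definition "f + g = Endo (\<lambda>x. app_endo f x + app_endo g x)"
definition "- f = Endo (\<lambda>x. - app_endo f x)"
definition "f - g = Endo (\<lambda>x. app_endo f x - app_endo g x)"
definition "f * g = Endo (\<lambda>x. app_endo f (app_endo g x))"

lemma app_endo_simps [simp]:
  "app_endo 0 x = 0"
  "app_endo (f + g) x = app_endo f x + app_endo g x"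
  "app_endo (- f) x = - app_endo f x"
  "app_endo (f - g) x = app_endo f x - app_endo g x"
  "app_endo (f * g) x = app_endo f (app_endo g x)"
  by (simp_all add: zero_endo_def plus_endo_def uminus_endo_def minus_endo_def times_endo_def
      Endo_inverse app_endo_diff)

instance
  by standard (rule endo_eqI, simp add: algebra_simps app_endo_add)+

end

instantiation endo :: ("{ab_group_add, zero_neq_one}") ring_1
begin

definition "1 = Endo (\<lambda>x. x)"

lemma app_endo_one [simp]: "app_endo 1 x = x"
  by (simp add: one_endo_def Endo_inverse)

instance
proof
  show "(0 :: 'a endo) \<noteq> 1"
  proof
    assume "(0 :: 'a endo) = 1"
    then have "app_endo 0 (1 :: 'a) = app_endo 1 1" by simp
    then show False by simp
  qed
qed (rule endo_eqI, simp)+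

end


section \<open>The free algebra\<close>

lemma carrier_free_algebra: "f \<in> carrier (free_algebra X) \<longleftrightarrow> keys f \<subseteq> lists X"
  by (simp add: free_algebra_def)

lemma free_algebra_simps [simp]:
  "zero (free_algebra X) = 0" "one (free_algebra X) = 1"
  "add (free_algebra X) = (+)" "mult (free_algebra X) = (*)"
  by (simp_all add: free_algebra_def)

lemma free_algebra_closed:
  fixes f g :: "'g list \<Rightarrow>\<^sub>0 'k::field"
  assumes "f \<in> carrier (free_algebra X)" "g \<in> carrier (free_algebra X)"
  shows "f + g \<in> carrier (free_algebra X)" "f * g \<in> carrier (free_algebra X)" "f - g \<in> carrier (free_algebra X)"
    "- f \<in> carrier (free_algebra X)"
proof -
  interpret ring "free_algebra X :: ('g list \<Rightarrow>\<^sub>0 'k) ring" by (rule ring_free_algebra)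
  show "f + g \<in> carrier (free_algebra X)" "f * g \<in> carrier (free_algebra X)"
    using a_closed[OF assms] m_closed[OF assms] by simp_all
  show "f - g \<in> carrier (free_algebra X)" "- f \<in> carrier (free_algebra X)"
    using assms keys_diff[of f g] unfolding carrier_free_algebra by auto
qed

lemma a_inv_free_algebra:
  fixes f :: "'g list \<Rightarrow>\<^sub>0 'k::field"
  assumes "f \<in> carrier (free_algebra X)"
  shows "\<ominus>\<^bsub>free_algebra X\<^esub> f = - f"
proof -
  interpret ring "free_algebra X :: ('g list \<Rightarrow>\<^sub>0 'k) ring" by (rule ring_free_algebra)
  show ?thesis
    using minus_equality[of "- f" f] assms free_algebra_closed(4)[OF assms assms] by simp
qed

lemma ideal_free_algebraI:
  fixes H :: "('g list \<Rightarrow>\<^sub>0 'k::field) set"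
  assumes "H \<subseteq> carrier (free_algebra X)" "subgrp H"
    "\<And>f g. f \<in> carrier (free_algebra X) \<Longrightarrow> g \<in> H \<Longrightarrow> f * g \<in> H \<and> g * f \<in> H"
  shows "ideal H (free_algebra X)"
proof -
  interpret ring "free_algebra X :: ('g list \<Rightarrow>\<^sub>0 'k) ring" by (rule ring_free_algebra)
  have "subgroup H (add_monoid (free_algebra X))"
  proof (rule add.subgroupI)
    show "H \<noteq> {}" using subgrp_zero[OF assms(2)] by auto
    show "\<ominus>\<^bsub>free_algebra X\<^esub> a \<in> H" if "a \<in> H" for a
      using that assms(1) subgrp_uminus[OF assms(2)] a_inv_free_algebra[of a X] by auto
  qed (use assms subgrp_add in auto)
  then show ?thesis
    by (intro idealI ring_free_algebra) (use assms(3) in auto)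
qed

lemma ideal_free_algebraD:
  fixes H :: "('g list \<Rightarrow>\<^sub>0 'k::field) set"
  assumes "ideal H (free_algebra X)"
  shows "H \<subseteq> carrier (free_algebra X)" "subgrp H"
    "\<And>f g. f \<in> carrier (free_algebra X) \<Longrightarrow> g \<in> H \<Longrightarrow> f * g \<in> H \<and> g * f \<in> H"
proof -
  interpret ideal H "free_algebra X" by fact
  show H: "H \<subseteq> carrier (free_algebra X)" by (rule a_subset)
  have "f - g \<in> H" if "f \<in> H" "g \<in> H" for f g
  proof -
    have "single [] (- 1) * g \<in> H"
      using I_l_closed[OF that(2), of "single [] (- 1)"] by (simp add: carrier_free_algebra)
    moreover have "single [] (- 1) = (- 1 :: 'g list \<Rightarrow>\<^sub>0 'k)"
      by (metis single_uminus single_one zero_list_def)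
    ultimately have "- g \<in> H"
      by simp
    then show ?thesis
      using additive_subgroup.a_closed[OF additive_subgroup_axioms that(1), of "- g"] by simp
  qed
  then show "subgrp H"
    using additive_subgroup.zero_closed[OF additive_subgroup_axioms] by (simp add: subgrp_def)
  show "\<And>f g. f \<in> carrier (free_algebra X) \<Longrightarrow> g \<in> H \<Longrightarrow> f * g \<in> H \<and> g * f \<in> H"
    using I_l_closed I_r_closed by simp
qed

lemma scalar_in_free_algebra: "single [] k \<in> carrier (free_algebra X)"
  by (auto simp: carrier_free_algebra)

lemma one_in_free_algebra: "1 \<in> carrier (free_algebra X)"
  by (auto simp: carrier_free_algebra zero_list_def)

lemma single_in_free_algebra: "w \<in> lists X \<Longrightarrow> single w k \<in> carrier (free_algebra X)"
  by (auto simp: carrier_free_algebra)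

lemma single_mult_single_list:
  "single u a * single w b = single (u @ w) (a * b)"
  by (simp add: mult_single plus_list_def)

lemma nonunital_subset: "nonunital_free_algebra X \<subseteq> carrier (free_algebra X)"
  unfolding nonunital_free_algebra_def free_algebra_def partial_object.select_convs by blast

lemma nonunital_mult:
  assumes "f \<in> nonunital_free_algebra X" "g \<in> carrier (free_algebra X)"
  shows "f * g \<in> nonunital_free_algebra X" "g * f \<in> nonunital_free_algebra X"
proof -
  show "f * g \<in> nonunital_free_algebra X"
    unfolding nonunital_free_algebra_def
  proof (intro CollectI subsetI)
    fix w assume "w \<in> keys (f * g)"
    then obtain u v where "w = u @ v" "u \<in> keys f" "v \<in> keys g"
      using keys_mult[of f g] by (auto simp: plus_list_def)
    with assms show "w \<in> lists X - {[]}"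
      by (auto simp: nonunital_free_algebra_def carrier_free_algebra)
  qed
  show "g * f \<in> nonunital_free_algebra X"
    unfolding nonunital_free_algebra_def
  proof (intro CollectI subsetI)
    fix w assume "w \<in> keys (g * f)"
    then obtain u v where "w = u @ v" "u \<in> keys g" "v \<in> keys f"
      using keys_mult[of g f] by (auto simp: plus_list_def)
    with assms show "w \<in> lists X - {[]}"
      by (auto simp: nonunital_free_algebra_def carrier_free_algebra)
  qed
qed

lemma subgrp_nonunital: "subgrp (nonunital_free_algebra X :: ('g list \<Rightarrow>\<^sub>0 'k::field) set)"
  unfolding subgrp_def nonunital_free_algebra_def mem_Collect_eq
proof (intro conjI ballI)
  fix f g :: "'g list \<Rightarrow>\<^sub>0 'k"
  assume "f \<in> {f. keys f \<subseteq> lists X - {[]}}" "g \<in> {f. keys f \<subseteq> lists X - {[]}}"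
  then show "keys (f - g) \<subseteq> lists X - {[]}"
    using keys_diff[of f g] by blast
qed simp

lemma nonunital_single: "w \<in> lists X \<Longrightarrow> w \<noteq> [] \<Longrightarrow> single w k \<in> nonunital_free_algebra X"
  by (auto simp: nonunital_free_algebra_def)

lemma exists_projection:
  fixes W :: "('g list \<Rightarrow>\<^sub>0 'k::field) set"
  assumes "subgrp W" "\<And>k f. f \<in> W \<Longrightarrow> single [] k * f \<in> W"
  obtains \<pi> where "\<And>x y. \<pi> (x - y) = \<pi> x - \<pi> y" "\<And>x. \<pi> x \<in> W" "\<And>x. x \<in> W \<Longrightarrow> \<pi> x = x"
proof -
  let ?s = "\<lambda>k (f :: 'g list \<Rightarrow>\<^sub>0 'k). single [] k * f"
  have one: "single [] 1 = (1 :: 'g list \<Rightarrow>\<^sub>0 'k)"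
    by (metis single_one zero_list_def)
  interpret vector_space ?s
    by unfold_locales
      (simp_all add: distrib_left distrib_right single_add one single_mult_single_list flip: mult.assoc)
  interpret pair: vector_space_pair ?s ?s ..
  have "Vector_Spaces.linear ?s ?s (\<lambda>x. x)" by (rule linear_id[unfolded id_def])
  moreover have "subspace W"
    unfolding subspace_def using assms subgrp_zero subgrp_add by blast
  ultimately obtain g where g: "range g \<subseteq> W" "Vector_Spaces.linear ?s ?s g" "\<forall>v\<in>W. g v = v"
    using pair.linear_exists_left_inverse_on[of "\<lambda>x. x" W] by auto
  interpret g: Vector_Spaces.linear ?s ?s g by fact
  show thesis
    by (rule that[of g]) (use g(1,3) g.diff in auto)
qed

subsection \<open>Faithful representation of a quotient of the free algebra\<close>

text \<open>
  With a projection \<open>\<rho>\<close> onto \<open>F\<close> and an additive map \<open>\<kappa>\<close> with kernel \<open>N\<close>, an element \<open>f\<close> of \<open>F\<close> acts on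
  the additive group of all finitely supported functions by \<open>g \<mapsto> \<kappa> (f \<rho> g)\<close>.  This realises \<open>F / N\<close>
  inside a type of class \<^class>\<open>ring_1\<close>.
\<close>

lemma exists_quotient_representation:
  fixes N :: "('g list \<Rightarrow>\<^sub>0 'k::field) set"
  assumes N: "ideal N (free_algebra X)"
  obtains \<psi> :: "('g list \<Rightarrow>\<^sub>0 'k) \<Rightarrow> ('g list \<Rightarrow>\<^sub>0 'k) endo"
  where "\<And>f g. \<psi> (f - g) = \<psi> f - \<psi> g"
    "\<And>f g. f \<in> carrier (free_algebra X) \<Longrightarrow> g \<in> carrier (free_algebra X) \<Longrightarrow> \<psi> (f * g) = \<psi> f * \<psi> g"
    "\<And>f. f \<in> carrier (free_algebra X) \<Longrightarrow> \<psi> f = 0 \<longleftrightarrow> f \<in> N"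
proof -
  let ?F = "carrier (free_algebra X) :: ('g list \<Rightarrow>\<^sub>0 'k) set"
  note N' = ideal_free_algebraD[OF N]
  have "subgrp ?F"
    unfolding subgrp_def by (auto simp: carrier_free_algebra[of 0] intro: free_algebra_closed(3))
  then obtain \<rho> where \<rho>: "\<And>x y. \<rho> (x - y) = \<rho> x - \<rho> y" "\<And>x. \<rho> x \<in> ?F" "\<And>x. x \<in> ?F \<Longrightarrow> \<rho> x = x"
    using exists_projection[of ?F] free_algebra_closed(2) scalar_in_free_algebra by metis
  obtain \<pi> where \<pi>: "\<And>x y. \<pi> (x - y) = \<pi> x - \<pi> y" "\<And>x. \<pi> x \<in> N" "\<And>x. x \<in> N \<Longrightarrow> \<pi> x = x"
    using exists_projection[of N] N'(2,3) scalar_in_free_algebra by metis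
  define \<kappa> where "\<kappa> x = x - \<pi> x" for x
  have \<kappa>_diff: "\<kappa> (x - y) = \<kappa> x - \<kappa> y" for x y by (simp add: \<kappa>_def \<pi>)
  have \<kappa>_zero: "\<kappa> x = 0 \<longleftrightarrow> x \<in> N" for x
    using \<pi>(2)[of x] \<pi>(3)[of x] by (auto simp: \<kappa>_def)
  have \<kappa>_F: "\<kappa> x \<in> ?F" if "x \<in> ?F" for x
    unfolding \<kappa>_def using that \<pi>(2)[of x] N'(1) by (intro free_algebra_closed(3)) auto
  define \<psi> where "\<psi> f = Endo (\<lambda>g. \<kappa> (f * \<rho> g))" for f
  have app: "app_endo (\<psi> f) g = \<kappa> (f * \<rho> g)" for f g
    unfolding \<psi>_def by (subst Endo_inverse) (simp_all add: \<rho> \<kappa>_diff right_diff_distrib)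
  show thesis
  proof (rule that[of \<psi>])
    show "\<psi> (f - g) = \<psi> f - \<psi> g" for f g
      by (rule endo_eqI) (simp add: app \<kappa>_diff left_diff_distrib)
    show "\<psi> (f * g) = \<psi> f * \<psi> g" if "f \<in> ?F" "g \<in> ?F" for f g
    proof (rule endo_eqI)
      fix x
      have h: "g * \<rho> x \<in> ?F" using that \<rho>(2) by (intro free_algebra_closed(2))
      have "app_endo (\<psi> f * \<psi> g) x = \<kappa> (f * \<kappa> (g * \<rho> x))"
        using \<rho>(3)[OF \<kappa>_F[OF h]] by (simp add: app)
      also have "\<dots> = \<kappa> (f * (g * \<rho> x)) - \<kappa> (f * \<pi> (g * \<rho> x))"
        by (simp add: \<kappa>_def[of "g * \<rho> x"] right_diff_distrib \<kappa>_diff)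
      also have "\<kappa> (f * \<pi> (g * \<rho> x)) = 0"
        using N'(3)[OF that(1) \<pi>(2)] \<kappa>_zero by blast
      finally show "app_endo (\<psi> (f * g)) x = app_endo (\<psi> f * \<psi> g) x"
        by (simp add: app mult.assoc)
    qed
    show "\<psi> f = 0 \<longleftrightarrow> f \<in> N" if "f \<in> ?F" for f
    proof
      assume "\<psi> f = 0"
      then have "app_endo (\<psi> f) 1 = 0" by simp
      then show "f \<in> N" using \<rho>(3)[OF one_in_free_algebra] \<kappa>_zero by (simp add: app)
    next
      assume "f \<in> N"
      then have "f * \<rho> g \<in> N" for g using N'(3)[OF \<rho>(2)] by blast
      then show "\<psi> f = 0" by (intro endo_eqI) (simp add: app \<kappa>_zero)
    qed
  qed
qed


section \<open>The Leavitt path algebra as a ring of endomorphisms\<close>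

context wf_digraph
begin

fun gen_act :: "('a, 'b) lpa_gen \<Rightarrow> (('a, 'b) bpath \<times> int \<Rightarrow>\<^sub>0 'k::field) \<Rightarrow> ('a, 'b) bpath \<times> int \<Rightarrow>\<^sub>0 'k" where
  "gen_act (Vertex v) = ext (rep_V v)"
| "gen_act (Edge e) = ext (rep_E e)"
| "gen_act (Ghost e) = ext (rep_Es e)"

definition word_act :: "('a, 'b) lpa_gen list \<Rightarrow> (('a, 'b) bpath \<times> int \<Rightarrow>\<^sub>0 'k::field) \<Rightarrow> ('a, 'b) bpath \<times> int \<Rightarrow>\<^sub>0 'k" where
  "word_act w g = foldr gen_act w g"

definition act :: "('a, 'b, 'k::field) lpa_free \<Rightarrow> (('a, 'b) bpath \<times> int \<Rightarrow>\<^sub>0 'k) \<Rightarrow> ('a, 'b) bpath \<times> int \<Rightarrow>\<^sub>0 'k" where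
  "act f g = ext (\<lambda>w. word_act w g) f"

lemma gen_act_diff: "gen_act a (g - h) = gen_act a g - gen_act a h"
  by (cases a) (simp_all add: ext_diff)

lemma gen_act_smul: "gen_act a (smul k g) = smul k (gen_act a g)"
  by (cases a) (simp_all add: ext_smul)

lemma word_act_simps: "word_act [] g = g" "word_act (a # w) g = gen_act a (word_act w g)"
  "word_act (u @ w) g = word_act u (word_act w g)"
  by (simp_all add: word_act_def)

lemma word_act_diff: "word_act w (g - h) = word_act w g - word_act w h"
  by (induction w) (simp_all add: word_act_simps gen_act_diff)

lemma word_act_smul: "word_act w (smul k g) = smul k (word_act w g)"
  by (induction w) (simp_all add: word_act_simps gen_act_smul)

lemma word_act_zero: "word_act w 0 = 0"
  using word_act_diff[of w 0 0] by simp

lemma word_act_add: "word_act w (g + h) = word_act w g + word_act w h"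
  using word_act_diff[of w "g + h" h] by (simp add: eq_diff_eq)

lemma word_act_sum: "word_act w (sum f A) = (\<Sum>i\<in>A. word_act w (f i))"
  by (induction A rule: infinite_finite_induct) (simp_all add: word_act_zero word_act_add)

lemma act_diff_left: "act (f - f') g = act f g - act f' g"
  by (simp add: act_def ext_diff)

lemma act_sum_left: "act (sum f A) g = (\<Sum>i\<in>A. act (f i) g)"
  by (simp add: act_def ext_sum)

lemma act_zero_left: "act 0 g = 0"
  by (simp add: act_def)

lemma act_diff: "act f (g - h) = act f g - act f h"
  by (simp add: act_def ext_def word_act_diff smul_diff sum_subtractf)

lemma act_zero: "act f 0 = 0"
  using act_diff[of f 0 0] by simp

lemma act_single: "act (single w k) g = smul k (word_act w g)"
  by (simp add: act_def)

lemma act_mult: "act (f * f') g = act f (act f' g)"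
proof -
  have single: "act (single u a * f') g = smul a (word_act u (act f' g))" for u a
  proof -
    have "act (single u a * f') g =
      act (\<Sum>w\<in>keys f'. single (u @ w) (a * lookup f' w)) g"
      by (subst pm_eq_sum[of f']) (simp add: sum_distrib_left single_mult_single_list)
    also have "\<dots> = smul a (word_act u (act f' g))"
      unfolding act_sum_left act_single
      by (simp add: act_def ext_def word_act_sum smul_sum word_act_smul smul_smul word_act_simps)
    finally show ?thesis .
  qed
  have "act (f * f') g = act (\<Sum>u\<in>keys f. single u (lookup f u) * f') g"
    by (subst pm_eq_sum[of f]) (simp add: sum_distrib_right)
  also have "\<dots> = act f (act f' g)"
    by (simp add: act_sum_left single) (simp add: act_def ext_def)
  finally show ?thesis .
qed

lemma lpa_relations_cases [consumes 1, case_names VV VE EV VG GV GE CK]: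
  assumes "r \<in> lpa_relations G"
  obtains
    (VV) v w where "v \<in> verts G" "w \<in> verts G" "r = lpa_V v * lpa_V w - (if v = w then lpa_V v else 0)"
  | (VE) e where "e \<in> arcs G" "r = lpa_V (tail G e) * lpa_E e - lpa_E e"
  | (EV) e where "e \<in> arcs G" "r = lpa_E e * lpa_V (head G e) - lpa_E e"
  | (VG) e where "e \<in> arcs G" "r = lpa_V (head G e) * lpa_Es e - lpa_Es e"
  | (GV) e where "e \<in> arcs G" "r = lpa_Es e * lpa_V (tail G e) - lpa_Es e"
  | (GE) e f where "e \<in> arcs G" "f \<in> arcs G" "r = lpa_Es e * lpa_E f - (if e = f then lpa_V (head G e) else 0)"
  | (CK) v where "regular G v" "r = lpa_V v - (\<Sum>e\<in>out_arcs G v. lpa_E e * lpa_Es e)"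
  using assms unfolding lpa_relations_def by blast

lemma act_relation:
  assumes "r \<in> (lpa_relations G :: ('a, 'b, 'k::field) lpa_free set)"
  shows "act r g = 0"
proof -
  have V: "act (lpa_V v) h = ext (rep_V v) h" and E: "act (lpa_E e) h = ext (rep_E e) h"
    and Es: "act (lpa_Es e) h = ext (rep_Es e) h" for v e and h :: "('a, 'b) bpath \<times> int \<Rightarrow>\<^sub>0 'k"
    by (simp_all add: act_single word_act_simps)
  have cases: "act (a - b) g = 0" if "act a g = act b g" for a b
    using that by (simp add: act_diff_left)
  from assms show ?thesis
  proof (cases rule: lpa_relations_cases)
    case (VV v w)
    have "ext (rep_V v) (ext (rep_V w) g) = (if v = w then ext (rep_V v) g else 0)"
    proof (cases "v = w")
      case True
      then show ?thesis unfolding ext_ext by (auto intro!: ext_eqI simp: rep_V_def split: prod.splits)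
    next
      case False
      then show ?thesis unfolding ext_ext
        by simp (rule ext_eq_zeroI, auto simp: rep_V_def split: prod.splits)
    qed
    then show ?thesis unfolding VV by (intro cases) (simp add: act_mult V act_zero_left)
  next
    case (VE e)
    have "ext (rep_V (tail G e)) (ext (rep_E e) g) = ext (rep_E e) g"
      unfolding ext_ext using VE(1) by (auto intro!: ext_eqI simp: rep_V_def rep_E_def valid_Step_iff split: prod.splits)
    then show ?thesis unfolding VE by (intro cases) (simp add: act_mult V E)
  next
    case (EV e)
    have "ext (rep_E e) (ext (rep_V (head G e)) g) = ext (rep_E e) g"
      unfolding ext_ext by (auto intro!: ext_eqI simp: rep_V_def rep_E_def split: prod.splits)
    then show ?thesis unfolding EV by (intro cases) (simp add: act_mult V E)
  next
    case (VG e)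
    have "ext (rep_V (head G e)) (ext (rep_Es e) g) = ext (rep_Es e) g"
      unfolding ext_ext by (auto intro!: ext_eqI simp: rep_V_def rep_Es_def valid_Step_iff split: prod.splits bpath.splits)
    then show ?thesis unfolding VG by (intro cases) (simp add: act_mult V Es)
  next
    case (GV e)
    have "ext (rep_Es e) (ext (rep_V (tail G e)) g) = ext (rep_Es e) g"
      unfolding ext_ext by (auto intro!: ext_eqI simp: rep_V_def rep_Es_def split: prod.splits bpath.splits)
    then show ?thesis unfolding GV by (intro cases) (simp add: act_mult V Es)
  next
    case (GE e f)
    have "ext (rep_Es e) (ext (rep_E f) g) = (if e = f then ext (rep_V (head G e)) g else 0)"
    proof (cases "e = f")
      case True
      then show ?thesis unfolding ext_ext using GE(1,2)
        by (auto intro!: ext_eqI simp: rep_V_def rep_E_def rep_Es_def valid_Step_iff split: prod.splits)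
    next
      case False
      then show ?thesis unfolding ext_ext
        by simp (rule ext_eq_zeroI, auto simp: rep_E_def rep_Es_def split: prod.splits)
    qed
    then show ?thesis unfolding GE by (intro cases) (simp add: act_mult V E Es act_zero_left)
  next
    case (CK v)
    have fin: "finite (out_arcs G v)" using CK by (simp add: regular_def)
    have "ext (rep_V v) g = (\<Sum>e\<in>out_arcs G v. ext (rep_E e) (ext (rep_Es e) g))"
      unfolding ext_ext ext_sum_left[symmetric]
    proof (rule ext_eqI)
      fix s :: "('a, 'b) bpath \<times> int"
      obtain x n where s: "s = (x, n)" by fastforce
      show "(rep_V v s :: _ \<Rightarrow>\<^sub>0 'k) = (\<Sum>e\<in>out_arcs G v. ext (rep_E e) (rep_Es e s))"
      proof (cases x)
        case (Stop w)
        then show ?thesis using CK(1) by (auto simp: s rep_V_def rep_Es_def valid_Stop_iff)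
      next
        case (Step f y)
        have "ext (rep_E e) (rep_Es e s) = (if e = f then rep_V v s else (0 :: _ \<Rightarrow>\<^sub>0 'k))" if "e \<in> out_arcs G v" for e
          using that by (auto simp: s Step rep_V_def rep_Es_def rep_E_def valid_Step_iff)
        then have "(\<Sum>e\<in>out_arcs G v. ext (rep_E e) (rep_Es e s)) = (if f \<in> out_arcs G v then rep_V v s else (0 :: _ \<Rightarrow>\<^sub>0 'k))"
          using fin by simp
        then show ?thesis by (auto simp: s Step rep_V_def valid_Step_iff)
      qed
    qed
    then show ?thesis unfolding CK by (intro cases) (simp add: act_sum_left act_mult V E Es)
  qed
qed

lemma act_lpa_ideal:
  assumes "f \<in> (lpa_ideal G :: ('a, 'b, 'k::field) lpa_free set)"
  shows "act f g = 0"
proof -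
  let ?F = "free_algebra (lpa_gens G) :: ('a, 'b, 'k) lpa_free ring"
  let ?K = "{f \<in> carrier ?F. \<forall>g. act f g = 0}"
  have "ideal ?K ?F"
    by (rule ideal_free_algebraI)
      (auto simp: subgrp_def act_diff_left act_mult act_zero act_zero_left free_algebra_closed carrier_free_algebra[of 0])
  moreover have "lpa_relations G \<subseteq> ?K"
    using lpa_relations_subset act_relation by (auto simp: nonunital_free_algebra_def carrier_free_algebra)
  ultimately have "lpa_ideal G \<subseteq> ?K"
    unfolding lpa_ideal_def by (intro ring.genideal_minimal ring_free_algebra)
  then show ?thesis using assms by blast
qed

lemma lpa_gens_in_free_algebra:
  "v \<in> verts G \<Longrightarrow> lpa_V v \<in> carrier (free_algebra (lpa_gens G))"
  "e \<in> arcs G \<Longrightarrow> lpa_E e \<in> carrier (free_algebra (lpa_gens G))"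
  "e \<in> arcs G \<Longrightarrow> lpa_Es e \<in> carrier (free_algebra (lpa_gens G))"
  by (auto simp: carrier_free_algebra lpa_gens_def)

lemma lpa_relations_in_ideal: "lpa_relations G \<subseteq> (lpa_ideal G :: ('a, 'b, 'k::field) lpa_free set)"
proof -
  have "lpa_relations G \<subseteq> carrier (free_algebra (lpa_gens G) :: ('a, 'b, 'k) lpa_free ring)"
    using lpa_relations_subset nonunital_subset by (rule subset_trans)
  then show ?thesis
    unfolding lpa_ideal_def by (rule ring.genideal_self[OF ring_free_algebra])
qed

lemma exists_leavitt_rep:
  obtains \<psi> :: "('a, 'b, 'k::field) lpa_free \<Rightarrow> ('a, 'b, 'k) lpa_free endo" and rep
  where "\<And>f g. \<psi> (f - g) = \<psi> f - \<psi> g"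
    "\<And>f g. f \<in> carrier (free_algebra (lpa_gens G)) \<Longrightarrow> g \<in> carrier (free_algebra (lpa_gens G)) \<Longrightarrow>
      \<psi> (f * g) = \<psi> f * \<psi> g"
    "\<And>f. f \<in> carrier (free_algebra (lpa_gens G)) \<Longrightarrow> \<psi> f = 0 \<longleftrightarrow> f \<in> lpa_ideal G"
    "leavitt_rep G (\<lambda>v. \<psi> (lpa_V v)) (\<lambda>e. \<psi> (lpa_E e)) (\<lambda>e. \<psi> (lpa_Es e)) (\<lambda>k. \<psi> (single [] k)) rep"
    "leavitt_family.C G (\<lambda>v. \<psi> (lpa_V v)) (\<lambda>e. \<psi> (lpa_E e)) (\<lambda>e. \<psi> (lpa_Es e)) (\<lambda>k. \<psi> (single [] k)) =
      \<psi> ` nonunital_free_algebra (lpa_gens G)"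
proof -
  let ?X = "lpa_gens G"
  let ?F = "carrier (free_algebra ?X) :: ('a, 'b, 'k) lpa_free set"
  let ?M = "nonunital_free_algebra ?X :: ('a, 'b, 'k) lpa_free set"
  let ?N = "lpa_ideal G :: ('a, 'b, 'k) lpa_free set"
  obtain \<psi> :: "('a, 'b, 'k) lpa_free \<Rightarrow> ('a, 'b, 'k) lpa_free endo"
    where diff: "\<And>f g. \<psi> (f - g) = \<psi> f - \<psi> g"
    and mult: "\<And>f g. f \<in> ?F \<Longrightarrow> g \<in> ?F \<Longrightarrow> \<psi> (f * g) = \<psi> f * \<psi> g"
    and kernel: "\<And>f. f \<in> ?F \<Longrightarrow> \<psi> f = 0 \<longleftrightarrow> f \<in> ?N"
    using exists_quotient_representation[OF ideal_lpa_ideal] by blast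
  have zero: "\<psi> 0 = 0" using diff[of 0 0] by simp
  have add: "\<psi> (f + g) = \<psi> f + \<psi> g" for f g using diff[of "f + g" g] by simp
  have sum: "\<psi> (sum f A) = (\<Sum>i\<in>A. \<psi> (f i))" for A :: "'c set" and f
    by (induction A rule: infinite_finite_induct) (simp_all add: zero add)
  have rel: "\<psi> f = \<psi> g" if "f - g \<in> lpa_relations G" for f g
  proof -
    have "f - g \<in> ?N" using that lpa_relations_in_ideal by blast
    moreover from this have "f - g \<in> ?F" using ideal_free_algebraD(1)[OF ideal_lpa_ideal] by blast
    ultimately have "\<psi> (f - g) = 0" using kernel by blast
    then show ?thesis using diff[of f g] by simp
  qed
  have gens: "v \<in> verts G \<Longrightarrow> lpa_V v \<in> ?F" "e \<in> arcs G \<Longrightarrow> lpa_E e \<in> ?F" "e \<in> arcs G \<Longrightarrow> lpa_Es e \<in> ?F" for v e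
    by (fact lpa_gens_in_free_algebra)+
  have scalar: "single [] k \<in> ?F" for k
    by (rule scalar_in_free_algebra)
  let ?V = "\<lambda>v. \<psi> (lpa_V v)" and ?E = "\<lambda>e. \<psi> (lpa_E e)" and ?Es = "\<lambda>e. \<psi> (lpa_Es e)"
    and ?S = "\<lambda>k. \<psi> (single [] k)"
  interpret L: leavitt_family G ?V ?E ?Es ?S
  proof unfold_locales
    fix v w assume vw: "v \<in> verts G" "w \<in> verts G"
    have "\<psi> (lpa_V v * lpa_V w) = \<psi> (if v = w then lpa_V v else 0)"
      by (rule rel) (use vw in \<open>unfold lpa_relations_def, blast\<close>)
    then show "?V v * ?V w = (if v = w then ?V v else 0)"
      using vw by (simp add: mult gens zero split: if_splits)
  next
    fix e assume e: "e \<in> arcs G"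
    have v: "tail G e \<in> verts G" "head G e \<in> verts G" using e by auto
    have "\<psi> (lpa_V (tail G e) * lpa_E e) = \<psi> (lpa_E e)"
      by (rule rel) (use e in \<open>unfold lpa_relations_def, blast\<close>)
    then show "?V (tail G e) * ?E e = ?E e" using e v by (simp add: mult gens)
    have "\<psi> (lpa_E e * lpa_V (head G e)) = \<psi> (lpa_E e)"
      by (rule rel) (use e in \<open>unfold lpa_relations_def, blast\<close>)
    then show "?E e * ?V (head G e) = ?E e" using e v by (simp add: mult gens)
    have "\<psi> (lpa_V (head G e) * lpa_Es e) = \<psi> (lpa_Es e)"
      by (rule rel) (use e in \<open>unfold lpa_relations_def, blast\<close>)
    then show "?V (head G e) * ?Es e = ?Es e" using e v by (simp add: mult gens)
    have "\<psi> (lpa_Es e * lpa_V (tail G e)) = \<psi> (lpa_Es e)"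
      by (rule rel) (use e in \<open>unfold lpa_relations_def, blast\<close>)
    then show "?Es e * ?V (tail G e) = ?Es e" using e v by (simp add: mult gens)
    fix f assume f: "f \<in> arcs G"
    have "\<psi> (lpa_Es e * lpa_E f) = \<psi> (if e = f then lpa_V (head G e) else 0)"
      by (rule rel) (use e f in \<open>unfold lpa_relations_def, blast\<close>)
    then show "?Es e * ?E f = (if e = f then ?V (head G e) else 0)"
      using e f v by (simp add: mult gens zero split: if_splits)
  next
    fix v assume v: "regular G v"
    have "\<psi> (lpa_V v) = \<psi> (\<Sum>e\<in>out_arcs G v. lpa_E e * lpa_Es e)"
      by (rule rel) (use v in \<open>unfold lpa_relations_def, blast\<close>)
    also have "\<dots> = (\<Sum>e\<in>out_arcs G v. ?E e * ?Es e)"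
      unfolding sum by (intro sum.cong) (auto simp: mult gens)
    finally show "?V v = (\<Sum>e\<in>out_arcs G v. ?E e * ?Es e)" .
  next
    fix a b :: 'k
    show "?S (a + b) = ?S a + ?S b" by (simp add: single_add add)
    show "?S (a * b) = ?S a * ?S b"
      by (simp add: mult[OF scalar scalar, symmetric] single_mult_single_list)
  next
    fix v a assume "v \<in> verts G"
    note m = mult[OF scalar gens(1)[OF this], symmetric] mult[OF gens(1)[OF this] scalar, symmetric]
    show "?S 1 * ?V v = ?V v" unfolding m by (simp add: single_mult_single_list)
    show "?S a * ?V v = ?V v * ?S a" unfolding m by (simp add: single_mult_single_list)
  next
    fix e and a :: 'k assume "e \<in> arcs G"
    note m = mult[OF scalar gens(2)[OF this], symmetric] mult[OF gens(2)[OF this] scalar, symmetric]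
      mult[OF scalar gens(3)[OF this], symmetric] mult[OF gens(3)[OF this] scalar, symmetric]
    show "?S a * ?E e = ?E e * ?S a" unfolding m by (simp add: single_mult_single_list)
    show "?S a * ?Es e = ?Es e * ?S a" unfolding m by (simp add: single_mult_single_list)
  qed
  have C: "L.C = \<psi> ` ?M"
  proof
    have subgrp: "subgrp (\<psi> ` ?M)"
      unfolding subgrp_def
    proof (intro conjI ballI)
      show "0 \<in> \<psi> ` ?M" using zero subgrp_zero[OF subgrp_nonunital] by force
      fix x y assume "x \<in> \<psi> ` ?M" "y \<in> \<psi> ` ?M"
      then obtain f g where "f \<in> ?M" "g \<in> ?M" "x = \<psi> f" "y = \<psi> g" by blast
      then show "x - y \<in> \<psi> ` ?M"
        using subgrp_diff[OF subgrp_nonunital, of f ?X g] by (simp flip: diff)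
    qed
    have step: "\<psi> f * x \<in> \<psi> ` ?M" "x * \<psi> f \<in> \<psi> ` ?M" if fx: "f \<in> ?F" "x \<in> \<psi> ` ?M" for f x
    proof -
      obtain g where g: "g \<in> ?M" "x = \<psi> g" using fx(2) by blast
      then have "g \<in> ?F" using nonunital_subset by blast
      then show "\<psi> f * x \<in> \<psi> ` ?M" "x * \<psi> f \<in> \<psi> ` ?M"
        using nonunital_mult[OF g(1) fx(1)] fx(1) by (simp_all add: g(2) flip: mult)
    qed
    have mono: "L.mono k p w q \<in> \<psi> ` ?M" if "awalk u p w" "awalk u' q w" for k p w q u u'
    proof -
      have sets: "set p \<subseteq> arcs G" "set q \<subseteq> arcs G" "w \<in> verts G" using that by auto
      have "?V w \<in> \<psi> ` ?M"
        using sets(3) by (intro imageI nonunital_single) (auto simp: lpa_gens_def)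
      then have "?V w * L.Q q \<in> \<psi> ` ?M"
        using sets(2)
      proof (induction q)
        case (Cons e q)
        then have "e \<in> arcs G" "?V w * L.Q q \<in> \<psi> ` ?M" by simp_all
        then have "?V w * L.Q q * ?Es e \<in> \<psi> ` ?M" by (intro step(2)[OF gens(3)])
        then show ?case by (simp add: L.Q_simps mult.assoc)
      qed (simp add: L.Q_simps)
      then have "L.P p * (?V w * L.Q q) \<in> \<psi> ` ?M"
        using sets(1)
      proof (induction p)
        case (Cons e p)
        then have "e \<in> arcs G" "L.P p * (?V w * L.Q q) \<in> \<psi> ` ?M" by simp_all
        then have "?E e * (L.P p * (?V w * L.Q q)) \<in> \<psi> ` ?M" by (intro step(1)[OF gens(2)])
        then show ?case by (simp add: L.P_simps mult.assoc)
      qed (simp add: L.P_simps)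
      then show ?thesis unfolding L.mono_def by (rule step(1)[OF scalar])
    qed
    show "L.C \<subseteq> \<psi> ` ?M"
      unfolding L.C_def by (rule aspan_subset[OF _ subgrp]) (use mono in blast)
    have word: "\<psi> (single w k) \<in> L.C" if "w \<in> lists ?X" "w \<noteq> []" for w k
      using that
    proof (induction w rule: list.induct)
      case (Cons a w)
      have gen: "\<psi> (single [a] 1) \<in> L.C"
      proof -
        have "a \<in> ?X" using Cons.prems by simp
        then consider v where "v \<in> verts G" "a = Vertex v" | e where "e \<in> arcs G" "a = Edge e"
          | e where "e \<in> arcs G" "a = Ghost e"
          by (auto simp: lpa_gens_def)
        then show ?thesis
          by cases (use L.V_in_C L.E_in_C L.Es_in_C in auto)
      qed
      have a: "single [a] 1 \<in> ?F" using Cons.prems by (intro single_in_free_algebra) auto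
      show ?case
      proof (cases "w = []")
        case True
        have "\<psi> (single [a] k) = ?S k * \<psi> (single [a] 1)"
          by (simp add: mult[OF scalar a, symmetric] single_mult_single_list)
        then show ?thesis using True L.S_C[OF gen] by simp
      next
        case False
        then have IH: "\<psi> (single w k) \<in> L.C" using Cons by auto
        have w: "single w k \<in> ?F" using Cons.prems by (intro single_in_free_algebra) auto
        have "\<psi> (single (a # w) k) = \<psi> (single [a] 1) * \<psi> (single w k)"
          by (simp add: mult[OF a w, symmetric] single_mult_single_list)
        then show ?thesis using L.C_mult[OF gen IH] by simp
      qed
    qed simp
    show "\<psi> ` ?M \<subseteq> L.C"
    proof safe
      fix f assume f: "f \<in> ?M"
      have "\<psi> f = (\<Sum>w\<in>keys f. \<psi> (single w (lookup f w)))"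
        by (subst pm_eq_sum[of f]) (rule sum)
      also have "\<dots> \<in> L.C"
        using f by (intro subgrp_sum L.subgrp_C word) (auto simp: nonunital_free_algebra_def)
      finally show "\<psi> f \<in> L.C" .
    qed
  qed
  define rep where "rep x = act (SOME f. f \<in> ?F \<and> \<psi> f = x)" for x
  have rep: "rep (\<psi> f) g = act f g" if f: "f \<in> ?F" for f g
  proof -
    have ex: "\<exists>f'. f' \<in> ?F \<and> \<psi> f' = \<psi> f" using f by blast
    define f' where "f' = (SOME f'. f' \<in> ?F \<and> \<psi> f' = \<psi> f)"
    have f': "f' \<in> ?F" "\<psi> f' = \<psi> f" using someI_ex[OF ex] by (simp_all add: f'_def)
    have "f' - f \<in> ?F" using f' f by (intro free_algebra_closed(3))
    moreover have "\<psi> (f' - f) = 0" using f'(2) diff[of f' f] by simp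
    ultimately have "f' - f \<in> ?N" using kernel by blast
    then have "act (f' - f) g = 0" by (rule act_lpa_ideal)
    then show ?thesis by (simp add: rep_def f'_def[symmetric] act_diff_left)
  qed
  have C_F: "\<exists>f\<in>?F. x = \<psi> f" if "x \<in> L.C" for x
    using that nonunital_subset unfolding C by blast
  have "leavitt_rep G ?V ?E ?Es ?S rep"
  proof unfold_locales
    fix x y g h assume "x \<in> L.C" "y \<in> L.C"
    then obtain f f' where f: "f \<in> ?F" "x = \<psi> f" "f' \<in> ?F" "y = \<psi> f'" using C_F by meson
    show "rep (x - y) g = rep x g - rep y g"
      using f by (simp add: rep free_algebra_closed act_diff_left flip: diff)
    show "rep (x * y) g = rep x (rep y g)"
      using f by (simp add: rep free_algebra_closed act_mult flip: mult)
  next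
    fix x g h k assume "x \<in> L.C"
    then obtain f where f: "f \<in> ?F" "x = \<psi> f" using C_F by meson
    show "rep x (g - h) = rep x g - rep x h"
      using f by (simp add: rep act_diff)
    show "rep (?S k * x) g = smul k (rep x g)"
      using f scalar[of k] by (simp add: rep free_algebra_closed act_mult act_single word_act_simps flip: mult)
  next
    fix v g assume "v \<in> verts G"
    then show "rep (?V v) g = ext (rep_V v) g"
      by (simp add: rep gens act_single word_act_simps)
  next
    fix e g assume "e \<in> arcs G"
    then show "rep (?E e) g = ext (rep_E e) g" "rep (?Es e) g = ext (rep_Es e) g"
      by (simp_all add: rep gens act_single word_act_simps)
  qed
  then show thesis
    using that[OF diff mult kernel _ C] by blast
qed

end

section \<open>Ring records embedded in a ring type\<close>

locale ring_embedding =
  fixes R :: "('x, 'm) ring_scheme" (structure) and h :: "'x \<Rightarrow> 'a::ring"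
  assumes inj: "inj_on h (carrier R)"
    and zero_in: "\<zero> \<in> carrier R" and h_zero: "h \<zero> = 0"
    and add_in: "x \<in> carrier R \<Longrightarrow> y \<in> carrier R \<Longrightarrow> x \<oplus> y \<in> carrier R"
    and h_add: "x \<in> carrier R \<Longrightarrow> y \<in> carrier R \<Longrightarrow> h (x \<oplus> y) = h x + h y"
    and mult_in: "x \<in> carrier R \<Longrightarrow> y \<in> carrier R \<Longrightarrow> x \<otimes> y \<in> carrier R"
    and h_mult: "x \<in> carrier R \<Longrightarrow> y \<in> carrier R \<Longrightarrow> h (x \<otimes> y) = h x * h y"
    and uminus_in: "x \<in> carrier R \<Longrightarrow> - h x \<in> h ` carrier R"
begin

lemma h_eq_iff: "x \<in> carrier R \<Longrightarrow> y \<in> carrier R \<Longrightarrow> h x = h y \<longleftrightarrow> x = y"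
  using inj by (auto dest: inj_onD)

lemma h_mem_iff: "x \<in> carrier R \<Longrightarrow> T \<subseteq> carrier R \<Longrightarrow> h x \<in> h ` T \<longleftrightarrow> x \<in> T"
  using inj by (auto dest: inj_onD)

lemma h_image_eq_iff: "S \<subseteq> carrier R \<Longrightarrow> T \<subseteq> carrier R \<Longrightarrow> h ` S = h ` T \<longleftrightarrow> S = T"
  using inj by (rule inj_on_image_eq_iff)

lemma h_image_subset_iff: "S \<subseteq> carrier R \<Longrightarrow> T \<subseteq> carrier R \<Longrightarrow> h ` S \<subseteq> h ` T \<longleftrightarrow> S \<subseteq> T"
  using h_mem_iff by blast

lemma h_vimage: "T \<subseteq> h ` carrier R \<Longrightarrow> h ` {x \<in> carrier R. h x \<in> T} = T"
  by auto

lemma m_inv_in: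
  assumes "x \<in> carrier R"
  shows "m_inv (add_monoid R) x \<in> carrier R \<and> h (m_inv (add_monoid R) x) = - h x"
proof -
  obtain y where y: "y \<in> carrier R" "h y = - h x" using uminus_in[OF assms] by auto
  have *: "z \<in> carrier R \<and> x \<oplus> z = \<zero> \<and> z \<oplus> x = \<zero> \<longleftrightarrow> z = y" for z
  proof
    assume z: "z \<in> carrier R \<and> x \<oplus> z = \<zero> \<and> z \<oplus> x = \<zero>"
    then have "h x + h z = 0" using h_add[of x z] assms h_zero by simp
    then have "h z = h y" using y(2) by (metis minus_unique)
    then show "z = y" using z y h_eq_iff by blast
  next
    assume "z = y"
    moreover have "h (x \<oplus> y) = h \<zero>" "h (y \<oplus> x) = h \<zero>" using y assms by (simp_all add: h_add h_zero)
    then have "x \<oplus> y = \<zero>" "y \<oplus> x = \<zero>" using y assms h_eq_iff add_in zero_in by blast+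
    ultimately show "z \<in> carrier R \<and> x \<oplus> z = \<zero> \<and> z \<oplus> x = \<zero>" using y by blast
  qed
  have "m_inv (add_monoid R) x = y"
    unfolding m_inv_def by (simp add: *)
  then show ?thesis using y by simp
qed

lemma additive_subgroup_iff:
  assumes T: "T \<subseteq> carrier R"
  shows "additive_subgroup T R \<longleftrightarrow> subgrp (h ` T)"
proof
  assume "additive_subgroup T R"
  then have s: "subgroup T (add_monoid R)" by (simp add: additive_subgroup_def)
  show "subgrp (h ` T)"
    unfolding subgrp_def
  proof (intro conjI ballI)
    show "0 \<in> h ` T" using subgroup.one_closed[OF s] h_zero by force
    fix x y assume "x \<in> h ` T" "y \<in> h ` T"
    then obtain x' y' where *: "x' \<in> T" "y' \<in> T" "x = h x'" "y = h y'" by blast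
    let ?z = "m_inv (add_monoid R) y'"
    have "?z \<in> T" using subgroup.m_inv_closed[OF s *(2)] .
    then have "x' \<oplus> ?z \<in> T" using subgroup.m_closed[OF s *(1)] by simp
    moreover have "h (x' \<oplus> ?z) = x - y"
      using m_inv_in[of y'] * T by (subst h_add) auto
    ultimately show "x - y \<in> h ` T" by (metis image_eqI)
  qed
next
  assume g: "subgrp (h ` T)"
  have "subgroup T (add_monoid R)"
  proof
    show "T \<subseteq> carrier (add_monoid R)" using T by simp
    show "\<one>\<^bsub>add_monoid R\<^esub> \<in> T"
      using subgrp_zero[OF g] zero_in h_zero h_mem_iff[OF zero_in T] by simp
  next
    fix x y assume xy: "x \<in> T" "y \<in> T"
    then have "x \<in> carrier R" "y \<in> carrier R" using T by auto
    moreover have "h x + h y \<in> h ` T" using subgrp_add[OF g] xy by blast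
    ultimately show "x \<otimes>\<^bsub>add_monoid R\<^esub> y \<in> T"
      using h_add add_in h_mem_iff[OF _ T, of "x \<oplus> y"] by simp
  next
    fix x assume x: "x \<in> T"
    then have "- h x \<in> h ` T" using subgrp_uminus[OF g] by blast
    then show "inv\<^bsub>add_monoid R\<^esub> x \<in> T"
      using m_inv_in[of x] x T h_mem_iff[OF _ T, of "m_inv (add_monoid R) x"] by auto
  qed
  then show "additive_subgroup T R" by (simp add: additive_subgroup_def)
qed

lemma left_ideal_subset: "left_ideal T R \<Longrightarrow> T \<subseteq> carrier R"
  unfolding left_ideal_def additive_subgroup_def using subgroup.subset by fastforce

lemma left_ideal_iff:
  assumes T: "T \<subseteq> carrier R"
  shows "left_ideal T R \<longleftrightarrow> lideal (h ` carrier R) (h ` T)"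
proof -
  have "r \<otimes> x \<in> T \<longleftrightarrow> h r * h x \<in> h ` T" if "r \<in> carrier R" "x \<in> T" for r x
    using that T h_mult[of r x] mult_in[of r x] h_mem_iff[OF _ T, of "r \<otimes> x"] by auto
  then show ?thesis
    using T additive_subgroup_iff[OF T] by (auto simp: left_ideal_def lideal_def)
qed

lemma right_ideal_iff:
  assumes T: "T \<subseteq> carrier R"
  shows "right_ideal T R \<longleftrightarrow> rideal (h ` carrier R) (h ` T)"
proof -
  have "x \<otimes> r \<in> T \<longleftrightarrow> h x * h r \<in> h ` T" if "r \<in> carrier R" "x \<in> T" for r x
    using that T h_mult[of x r] mult_in[of x r] h_mem_iff[OF _ T, of "x \<otimes> r"] by auto
  then show ?thesis
    using T additive_subgroup_iff[OF T] by (auto simp: right_ideal_def rideal_def)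
qed

lemma image_zero_iff: "T \<subseteq> carrier R \<Longrightarrow> h ` T = {0} \<longleftrightarrow> T = {\<zero>}"
  using h_image_eq_iff[of T "{\<zero>}"] zero_in h_zero by simp

lemma simple_left_module_iff:
  assumes S: "S \<subseteq> carrier R"
  shows "simple_left_module S R \<longleftrightarrow> lsimple (h ` carrier R) (h ` S)"
proof -
  have "r \<otimes> x \<noteq> \<zero> \<longleftrightarrow> h r * h x \<noteq> 0" if "r \<in> carrier R" "x \<in> S" for r x
    using that S h_mult[of r x] mult_in[of r x] h_eq_iff[OF _ zero_in, of "r \<otimes> x"] h_zero by auto
  then have 1: "(\<exists>r\<in>carrier R. \<exists>x\<in>S. r \<otimes> x \<noteq> \<zero>) \<longleftrightarrow> (\<exists>r\<in>h ` carrier R. \<exists>x\<in>h ` S. r * x \<noteq> 0)"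
    by blast
  have 2: "(\<forall>T. left_ideal T R \<and> T \<subseteq> S \<longrightarrow> T = {\<zero>} \<or> T = S) \<longleftrightarrow>
    (\<forall>T. lideal (h ` carrier R) T \<and> T \<subseteq> h ` S \<longrightarrow> T = {0} \<or> T = h ` S)" (is "?L \<longleftrightarrow> ?R")
  proof
    assume L: ?L
    show ?R
    proof (intro allI impI, elim conjE)
      fix T assume T: "lideal (h ` carrier R) T" "T \<subseteq> h ` S"
      define T' where "T' = {x \<in> carrier R. h x \<in> T}"
      have hT': "h ` T' = T" unfolding T'_def using lidealD(1)[OF T(1)] by (rule h_vimage)
      have T': "T' \<subseteq> carrier R" by (auto simp: T'_def)
      then have "left_ideal T' R" "T' \<subseteq> S"
        using left_ideal_iff[OF T'] T hT' h_image_subset_iff[OF T' S] by simp_all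
      then have "T' = {\<zero>} \<or> T' = S" using L by blast
      then show "T = {0} \<or> T = h ` S" using hT' h_zero by auto
    qed
  next
    assume R: ?R
    show ?L
    proof (intro allI impI, elim conjE)
      fix T assume T: "left_ideal T R" "T \<subseteq> S"
      have T': "T \<subseteq> carrier R" using T S by blast
      have "h ` T = {0} \<or> h ` T = h ` S"
        using R left_ideal_iff[OF T'] T by blast
      then show "T = {\<zero>} \<or> T = S"
        using image_zero_iff[OF T'] h_image_eq_iff[OF T' S] by blast
    qed
  qed
  show ?thesis
    unfolding simple_left_module_def lsimple_def 1 2 left_ideal_iff[OF S] ..
qed

lemma generate_image:
  assumes "X \<subseteq> carrier R"
  shows "generate (add_monoid R) X \<subseteq> carrier R \<and> h ` generate (add_monoid R) X = aspan (h ` X)"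
proof -
  have 1: "x \<in> carrier R \<and> h x \<in> aspan (h ` X)" if "x \<in> generate (add_monoid R) X" for x
    using that
  proof induction
    case one
    then show ?case using zero_in h_zero by (simp add: aspan.zero)
  next
    case (incl x)
    then show ?case using assms by (auto intro: aspan.base)
  next
    case (inv x)
    then have "x \<in> carrier R" using assms by auto
    moreover have "- h x \<in> aspan (h ` X)"
      using inv by (intro subgrp_uminus[OF subgrp_aspan] aspan.base) blast
    ultimately show ?case using m_inv_in[of x] by simp
  next
    case (eng x y)
    then show ?case using subgrp_add[OF subgrp_aspan, of "h x" "h ` X" "h y"] by (simp add: add_in h_add)
  qed
  have uminus: "\<exists>y\<in>generate (add_monoid R) X. h y = - h x" if "x \<in> generate (add_monoid R) X" for x
    using that
  proof induction
    case one
    then show ?case using generate.one[of "add_monoid R" X] h_zero by auto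
  next
    case (incl x)
    then show ?case using assms m_inv_in[of x] by (intro bexI[OF _ generate.inv]) auto
  next
    case (inv x)
    then show ?case using assms m_inv_in[of x] by (intro bexI[OF _ generate.incl]) auto
  next
    case (eng x y)
    then obtain x' y' where *: "x' \<in> generate (add_monoid R) X" "h x' = - h x"
      "y' \<in> generate (add_monoid R) X" "h y' = - h y" by blast
    have "x' \<oplus> y' \<in> generate (add_monoid R) X"
      using generate.eng[OF *(1,3)] by simp
    moreover have "h (x' \<oplus> y') = - h (x \<oplus> y)"
      using * eng.hyps 1 by (simp add: h_add)
    ultimately show ?case by auto
  qed
  have "y \<in> h ` generate (add_monoid R) X" if "y \<in> aspan (h ` X)" for y
    using that
  proof induction
    case zero
    then show ?case using generate.one[of "add_monoid R" X] h_zero by force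
  next
    case (base y)
    then show ?case using generate.incl by fastforce
  next
    case (diff x y)
    then obtain x' y' where *: "x' \<in> generate (add_monoid R) X" "x = h x'"
      "y' \<in> generate (add_monoid R) X" "y = h y'" by blast
    obtain z where z: "z \<in> generate (add_monoid R) X" "h z = - h y'" using uminus[OF *(3)] by blast
    have "x' \<oplus> z \<in> generate (add_monoid R) X" using generate.eng[OF *(1) z(1)] by simp
    moreover have "h (x' \<oplus> z) = x - y" using * z 1 by (simp add: h_add)
    ultimately show ?case by (metis image_eqI)
  qed
  with 1 show ?thesis by blast
qed

lemma semisimple_left_ideal_iff:
  assumes J: "J \<subseteq> carrier R"
  shows "semisimple_left_ideal J R \<longleftrightarrow> semisimple_lideal (h ` carrier R) (h ` J)"
proof
  assume "semisimple_left_ideal J R"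
  then obtain \<S> where S: "left_ideal J R" "\<And>S. S \<in> \<S> \<Longrightarrow> simple_left_module S R"
    "J = generate (add_monoid R) (\<Union>\<S>)"
    by (auto simp: semisimple_left_ideal_def)
  have sub: "S \<subseteq> carrier R" if "S \<in> \<S>" for S
    using S(2)[OF that] left_ideal_subset by (auto simp: simple_left_module_def)
  have "h ` J = aspan (h ` \<Union>\<S>)"
    unfolding S(3) using generate_image[of "\<Union>\<S>"] sub by blast
  also have "h ` \<Union>\<S> = \<Union>((`) h ` \<S>)" by blast
  finally show "semisimple_lideal (h ` carrier R) (h ` J)"
    unfolding semisimple_lideal_def using S(1,2) left_ideal_iff[OF J] simple_left_module_iff sub
    by (intro conjI exI[of _ "(`) h ` \<S>"]) auto
next
  assume "semisimple_lideal (h ` carrier R) (h ` J)"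
  then obtain \<S> where S: "lideal (h ` carrier R) (h ` J)" "\<And>S. S \<in> \<S> \<Longrightarrow> lsimple (h ` carrier R) S"
    "h ` J = aspan (\<Union>\<S>)"
    by (auto simp: semisimple_lideal_def)
  define \<T> where "\<T> = {T. T \<subseteq> carrier R \<and> h ` T \<in> \<S>}"
  have "S \<in> (`) h ` \<T>" if "S \<in> \<S>" for S
  proof -
    have "S \<subseteq> h ` carrier R" using S(2)[OF that] by (auto simp: lsimple_def lideal_def)
    from h_vimage[OF this] show ?thesis
      using that unfolding \<T>_def by (intro image_eqI[where x = "{x \<in> carrier R. h x \<in> S}"]) auto
  qed
  then have "(`) h ` \<T> = \<S>" by (auto simp: \<T>_def)
  then have "h ` \<Union>\<T> = \<Union>\<S>" by blast
  moreover have T: "\<Union>\<T> \<subseteq> carrier R" by (auto simp: \<T>_def)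
  ultimately have "h ` J = h ` generate (add_monoid R) (\<Union>\<T>)"
    using generate_image[OF T] S(3) by simp
  then have "J = generate (add_monoid R) (\<Union>\<T>)"
    using h_image_eq_iff[OF J] generate_image[OF T] by blast
  then show "semisimple_left_ideal J R"
    unfolding semisimple_left_ideal_def using S(1,2) left_ideal_iff[OF J] simple_left_module_iff
    by (intro conjI exI[of _ \<T>]) (auto simp: \<T>_def)
qed

lemma left_artinian_iff: "left_artinian R \<longleftrightarrow> lart (h ` carrier R)"
proof
  assume L: "left_artinian R"
  show "lart (h ` carrier R)"
    unfolding lart_def
  proof (intro allI impI)
    fix I :: "nat \<Rightarrow> 'a set"
    assume I: "\<forall>n. lideal (h ` carrier R) (I n) \<and> I (Suc n) \<subseteq> I n"
    define I' where "I' n = {x \<in> carrier R. h x \<in> I n}" for n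
    have hI': "h ` I' n = I n" for n
      unfolding I'_def using I lidealD(1) by (intro h_vimage) blast
    have I'C: "I' n \<subseteq> carrier R" for n by (auto simp: I'_def)
    have "\<forall>n. left_ideal (I' n) R \<and> I' (Suc n) \<subseteq> I' n"
      using I left_ideal_iff[OF I'C] hI' by (auto simp: I'_def)
    with L have "\<exists>n. \<forall>m\<ge>n. I' m = I' n"
      unfolding left_artinian_def by (elim allE[where x = I'] impE)
    then show "\<exists>n. \<forall>m\<ge>n. I m = I n"
      using hI' by metis
  qed
next
  assume A: "lart (h ` carrier R)"
  show "left_artinian R"
    unfolding left_artinian_def
  proof (intro allI impI)
    fix I :: "nat \<Rightarrow> 'x set"
    assume I: "\<forall>n. left_ideal (I n) R \<and> I (Suc n) \<subseteq> I n"
    then have IC: "I n \<subseteq> carrier R" for n using left_ideal_subset by blast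
    have "\<forall>n. lideal (h ` carrier R) (h ` I n) \<and> h ` I (Suc n) \<subseteq> h ` I n"
      using I left_ideal_iff[OF IC] by blast
    with A have "\<exists>n. \<forall>m\<ge>n. h ` I m = h ` I n"
      unfolding lart_def by (elim allE[where x = "\<lambda>n. h ` I n"] impE)
    then show "\<exists>n. \<forall>m\<ge>n. I m = I n"
      using h_image_eq_iff[OF IC IC] by simp
  qed
qed

lemma subrecord_embedding:
  assumes "J \<subseteq> carrier R" "subrng (h ` J)"
  shows "ring_embedding (R\<lparr>carrier := J, one := e\<rparr>) h"
proof -
  have J: "x \<in> carrier R" if "x \<in> J" for x using assms(1) that by blast
  have mem: "x \<in> J" if "h x \<in> h ` J" "x \<in> carrier R" for x
    using that h_mem_iff[OF _ assms(1)] by blast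
  have g: "subgrp (h ` J)" using assms(2) by (simp add: subrng_def)
  have 1: "inj_on h J" using inj assms(1) by (rule inj_on_subset)
  have 2: "\<zero> \<in> J" using subgrp_zero[OF g] h_zero zero_in by (intro mem) simp_all
  have 3: "x \<oplus> y \<in> J" if "x \<in> J" "y \<in> J" for x y
    using subgrp_add[OF g, of "h x" "h y"] that J by (intro mem) (simp_all add: h_add add_in)
  have 4: "x \<otimes> y \<in> J" if "x \<in> J" "y \<in> J" for x y
    using assms(2) that J by (intro mem) (simp_all add: h_mult mult_in subrng_def)
  have 5: "- h x \<in> h ` J" if "x \<in> J" for x
    using subgrp_uminus[OF g] that by blast
  show ?thesis
    by unfold_locales (simp_all add: 1 2 3 4 5 J h_zero h_add h_mult)
qed

lemma corner_image:
  assumes "J \<subseteq> carrier R" "e \<in> J"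
  shows "h ` carrier (corner (R\<lparr>carrier := J\<rparr>) e) = (\<lambda>x. h e * x * h e) ` h ` J"
    "carrier (corner (R\<lparr>carrier := J\<rparr>) e) \<subseteq> carrier R"
proof -
  have "h (e \<otimes> x \<otimes> e) = h e * h x * h e" "e \<otimes> x \<otimes> e \<in> carrier R" if "x \<in> J" for x
  proof -
    have "x \<in> carrier R" "e \<in> carrier R" using assms that by auto
    then show "h (e \<otimes> x \<otimes> e) = h e * h x * h e" "e \<otimes> x \<otimes> e \<in> carrier R"
      by (simp_all add: h_mult mult_in)
  qed
  then show "h ` carrier (corner (R\<lparr>carrier := J\<rparr>) e) = (\<lambda>x. h e * x * h e) ` h ` J"
    "carrier (corner (R\<lparr>carrier := J\<rparr>) e) \<subseteq> carrier R"
    by (auto simp: corner_def image_image)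
qed

lemma left_artinian_corner_iff:
  assumes J: "J \<subseteq> carrier R" "subrng (h ` J)" and e: "e \<in> J" "h e * h e = h e"
  shows "left_artinian (corner (R\<lparr>carrier := J\<rparr>) e) \<longleftrightarrow> lart ((\<lambda>x. h e * x * h e) ` h ` J)"
proof -
  let ?D = "carrier (corner (R\<lparr>carrier := J\<rparr>) e)"
  have "subrng (h ` ?D)"
    unfolding corner_image(1)[OF J(1) e(1)] using J(2) e by (intro subrng_corner) auto
  then have "ring_embedding (R\<lparr>carrier := ?D, one := e\<rparr>) h"
    using corner_image(2)[OF J(1) e(1)] by (intro subrecord_embedding)
  moreover have "R\<lparr>carrier := ?D, one := e\<rparr> = corner (R\<lparr>carrier := J\<rparr>) e"
    by (simp add: corner_def)
  ultimately have "ring_embedding (corner (R\<lparr>carrier := J\<rparr>) e) h"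
    by simp
  then have "left_artinian (corner (R\<lparr>carrier := J\<rparr>) e) \<longleftrightarrow> lart (h ` ?D)"
    by (rule ring_embedding.left_artinian_iff)
  then show ?thesis by (simp only: corner_image(1)[OF J(1) e(1)])
qed

lemma locally_left_artinian_iff:
  assumes J: "J \<subseteq> carrier R" "subrng (h ` J)"
  shows "locally_left_artinian (R\<lparr>carrier := J\<rparr>) \<longleftrightarrow> locally_lart (h ` J)"
proof -
  have idem: "e \<otimes> e = e \<longleftrightarrow> h e * h e = h e" if "e \<in> J" for e
    using that J(1) h_eq_iff[of "e \<otimes> e" e] by (auto simp: h_mult mult_in)
  have eq: "(e \<otimes> e = e \<and> X \<subseteq> carrier (corner (R\<lparr>carrier := J\<rparr>) e) \<and> left_artinian (corner (R\<lparr>carrier := J\<rparr>) e)) \<longleftrightarrow>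
    (h e * h e = h e \<and> h ` X \<subseteq> (\<lambda>x. h e * x * h e) ` h ` J \<and> lart ((\<lambda>x. h e * x * h e) ` h ` J))"
    if "e \<in> J" "X \<subseteq> J" for e X
    using idem[OF that(1)] left_artinian_corner_iff[OF J that(1)] that(2) J(1)
      h_image_subset_iff[of X "carrier (corner (R\<lparr>carrier := J\<rparr>) e)"] corner_image[OF J(1) that(1)]
    by auto
  show ?thesis
  proof
    assume L: "locally_left_artinian (R\<lparr>carrier := J\<rparr>)"
    show "locally_lart (h ` J)"
      unfolding locally_lart_def
    proof (intro allI impI, elim conjE)
      fix X assume X: "finite X" "X \<subseteq> h ` J"
      then obtain Y where Y: "finite Y" "Y \<subseteq> J" "X = h ` Y" by (meson finite_subset_image)
      have "finite Y \<and> Y \<subseteq> carrier (R\<lparr>carrier := J\<rparr>)" using Y by simp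
      with L have "\<exists>e\<in>carrier (R\<lparr>carrier := J\<rparr>). e \<otimes>\<^bsub>R\<lparr>carrier := J\<rparr>\<^esub> e = e \<and>
        Y \<subseteq> carrier (corner (R\<lparr>carrier := J\<rparr>) e) \<and> left_artinian (corner (R\<lparr>carrier := J\<rparr>) e)"
        unfolding locally_left_artinian_def by (elim allE[where x = Y] impE)
      then obtain e where "e \<in> J" "e \<otimes> e = e \<and> Y \<subseteq> carrier (corner (R\<lparr>carrier := J\<rparr>) e) \<and> left_artinian (corner (R\<lparr>carrier := J\<rparr>) e)"
        by auto
      then show "\<exists>e\<in>h ` J. e * e = e \<and> X \<subseteq> (\<lambda>x. e * x * e) ` h ` J \<and> lart ((\<lambda>x. e * x * e) ` h ` J)"
        using eq[of e Y] Y by blast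
    qed
  next
    assume A: "locally_lart (h ` J)"
    show "locally_left_artinian (R\<lparr>carrier := J\<rparr>)"
      unfolding locally_left_artinian_def
    proof (intro allI impI, elim conjE)
      fix X assume X: "finite X" "X \<subseteq> carrier (R\<lparr>carrier := J\<rparr>)"
      then have X': "X \<subseteq> J" "finite (h ` X)" "h ` X \<subseteq> h ` J" by auto
      with A have "\<exists>e\<in>h ` J. e * e = e \<and> h ` X \<subseteq> (\<lambda>x. e * x * e) ` h ` J \<and> lart ((\<lambda>x. e * x * e) ` h ` J)"
        unfolding locally_lart_def by blast
      then obtain e where "e \<in> J" "h e * h e = h e \<and> h ` X \<subseteq> (\<lambda>x. h e * x * h e) ` h ` J \<and> lart ((\<lambda>x. h e * x * h e) ` h ` J)"
        by blast
      then show "\<exists>e\<in>carrier (R\<lparr>carrier := J\<rparr>). e \<otimes>\<^bsub>R\<lparr>carrier := J\<rparr>\<^esub> e = e \<and>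
        X \<subseteq> carrier (corner (R\<lparr>carrier := J\<rparr>) e) \<and> left_artinian (corner (R\<lparr>carrier := J\<rparr>) e)"
        using eq[OF _ X'(1)] by auto
    qed
  qed
qed

lemma two_sided_ideal_iff:
  "T \<subseteq> carrier R \<Longrightarrow> two_sided_ideal T R \<longleftrightarrow> lideal (h ` carrier R) (h ` T) \<and> rideal (h ` carrier R) (h ` T)"
  by (simp add: two_sided_ideal_def left_ideal_iff right_ideal_iff)

lemma locally_left_artinian_ideal_iff:
  assumes J: "J \<subseteq> carrier R"
  shows "locally_left_artinian_ideal J R \<longleftrightarrow>
    lideal (h ` carrier R) (h ` J) \<and> rideal (h ` carrier R) (h ` J) \<and> locally_lart (h ` J)"
  unfolding locally_left_artinian_ideal_def two_sided_ideal_iff[OF J]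
  using locally_left_artinian_iff[OF J] subrng_lideal by blast

lemma ideal_generated_image:
  assumes X: "X \<subseteq> carrier R" and I: "lideal (h ` carrier R) I" "rideal (h ` carrier R) I" "h ` X \<subseteq> I"
    and minimal: "\<And>T. lideal (h ` carrier R) T \<Longrightarrow> rideal (h ` carrier R) T \<Longrightarrow> h ` X \<subseteq> T \<Longrightarrow> I \<subseteq> T"
  shows "ideal_generated R X \<subseteq> carrier R" "h ` ideal_generated R X = I"
proof -
  define J where "J = {x \<in> carrier R. h x \<in> I}"
  have J: "J \<subseteq> carrier R" "h ` J = I"
    unfolding J_def using h_vimage[OF lidealD(1)[OF I(1)]] by auto
  have "two_sided_ideal J R" using two_sided_ideal_iff[OF J(1)] I J(2) by simp
  moreover have "X \<subseteq> J" using X I(3) by (auto simp: J_def)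
  moreover have "J \<subseteq> T" if T: "two_sided_ideal T R" "X \<subseteq> T" for T
  proof -
    have T': "T \<subseteq> carrier R" using T(1) left_ideal_subset by (simp add: two_sided_ideal_def)
    have "I \<subseteq> h ` T" using minimal T two_sided_ideal_iff[OF T'] by blast
    then show ?thesis using J h_image_subset_iff[OF J(1) T'] by simp
  qed
  ultimately have "ideal_generated R X = J"
    unfolding ideal_generated_def by blast
  then show "ideal_generated R X \<subseteq> carrier R" "h ` ideal_generated R X = I" using J by simp_all
qed

end

context leavitt_rep
begin

theorem largest_line_ideal:
  assumes "ring_embedding R h" "h ` carrier R = C" "X \<subseteq> carrier R" "h ` X = V ` line_points G"
  shows "largest (\<lambda>J. semisimple_left_ideal J R) (ideal_generated R X) \<and>
    largest (\<lambda>J. locally_left_artinian_ideal J R) (ideal_generated R X)"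
proof -
  interpret ring_embedding R h by fact
  let ?I = "ideal_generated R X"
  have "V ` line_points G \<subseteq> line_ideal" using V_in_line_ideal by blast
  then have I: "?I \<subseteq> carrier R" "h ` ?I = line_ideal"
    using ideal_generated_image[OF assms(3), of line_ideal] lideal_line_ideal rideal_line_ideal line_ideal_minimal
    unfolding assms(2,4) by blast+
  have 1: "semisimple_left_ideal ?I R"
    unfolding semisimple_left_ideal_iff[OF I(1)] I(2) assms(2) by (rule semisimple_line_ideal)
  have 2: "locally_left_artinian_ideal ?I R"
    unfolding locally_left_artinian_ideal_iff[OF I(1)] I(2) assms(2)
    using lideal_line_ideal rideal_line_ideal locally_lart_line_ideal by blast
  have sub: "J \<subseteq> ?I" if "J \<subseteq> carrier R" "h ` J \<subseteq> line_ideal" for J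
    using that I h_image_subset_iff[OF that(1) I(1)] by simp
  have 3: "J \<subseteq> ?I" if J: "semisimple_left_ideal J R" for J
  proof -
    have JC: "J \<subseteq> carrier R" using J left_ideal_subset by (simp add: semisimple_left_ideal_def)
    then have "semisimple_lideal C (h ` J)" using semisimple_left_ideal_iff[OF JC] J assms(2) by simp
    then obtain \<S> where S: "\<forall>S\<in>\<S>. lsimple C S" "h ` J = aspan (\<Union>\<S>)"
      by (auto simp: semisimple_lideal_def)
    have "aspan (\<Union>\<S>) \<subseteq> line_ideal"
      using S(1) lsimple_subset_line_ideal by (intro aspan_subset subgrp_line_ideal) blast
    then show ?thesis using sub[OF JC] S(2) by simp
  qed
  have 4: "J \<subseteq> ?I" if J: "locally_left_artinian_ideal J R" for J
  proof -
    have JC: "J \<subseteq> carrier R"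
      using J left_ideal_subset by (simp add: locally_left_artinian_ideal_def two_sided_ideal_def)
    then show ?thesis
      using J locally_left_artinian_ideal_iff[OF JC] assms(2) locally_lart_subset_line_ideal sub by simp
  qed
  show ?thesis
    unfolding largest_def using 1 2 3 4 by blast
qed

end

section \<open>The involution\<close>

fun star_gen :: "('v, 'e) lpa_gen \<Rightarrow> ('v, 'e) lpa_gen" where
  "star_gen (Vertex v) = Vertex v"
| "star_gen (Edge e) = Ghost e"
| "star_gen (Ghost e) = Edge e"

definition star_word :: "('v, 'e) lpa_gen list \<Rightarrow> ('v, 'e) lpa_gen list" where
  "star_word w = rev (map star_gen w)"

definition star :: "('v, 'e, 'k::field) lpa_free \<Rightarrow> ('v, 'e, 'k) lpa_free" where
  "star = ext (\<lambda>w. single (star_word w) 1)"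

lemma star_gen_star_gen: "star_gen (star_gen a) = a"
  by (cases a) simp_all

lemma star_word_simps: "star_word (star_word w) = w" "star_word (u @ w) = star_word w @ star_word u"
  "star_word w = [] \<longleftrightarrow> w = []"
  by (simp_all add: star_word_def rev_map star_gen_star_gen comp_def)

lemma star_diff: "star (f - g) = star f - star g"
  by (simp add: star_def ext_diff)

lemma star_zero: "star 0 = 0"
  by (simp add: star_def)

lemma star_single: "star (single w k) = single (star_word w) k"
  by (simp add: star_def)

lemma star_sum: "star (sum f A) = (\<Sum>i\<in>A. star (f i))"
  by (simp add: star_def ext_sum)

lemma star_star: "star (star f) = f"
  by (simp add: star_def ext_ext star_word_simps ext_ident)

lemma star_eq_sum:
  "star f = (\<Sum>w\<in>keys f. single (star_word w) (lookup f w))"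
  by (simp add: star_def ext_def)

lemma star_mult: "star (f * g) = star g * star f"
proof -
  have "star (f * g) = star ((\<Sum>u\<in>keys f. single u (lookup f u)) *
    (\<Sum>w\<in>keys g. single w (lookup g w)))"
    by (simp flip: pm_eq_sum)
  also have "\<dots> = (\<Sum>u\<in>keys f. \<Sum>w\<in>keys g.
    single (star_word w @ star_word u) (lookup f u * lookup g w))"
    by (simp add: sum_product star_sum single_mult_single_list star_single star_word_simps)
  also have "\<dots> = (\<Sum>w\<in>keys g. \<Sum>u\<in>keys f.
    single (star_word w @ star_word u) (lookup g w * lookup f u))"
    by (subst sum.swap) (simp add: mult.commute)
  also have "\<dots> = star g * star f"
    by (simp add: star_eq_sum sum_product single_mult_single_list)
  finally show ?thesis .
qed

context wf_digraph
begin

lemma star_word_lists: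
  assumes "w \<in> lists (lpa_gens G)"
  shows "star_word w \<in> lists (lpa_gens G)"
proof -
  have "star_gen a \<in> lpa_gens G" if "a \<in> lpa_gens G" for a
    using that by (cases a) (auto simp: lpa_gens_def)
  with assms show ?thesis by (auto simp: star_word_def)
qed

lemma keys_star: "keys (star f) \<subseteq> star_word ` keys f"
  using keys_ext[of "\<lambda>w. single (star_word w) 1" f] by (auto simp: star_def)

lemma star_carrier: "f \<in> carrier (free_algebra (lpa_gens G)) \<Longrightarrow> star f \<in> carrier (free_algebra (lpa_gens G))"
  using keys_star[of f] star_word_lists unfolding carrier_free_algebra by blast

lemma star_nonunital:
  assumes "f \<in> nonunital_free_algebra (lpa_gens G)"
  shows "star f \<in> nonunital_free_algebra (lpa_gens G)"
  unfolding nonunital_free_algebra_def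
proof (intro CollectI subsetI)
  fix w assume "w \<in> keys (star f)"
  then obtain u where "u \<in> keys f" "w = star_word u" using keys_star[of f] by blast
  moreover from this have "u \<in> lists (lpa_gens G)" "u \<noteq> []"
    using assms unfolding nonunital_free_algebra_def by blast+
  ultimately show "w \<in> lists (lpa_gens G) - {[]}"
    using star_word_lists by (simp add: star_word_simps)
qed

lemma star_relation:
  assumes "r \<in> (lpa_relations G :: ('a, 'b, 'k::field) lpa_free set)"
  shows "star r \<in> lpa_relations G"
proof -
  have gens: "star (lpa_V v) = lpa_V v" "star (lpa_E e) = lpa_Es e" "star (lpa_Es e) = (lpa_E e :: ('a, 'b, 'k) lpa_free)" for v e
    by (simp_all add: star_single star_word_def)
  from assms show ?thesis
  proof (cases rule: lpa_relations_cases)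
    case (VV v w)
    then have "star r = lpa_V w * lpa_V v - (if w = v then lpa_V w else 0)"
      by (auto simp: star_diff star_mult gens star_zero)
    then show ?thesis unfolding lpa_relations_def using VV by blast
  next
    case (VE e)
    then have "star r = lpa_Es e * lpa_V (tail G e) - lpa_Es e"
      by (simp add: star_diff star_mult gens)
    then show ?thesis unfolding lpa_relations_def using VE by blast
  next
    case (EV e)
    then have "star r = lpa_V (head G e) * lpa_Es e - lpa_Es e"
      by (simp add: star_diff star_mult gens)
    then show ?thesis unfolding lpa_relations_def using EV by blast
  next
    case (VG e)
    then have "star r = lpa_E e * lpa_V (head G e) - lpa_E e"
      by (simp add: star_diff star_mult gens)
    then show ?thesis unfolding lpa_relations_def using VG by blast
  next
    case (GV e)
    then have "star r = lpa_V (tail G e) * lpa_E e - lpa_E e"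
      by (simp add: star_diff star_mult gens)
    then show ?thesis unfolding lpa_relations_def using GV by blast
  next
    case (GE e f)
    then have "star r = lpa_Es f * lpa_E e - (if f = e then lpa_V (head G f) else 0)"
      by (auto simp: star_diff star_mult gens star_zero)
    then show ?thesis unfolding lpa_relations_def using GE by blast
  next
    case (CK v)
    then have "star r = r"
      by (simp add: star_diff star_sum star_mult gens)
    then show ?thesis using assms by simp
  qed
qed

lemma star_lpa_ideal: "f \<in> lpa_ideal G \<Longrightarrow> star f \<in> (lpa_ideal G :: ('a, 'b, 'k::field) lpa_free set)"
proof -
  let ?F = "free_algebra (lpa_gens G) :: ('a, 'b, 'k) lpa_free ring"
  let ?N = "lpa_ideal G :: ('a, 'b, 'k) lpa_free set"
  let ?K = "{f \<in> carrier ?F. star f \<in> ?N}"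
  note N = ideal_free_algebraD[OF ideal_lpa_ideal[where ?'k = 'k]]
  have "ideal ?K ?F"
  proof (rule ideal_free_algebraI)
    show "subgrp ?K"
      unfolding subgrp_def using subgrp_zero[OF N(2)] subgrp_diff[OF N(2)]
      by (auto simp: star_diff star_zero free_algebra_closed carrier_free_algebra[of 0])
    show "f * g \<in> ?K \<and> g * f \<in> ?K" if "f \<in> carrier ?F" "g \<in> ?K" for f g
      using that N(3)[OF star_carrier[OF that(1)], of "star g"] by (simp add: star_mult free_algebra_closed)
  qed blast
  moreover have "lpa_relations G \<subseteq> ?K"
  proof
    fix r :: "('a, 'b, 'k) lpa_free" assume r: "r \<in> lpa_relations G"
    then have "star r \<in> ?N" using star_relation lpa_relations_in_ideal by blast
    moreover have "r \<in> carrier ?F" using r lpa_relations_in_ideal N(1) by blast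
    ultimately show "r \<in> ?K" by simp
  qed
  ultimately have "?N \<subseteq> ?K"
    unfolding lpa_ideal_def by (intro ring.genideal_minimal ring_free_algebra)
  then show "f \<in> lpa_ideal G \<Longrightarrow> star f \<in> ?N" by blast
qed

lemma star_lpa_ideal_iff: "star f \<in> lpa_ideal G \<longleftrightarrow> f \<in> lpa_ideal G"
  using star_lpa_ideal[of f] star_lpa_ideal[of "star f"] star_star by metis

end


section \<open>Opposite rings\<close>

definition opp :: "('x, 'm) ring_scheme \<Rightarrow> ('x, 'm) ring_scheme" where
  "opp R = R\<lparr>mult := \<lambda>x y. y \<otimes>\<^bsub>R\<^esub> x\<rparr>"

lemma opp_simps [simp]: "carrier (opp R) = carrier R" "zero (opp R) = zero R" "add (opp R) = add R"
  "x \<otimes>\<^bsub>opp R\<^esub> y = y \<otimes>\<^bsub>R\<^esub> x"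
  by (simp_all add: opp_def)

lemma additive_subgroup_opp: "additive_subgroup T (opp R) \<longleftrightarrow> additive_subgroup T R"
  by (simp add: additive_subgroup_def)

lemma left_ideal_opp: "left_ideal T (opp R) \<longleftrightarrow> right_ideal T R"
  by (simp add: left_ideal_def right_ideal_def additive_subgroup_opp)

lemma right_ideal_opp: "right_ideal T (opp R) \<longleftrightarrow> left_ideal T R"
  by (simp add: left_ideal_def right_ideal_def additive_subgroup_opp)

lemma two_sided_ideal_opp: "two_sided_ideal T (opp R) \<longleftrightarrow> two_sided_ideal T R"
  by (auto simp: two_sided_ideal_def left_ideal_opp right_ideal_opp)

lemma ideal_generated_opp: "ideal_generated (opp R) X = ideal_generated R X"
  by (simp add: ideal_generated_def two_sided_ideal_opp)

lemma semisimple_left_ideal_opp: "semisimple_left_ideal J (opp R) \<longleftrightarrow> semisimple_right_ideal J R"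
  by (simp add: semisimple_left_ideal_def semisimple_right_ideal_def simple_left_module_def
      simple_right_module_def left_ideal_opp)

lemma left_artinian_opp: "left_artinian (opp R) \<longleftrightarrow> right_artinian R"
  by (simp add: left_artinian_def right_artinian_def left_ideal_opp)

context ring_embedding
begin

lemma mult_assoc: "x \<in> carrier R \<Longrightarrow> y \<in> carrier R \<Longrightarrow> z \<in> carrier R \<Longrightarrow> (x \<otimes> y) \<otimes> z = x \<otimes> (y \<otimes> z)"
  using h_eq_iff[of "(x \<otimes> y) \<otimes> z" "x \<otimes> (y \<otimes> z)"] by (simp add: mult_in h_mult mult.assoc)

lemma corner_opp:
  assumes "J \<subseteq> carrier R" "e \<in> J"
  shows "corner (opp R\<lparr>carrier := J\<rparr>) e = opp (corner (R\<lparr>carrier := J\<rparr>) e)"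
proof -
  have "(\<lambda>x. e \<otimes> (x \<otimes> e)) ` J = (\<lambda>x. e \<otimes> x \<otimes> e) ` J"
  proof (rule image_cong)
    fix x assume "x \<in> J"
    then have "x \<in> carrier R" "e \<in> carrier R" using assms by auto
    then show "e \<otimes> (x \<otimes> e) = e \<otimes> x \<otimes> e"
      using mult_assoc[of e x e] by simp
  qed simp
  then show ?thesis by (simp add: corner_def opp_def)
qed

lemma locally_left_artinian_ideal_opp:
  "locally_left_artinian_ideal J (opp R) \<longleftrightarrow> locally_right_artinian_ideal J R"
proof (cases "J \<subseteq> carrier R")
  case True
  then show ?thesis
    unfolding locally_left_artinian_ideal_def locally_right_artinian_ideal_def
      locally_left_artinian_def locally_right_artinian_def two_sided_ideal_opp
    by (simp add: corner_opp left_artinian_opp cong: bex_cong conj_cong)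
next
  case False
  then show ?thesis
    using left_ideal_subset
    by (auto simp: locally_left_artinian_ideal_def locally_right_artinian_ideal_def two_sided_ideal_def
        left_ideal_opp right_ideal_opp)
qed

end


section \<open>The Leavitt path algebra\<close>

context wf_digraph
begin

lemma leavitt_path_algebra_simps:
  fixes K :: "'k::field itself"
  defines "F \<equiv> free_algebra (lpa_gens G) :: ('a, 'b, 'k) lpa_free ring"
    and "M \<equiv> nonunital_free_algebra (lpa_gens G) :: ('a, 'b, 'k) lpa_free set"
  shows "carrier (leavitt_path_algebra K G) = (\<lambda>f. lpa_ideal G +>\<^bsub>F\<^esub> f) ` M"
    "\<zero>\<^bsub>leavitt_path_algebra K G\<^esub> = lpa_ideal G +>\<^bsub>F\<^esub> 0"
    "\<And>f g. f \<in> carrier F \<Longrightarrow> g \<in> carrier F \<Longrightarrow>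
      (lpa_ideal G +>\<^bsub>F\<^esub> f) \<oplus>\<^bsub>leavitt_path_algebra K G\<^esub> (lpa_ideal G +>\<^bsub>F\<^esub> g) = lpa_ideal G +>\<^bsub>F\<^esub> (f + g)"
    "\<And>f g. f \<in> carrier F \<Longrightarrow> g \<in> carrier F \<Longrightarrow>
      (lpa_ideal G +>\<^bsub>F\<^esub> f) \<otimes>\<^bsub>leavitt_path_algebra K G\<^esub> (lpa_ideal G +>\<^bsub>F\<^esub> g) = lpa_ideal G +>\<^bsub>F\<^esub> (f * g)"
    "\<And>f g. f \<in> carrier F \<Longrightarrow> g \<in> carrier F \<Longrightarrow>
      lpa_ideal G +>\<^bsub>F\<^esub> f = lpa_ideal G +>\<^bsub>F\<^esub> g \<longleftrightarrow> f - g \<in> lpa_ideal G"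
proof -
  interpret ideal "lpa_ideal G :: ('a, 'b, 'k) lpa_free set" F
    unfolding F_def by (rule ideal_lpa_ideal)
  show "carrier (leavitt_path_algebra K G) = (\<lambda>f. lpa_ideal G +>\<^bsub>F\<^esub> f) ` M"
    by (simp add: leavitt_path_algebra_def Let_def F_def M_def)
  show "\<zero>\<^bsub>leavitt_path_algebra K G\<^esub> = lpa_ideal G +>\<^bsub>F\<^esub> 0"
    using a_coset_add_zero[OF a_subset] by (simp add: leavitt_path_algebra_def Let_def FactRing_def F_def)
  fix f g assume fg: "f \<in> carrier F" "g \<in> carrier F"
  show "(lpa_ideal G +>\<^bsub>F\<^esub> f) \<oplus>\<^bsub>leavitt_path_algebra K G\<^esub> (lpa_ideal G +>\<^bsub>F\<^esub> g) = lpa_ideal G +>\<^bsub>F\<^esub> (f + g)"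
    using a_rcos_sum[OF fg] by (simp add: leavitt_path_algebra_def Let_def FactRing_def F_def)
  show "(lpa_ideal G +>\<^bsub>F\<^esub> f) \<otimes>\<^bsub>leavitt_path_algebra K G\<^esub> (lpa_ideal G +>\<^bsub>F\<^esub> g) = lpa_ideal G +>\<^bsub>F\<^esub> (f * g)"
    using rcoset_mult_add[OF fg] by (simp add: leavitt_path_algebra_def Let_def FactRing_def F_def)
  have "f \<ominus>\<^bsub>F\<^esub> g = f - g"
    using fg(2) by (simp add: a_minus_def F_def a_inv_free_algebra)
  then show "lpa_ideal G +>\<^bsub>F\<^esub> f = lpa_ideal G +>\<^bsub>F\<^esub> g \<longleftrightarrow> f - g \<in> lpa_ideal G"
    using quotient_eq_iff_same_a_r_cos[OF ideal_axioms fg] by simp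
qed

lemma quotient_embedding:
  fixes \<psi> :: "('a, 'b, 'k::field) lpa_free \<Rightarrow> 'c::ring" and K :: "'k itself"
  defines "F \<equiv> free_algebra (lpa_gens G) :: ('a, 'b, 'k) lpa_free ring"
    and "M \<equiv> nonunital_free_algebra (lpa_gens G) :: ('a, 'b, 'k) lpa_free set"
  assumes diff: "\<And>f g. \<psi> (f - g) = \<psi> f - \<psi> g"
    and kernel: "\<And>f. f \<in> carrier F \<Longrightarrow> \<psi> f = 0 \<longleftrightarrow> f \<in> lpa_ideal G"
  shows "\<exists>h. (\<forall>f\<in>carrier F. h (lpa_ideal G +>\<^bsub>F\<^esub> f) = \<psi> f) \<and>
    ((\<forall>f\<in>carrier F. \<forall>g\<in>carrier F. \<psi> (f * g) = \<psi> f * \<psi> g) \<longrightarrow>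
      ring_embedding (leavitt_path_algebra K G) h) \<and>
    ((\<forall>f\<in>carrier F. \<forall>g\<in>carrier F. \<psi> (f * g) = \<psi> g * \<psi> f) \<longrightarrow>
      ring_embedding (opp (leavitt_path_algebra K G)) h)"
proof -
  let ?N = "lpa_ideal G :: ('a, 'b, 'k) lpa_free set"
  let ?L = "leavitt_path_algebra K G"
  note L = leavitt_path_algebra_simps(1-4)[where K = K, folded F_def M_def]
  have MF: "f \<in> carrier F" if "f \<in> M" for f
    using that nonunital_subset unfolding M_def F_def by blast
  have zero: "\<psi> 0 = 0" using diff[of 0 0] by simp
  have add: "\<psi> (f + g) = \<psi> f + \<psi> g" for f g using diff[of "f + g" g] by simp
  have eq: "?N +>\<^bsub>F\<^esub> f = ?N +>\<^bsub>F\<^esub> g \<longleftrightarrow> \<psi> f = \<psi> g" if fg: "f \<in> carrier F" "g \<in> carrier F" for f g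
  proof -
    have "?N +>\<^bsub>F\<^esub> f = ?N +>\<^bsub>F\<^esub> g \<longleftrightarrow> f - g \<in> ?N"
      using fg unfolding F_def by (rule leavitt_path_algebra_simps(5))
    moreover have "f - g \<in> carrier F" using fg unfolding F_def by (rule free_algebra_closed(3))
    then have "f - g \<in> ?N \<longleftrightarrow> \<psi> (f - g) = 0" using kernel by blast
    ultimately show ?thesis using diff[of f g] by simp
  qed
  define h where "h X = \<psi> (SOME f. f \<in> carrier F \<and> ?N +>\<^bsub>F\<^esub> f = X)" for X
  have h: "h (?N +>\<^bsub>F\<^esub> f) = \<psi> f" if "f \<in> carrier F" for f
  proof -
    have ex: "\<exists>g. g \<in> carrier F \<and> ?N +>\<^bsub>F\<^esub> g = ?N +>\<^bsub>F\<^esub> f" using that by blast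
    from someI_ex[OF ex] show ?thesis
      unfolding h_def using eq that by blast
  qed
  have M_add: "f + g \<in> M" and M_mult: "f * g \<in> M" and M_uminus: "- f \<in> M" if "f \<in> M" "g \<in> M" for f g
    using that subgrp_add[OF subgrp_nonunital] subgrp_uminus[OF subgrp_nonunital]
      nonunital_mult(1)[of f "lpa_gens G" g] MF
    unfolding M_def F_def by blast+
  have M_zero: "0 \<in> M" using subgrp_zero[OF subgrp_nonunital] by (simp add: M_def)
  have inj: "inj_on h (carrier ?L)"
  proof (rule inj_onI)
    fix x y assume "x \<in> carrier ?L" "y \<in> carrier ?L" "h x = h y"
    then obtain f g where "f \<in> M" "g \<in> M" "x = ?N +>\<^bsub>F\<^esub> f" "y = ?N +>\<^bsub>F\<^esub> g" "h x = h y"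
      unfolding L(1) by blast
    then show "x = y" using eq[of f g] h MF by simp
  qed
  have z: "\<zero>\<^bsub>?L\<^esub> \<in> carrier ?L" "h \<zero>\<^bsub>?L\<^esub> = 0"
    using M_zero h[OF MF[OF M_zero]] zero unfolding L(1,2) by simp_all
  have a: "x \<oplus>\<^bsub>?L\<^esub> y \<in> carrier ?L" "h (x \<oplus>\<^bsub>?L\<^esub> y) = h x + h y" "x \<otimes>\<^bsub>?L\<^esub> y \<in> carrier ?L"
    "\<exists>f g. f \<in> carrier F \<and> g \<in> carrier F \<and> h (x \<otimes>\<^bsub>?L\<^esub> y) = \<psi> (f * g) \<and> h x = \<psi> f \<and> h y = \<psi> g"
    if xy: "x \<in> carrier ?L" "y \<in> carrier ?L" for x y
  proof -
    obtain f g where f: "f \<in> M" "g \<in> M" "x = ?N +>\<^bsub>F\<^esub> f" "y = ?N +>\<^bsub>F\<^esub> g"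
      using xy unfolding L(1) by blast
    note F = MF[OF f(1)] MF[OF f(2)]
    have s: "x \<oplus>\<^bsub>?L\<^esub> y = ?N +>\<^bsub>F\<^esub> (f + g)" "x \<otimes>\<^bsub>?L\<^esub> y = ?N +>\<^bsub>F\<^esub> (f * g)"
      using f(3,4) L(3,4)[OF F] by simp_all
    show "x \<oplus>\<^bsub>?L\<^esub> y \<in> carrier ?L" "x \<otimes>\<^bsub>?L\<^esub> y \<in> carrier ?L"
      unfolding s L(1) using M_add[OF f(1,2)] M_mult[OF f(1,2)] by blast+
    have hxy: "h x = \<psi> f" "h y = \<psi> g" using f(3,4) h F by simp_all
    show "h (x \<oplus>\<^bsub>?L\<^esub> y) = h x + h y"
      unfolding s hxy using h[OF MF[OF M_add[OF f(1,2)]]] add by simp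
    show "\<exists>f g. f \<in> carrier F \<and> g \<in> carrier F \<and> h (x \<otimes>\<^bsub>?L\<^esub> y) = \<psi> (f * g) \<and> h x = \<psi> f \<and> h y = \<psi> g"
      using F hxy h[OF MF[OF M_mult[OF f(1,2)]]] unfolding s by blast
  qed
  have m: "- h x \<in> h ` carrier ?L" if x: "x \<in> carrier ?L" for x
  proof -
    obtain f where f: "f \<in> M" "x = ?N +>\<^bsub>F\<^esub> f" using x unfolding L(1) by blast
    have "\<psi> (- f) = - \<psi> f" using diff[of 0 f] zero by simp
    then have "- h x = h (?N +>\<^bsub>F\<^esub> (- f))"
      using h[OF MF[OF f(1)]] h[OF MF[OF M_uminus[OF f(1,1)]]] f(2) by simp
    then show ?thesis unfolding L(1) using M_uminus[OF f(1,1)] by blast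
  qed
  show ?thesis
  proof (intro exI conjI impI ballI)
    show "h (?N +>\<^bsub>F\<^esub> f) = \<psi> f" if "f \<in> carrier F" for f
      using that by (rule h)
  next
    assume mult: "\<forall>f\<in>carrier F. \<forall>g\<in>carrier F. \<psi> (f * g) = \<psi> f * \<psi> g"
    show "ring_embedding ?L h"
    proof
      show "h (x \<otimes>\<^bsub>?L\<^esub> y) = h x * h y" if "x \<in> carrier ?L" "y \<in> carrier ?L" for x y
        using a(4)[OF that] mult by metis
    qed (fact inj z a(1-3) m)+
  next
    assume mult: "\<forall>f\<in>carrier F. \<forall>g\<in>carrier F. \<psi> (f * g) = \<psi> g * \<psi> f"
    show "ring_embedding (opp ?L) h"
    proof (unfold_locales, unfold opp_simps)
      show "h (y \<otimes>\<^bsub>?L\<^esub> x) = h x * h y" if "x \<in> carrier ?L" "y \<in> carrier ?L" for x y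
        using a(4)[OF that(2,1)] mult by metis
      show "y \<otimes>\<^bsub>?L\<^esub> x \<in> carrier ?L" if "x \<in> carrier ?L" "y \<in> carrier ?L" for x y
        using a(3)[OF that(2,1)] .
    qed (fact inj z a(1,2) m)+
  qed
qed

end

theorem theorem3p2:
  fixes G :: "('v, 'e) pre_digraph" and K :: "'k::field itself"
  assumes "wf_digraph G"
  shows "let L = leavitt_path_algebra K G;
             I = ideal_generated L (lpa_vertex K G ` line_points G)
         in largest (\<lambda>J. semisimple_left_ideal J L) I \<and>
            largest (\<lambda>J. semisimple_right_ideal J L) I \<and>
            largest (\<lambda>J. locally_left_artinian_ideal J L) I \<and>
            largest (\<lambda>J. locally_right_artinian_ideal J L) I"
proof -
  interpret wf_digraph G by fact
  let ?F = "free_algebra (lpa_gens G) :: ('v, 'e, 'k) lpa_free ring"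
  let ?M = "nonunital_free_algebra (lpa_gens G) :: ('v, 'e, 'k) lpa_free set"
  let ?L = "leavitt_path_algebra K G"
  let ?X = "lpa_vertex K G ` line_points G"
  obtain \<psi> :: "('v, 'e, 'k) lpa_free \<Rightarrow> ('v, 'e, 'k) lpa_free endo" and rep where
    diff: "\<And>f g. \<psi> (f - g) = \<psi> f - \<psi> g" and
    mult: "\<And>f g. f \<in> carrier ?F \<Longrightarrow> g \<in> carrier ?F \<Longrightarrow> \<psi> (f * g) = \<psi> f * \<psi> g" and
    kernel: "\<And>f. f \<in> carrier ?F \<Longrightarrow> \<psi> f = 0 \<longleftrightarrow> f \<in> lpa_ideal G" and
    rep: "leavitt_rep G (\<lambda>v. \<psi> (lpa_V v)) (\<lambda>e. \<psi> (lpa_E e)) (\<lambda>e. \<psi> (lpa_Es e)) (\<lambda>k. \<psi> (single [] k)) rep" and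
    C: "leavitt_family.C G (\<lambda>v. \<psi> (lpa_V v)) (\<lambda>e. \<psi> (lpa_E e)) (\<lambda>e. \<psi> (lpa_Es e)) (\<lambda>k. \<psi> (single [] k)) =
      \<psi> ` ?M"
    by (rule exists_leavitt_rep) (rule that)
  interpret L: leavitt_rep G "\<lambda>v. \<psi> (lpa_V v)" "\<lambda>e. \<psi> (lpa_E e)" "\<lambda>e. \<psi> (lpa_Es e)"
    "\<lambda>k. \<psi> (single [] k)" rep
    by (rule rep)
  have MF: "f \<in> carrier ?F" if "f \<in> ?M" for f using that nonunital_subset by blast
  have vertex: "lpa_V v \<in> ?M" if "v \<in> line_points G" for v
    using that by (intro nonunital_single) (auto simp: lpa_gens_def line_points_def)
  have carrier_L: "carrier ?L = (\<lambda>f. lpa_ideal G +>\<^bsub>?F\<^esub> f) ` ?M"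
    by (rule leavitt_path_algebra_simps)
  have X: "?X \<subseteq> carrier ?L"
    unfolding carrier_L lpa_vertex_def using vertex by blast
  have star_M: "star ` ?M = ?M"
  proof
    show "star ` ?M \<subseteq> ?M" using star_nonunital by blast
    show "?M \<subseteq> star ` ?M"
    proof
      fix f assume "f \<in> ?M"
      then show "f \<in> star ` ?M" using star_nonunital star_star by (metis image_eqI)
    qed
  qed
  obtain h where h: "\<And>f. f \<in> carrier ?F \<Longrightarrow> h (lpa_ideal G +>\<^bsub>?F\<^esub> f) = \<psi> f" "ring_embedding ?L h"
    using quotient_embedding[of \<psi> K, OF diff kernel] mult by auto
  have "\<psi> (star (f - g)) = \<psi> (star f) - \<psi> (star g)" for f g
    by (simp add: star_diff diff)
  moreover have "\<psi> (star f) = 0 \<longleftrightarrow> f \<in> lpa_ideal G" if "f \<in> carrier ?F" for f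
    using kernel[OF star_carrier[OF that]] by (simp add: star_lpa_ideal_iff)
  moreover have "\<forall>f\<in>carrier ?F. \<forall>g\<in>carrier ?F. \<psi> (star (f * g)) = \<psi> (star g) * \<psi> (star f)"
    by (simp add: star_mult mult star_carrier)
  ultimately obtain h' where h': "\<And>f. f \<in> carrier ?F \<Longrightarrow> h' (lpa_ideal G +>\<^bsub>?F\<^esub> f) = \<psi> (star f)"
    "ring_embedding (opp ?L) h'"
    using quotient_embedding[of "\<lambda>f. \<psi> (star f)" K] by blast
  have "h ` carrier ?L = L.C"
    unfolding carrier_L C image_image using h(1) MF by (intro image_cong) auto
  moreover have "h ` ?X = (\<lambda>v. \<psi> (lpa_V v)) ` line_points G"
    unfolding lpa_vertex_def image_image using h(1) MF vertex by (intro image_cong) auto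
  ultimately have 1: "largest (\<lambda>J. semisimple_left_ideal J ?L) (ideal_generated ?L ?X) \<and>
    largest (\<lambda>J. locally_left_artinian_ideal J ?L) (ideal_generated ?L ?X)"
    using L.largest_line_ideal[OF h(2) _ X] by blast
  have "h' ` carrier (opp ?L) = (\<lambda>f. \<psi> (star f)) ` ?M"
    unfolding opp_simps carrier_L image_image using h'(1) MF by (intro image_cong) auto
  also have "\<dots> = L.C"
    unfolding C using star_M by (metis image_image)
  finally have C': "h' ` carrier (opp ?L) = L.C" .
  have "h' ` ?X = (\<lambda>v. \<psi> (lpa_V v)) ` line_points G"
    unfolding lpa_vertex_def image_image using h'(1) MF vertex
    by (intro image_cong) (auto simp: star_single star_word_def)
  then have 2: "largest (\<lambda>J. semisimple_left_ideal J (opp ?L)) (ideal_generated (opp ?L) ?X) \<and>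
    largest (\<lambda>J. locally_left_artinian_ideal J (opp ?L)) (ideal_generated (opp ?L) ?X)"
    using X by (intro L.largest_line_ideal[OF h'(2) C']) simp_all
  show ?thesis
    using 1 2 unfolding Let_def semisimple_left_ideal_opp ideal_generated_opp
      ring_embedding.locally_left_artinian_ideal_opp[OF h(2)] by blast
qed

end
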